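(* Fix $k\in\{1,\dots,d-1\}$. Let $\Sigma$ be a compact, $C^1$-smooth, $(d-k)$-dimensional submanifold of $\mathbb{R}^d$, and let $E\subset\mathbb{R}^d$ be a measurable set satisfying the $k$-GCC. Then for any $\delta>0$ and $\beta>0$ there is a constant $C>0$ such that for every $R>0$, $$\|f\|_{L^2(\mathbb{R}^d)}\le C\,\|f\|_{L^2(\mathcal{U}_\delta(E))}$$ whenever $f\in L^2(\mathbb{R}^d)$ satisfies $\operatorname{spec}(f)\subset\mathcal{U}_\beta(R\Sigma)$, where $R\Sigma=\{R x: x\in\Sigma\}$.
   Context: For $k\in\{1,\dots,d\}$, $\ell>0$, $\gamma>0$, a set $E\subset\mathbb{R}^d$ satisfies the $k$-dimensional $(\ell,\gamma)$-geometric control condition (GCC) if for every $k$-dimensional cube $Q\subset\mathbb{R}^d$ (a cube lying in some $k$-dimensional affine plane, of arbitrary position and orientation) of side-length at least $\ell$, one has $\mathcal{H}^k(Q\cap E)\ge\gamma\ell^k$, where $\mathcal{H}^k$ is $k$-dimensional Hausdorff measure. $E$ satisfies the $k$-GCC if it satisfies the $k$-dimensional $(\ell,\gamma)$-GCC for some $\ell>0,\gamma>0$. For $A\subset\mathbb{R}^d$ and $\delta>0$, $\mathcal{U}_\delta(A)$ denotes the open $\delta$-neighborhood of $A$. For $f\in L^2(\mathbb{R}^d)$, $\operatorname{spec}(f)$ denotes the support of the Fourier transform $\widehat f$. *)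

theory Defs
  imports "HOL-Analysis.Analysis"
begin

text \<open>k-dimensional Hausdorff measure (Caratheodory construction), normalised so that
  it agrees with k-dimensional Lebesgue measure on k-planes.\<close>
definition hausdorff_measure :: "nat \<Rightarrow> ('a::metric_space) set \<Rightarrow> ennreal" where
  "hausdorff_measure k A =
     (SUP \<delta>\<in>{0<..}. INF C\<in>{C :: nat \<Rightarrow> 'a set. A \<subseteq> (\<Union>j. C j) \<and>
            (\<forall>j. bounded (C j) \<and> diameter (C j) \<le> \<delta>)}.
        (\<Sum>j. ennreal (unit_ball_vol (real k) * (diameter (C j) / 2) ^ k)))"

definition kcube :: "nat \<Rightarrow> real^'d \<Rightarrow> (nat \<Rightarrow> real^'d) \<Rightarrow> real \<Rightarrow> (real^'d) set" where
  "kcube k p v L = {p + (\<Sum>i<k. t i *\<^sub>R v i) | t. \<forall>i<k. 0 \<le> t i \<and> t i \<le> L}"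

definition orthonormal_family :: "nat \<Rightarrow> (nat \<Rightarrow> real^'d) \<Rightarrow> bool" where
  "orthonormal_family k v \<longleftrightarrow> (\<forall>i<k. \<forall>j<k. v i \<bullet> v j = (if i = j then 1 else 0))"

definition GCC_params :: "nat \<Rightarrow> real \<Rightarrow> real \<Rightarrow> (real^'d) set \<Rightarrow> bool" where
  "GCC_params k l \<gamma> E \<longleftrightarrow>
     (\<forall>p v L. orthonormal_family k v \<and> L \<ge> l \<longrightarrow>
        hausdorff_measure k (kcube k p v L \<inter> E) \<ge> ennreal (\<gamma> * l ^ k))"

definition GCC :: "nat \<Rightarrow> (real^'d) set \<Rightarrow> bool" where
  "GCC k E \<longleftrightarrow> (\<exists>l>0. \<exists>\<gamma>>0. GCC_params k l \<gamma> E)"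

definition nbhd :: "real \<Rightarrow> ('a::metric_space) set \<Rightarrow> 'a set" where
  "nbhd \<delta> A = {x. \<exists>a\<in>A. dist x a < \<delta>}"

text \<open>Compact C^1 submanifold of R^d of dimension d - k (codimension k), given locally as
  the regular zero set of k C^1 functions with linearly independent gradients.\<close>
definition compact_C1_submanifold_codim :: "nat \<Rightarrow> (real^'d) set \<Rightarrow> bool" where
  "compact_C1_submanifold_codim k S \<longleftrightarrow> compact S \<and>
     (\<forall>p\<in>S. \<exists>U F G. open U \<and> p \<in> U \<and>
        (\<forall>i<k. continuous_on U (G i) \<and>
               (\<forall>x\<in>U. (F i has_derivative (\<lambda>h. G i x \<bullet> h)) (at x))) \<and>
        (\<forall>x\<in>U. \<forall>c::nat \<Rightarrow> real. (\<Sum>i<k. c i *\<^sub>R G i x) = 0 \<longrightarrow> (\<forall>i<k. c i = 0)) \<and>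
        S \<inter> U = {x\<in>U. \<forall>i<k. F i x = (0::real)})"

definition L2 :: "((real^'d) \<Rightarrow> complex) set" where
  "L2 = {f. f \<in> borel_measurable lebesgue \<and> integrable lebesgue (\<lambda>x. (cmod (f x))\<^sup>2)}"

definition L2_norm_on :: "(real^'d) set \<Rightarrow> ((real^'d) \<Rightarrow> complex) \<Rightarrow> real" where
  "L2_norm_on A f = sqrt (\<integral>x\<in>A. (cmod (f x))\<^sup>2 \<partial>lebesgue)"

definition fourier :: "((real^'d) \<Rightarrow> complex) \<Rightarrow> (real^'d) \<Rightarrow> complex" where
  "fourier \<psi> x = (\<integral>\<xi>. \<psi> \<xi> * exp (- (2 * pi * \<i>) * complex_of_real (x \<bullet> \<xi>)) \<partial>lebesgue)"

text \<open>spec f = support of the (distributional, equivalently L^2) Fourier transform of f: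
  xi is outside the support iff on some open neighbourhood V of xi, the pairing
  \<langle>f^, psi\<rangle> = \<integral> f * psi^ vanishes for all continuous psi compactly supported in V.\<close>
definition spec :: "((real^'d) \<Rightarrow> complex) \<Rightarrow> (real^'d) set" where
  "spec f = - {\<xi>. \<exists>V. open V \<and> \<xi> \<in> V \<and>
       (\<forall>\<psi>. continuous_on UNIV \<psi> \<and> (\<exists>K. compact K \<and> K \<subseteq> V \<and> (\<forall>\<eta>. \<eta> \<notin> K \<longrightarrow> \<psi> \<eta> = 0))
             \<longrightarrow> (\<integral>x. f x * fourier \<psi> x \<partial>lebesgue) = 0)}"

end

theory Submission
  imports Defs "HOL-Probability.Probability"
begin

text \<open>Only one consequence of the control condition is used: \<open>E\<close> meets every \<open>k\<close>-cube of side \<open>l\<close>.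

  If the Fourier transform of \<open>g\<close> lives in a slab that is bounded in \<open>k\<close> orthonormal directions, then a
  translate of \<open>g\<close> along these directions is, up to a small \<open>L\<^sup>2\<close> error, a finite combination of
  very short translates, because on a bounded set of frequencies \<open>cis t\<close> is uniformly approximated by
  combinations of \<open>cis (s t)\<close> with \<open>s\<close> near \<open>0\<close>. Covering space by finitely many translates of a
  neighbourhood of \<open>E\<close> gives a Logvinenko--Sereda inequality for such \<open>g\<close>.

  On a frequency ball of fixed radius \<open>M\<close>, the neighbourhood of \<open>R \<Sigma>\<close> lies in such a slab once \<open>R\<close> is
  large, since \<open>\<Sigma>\<close> is uniformly \<open>C\<^sup>1\<close>; for bounded \<open>R\<close> the whole spectrum lies in one slab. The pieces of
  \<open>f\<close> localised to balls of radius \<open>M\<close> are recombined exactly by Plancherel for the short-time Fourier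
  transform, whose window has width \<open>1 / M\<close>; the leakage out of the \<open>\<delta>\<close>-neighbourhood is absorbed
  for large \<open>M\<close>.\<close>

subsection \<open>Affine substitutions and Gaussians\<close>

text \<open>The constants must be chosen without a circle. The slab constant \<open>C1\<close>
  belongs to half-width 2 \<beta>, whatever the size of the frequency ball. It fixes the admissible
  leakage 1 / (2 \<open>C1\<close>), hence the window and its bandwidth M. Only then are the
  flatness tolerance \<beta> / D, with D = 2 \<beta> + 2 M, and the threshold for R chosen, so that
  over a ball of radius M the curvature of R \<Sigma> costs at most another \<beta>. Since position
  and direction of the slab change from piece to piece, its constant has to be uniform in the frame,
  the frequency centre and the function. All Fourier analysis takes place on L^1 \<inter> L^2, where
  the transform is an honest integral. A general f in L^2 is brought there by multiplying it with a
  dilated transform of a compactly supported bump. This widens the spectrum slightly, which is why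
  the L^1 \<inter> L^2 estimate is applied with 2 \<beta> instead of \<beta>.\<close>

lemma nn_integral_lborel_affine:
  fixes f :: "'a::euclidean_space \<Rightarrow> ennreal"
  assumes [measurable]: "f \<in> borel_measurable borel" and c: "c \<noteq> 0"
  shows "(\<integral>\<^sup>+x. f x \<partial>lborel) = ennreal (\<bar>c\<bar> ^ DIM('a)) * (\<integral>\<^sup>+x. f (t + c *\<^sub>R x) \<partial>lborel)"
  by (subst lborel_affine[OF c, of t])
     (simp add: nn_integral_density nn_integral_distr nn_integral_cmult)

lemma integrable_lborel_affine:
  fixes f :: "'a::euclidean_space \<Rightarrow> 'b::{banach, second_countable_topology}"
  assumes f: "integrable lborel f" and c: "c \<noteq> 0"
  shows "integrable lborel (\<lambda>x. f (t + c *\<^sub>R x))"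
  using f f[THEN borel_measurable_integrable] c unfolding integrable_iff_bounded
  by (subst (asm) nn_integral_lborel_affine[where c=c and t=t]) (auto simp: ennreal_mult_less_top)

lemma integrable_lborel_affine_iff:
  fixes f :: "'a::euclidean_space \<Rightarrow> 'b::{banach, second_countable_topology}"
  assumes c: "c \<noteq> 0"
  shows "integrable lborel (\<lambda>x. f (t + c *\<^sub>R x)) \<longleftrightarrow> integrable lborel f"
  using c integrable_lborel_affine[of f c t]
    integrable_lborel_affine[of "\<lambda>x. f (t + c *\<^sub>R x)" "1/c" "(-1/c) *\<^sub>R t"]
  by (auto simp: algebra_simps)

lemma integral_lborel_affine:
  fixes f :: "'a::euclidean_space \<Rightarrow> 'b::{banach, second_countable_topology}"
  assumes c: "c \<noteq> 0"
  shows "(\<integral>x. f x \<partial>lborel) = \<bar>c\<bar> ^ DIM('a) *\<^sub>R (\<integral>x. f (t + c *\<^sub>R x) \<partial>lborel)"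
proof cases
  assume f[measurable]: "integrable lborel f" then show ?thesis
    using c f f[THEN borel_measurable_integrable] integrable_lborel_affine[OF f c, of t]
    by (subst lborel_affine[OF c, of t])
       (simp add: integral_density integral_distr)
next
  assume "\<not> integrable lborel f" with c show ?thesis
    by (simp add: integrable_lborel_affine_iff not_integrable_integral_eq)
qed

text \<open>Lebesgue measure is the image of a product of one-dimensional measures under the
  coordinate map, so tensor products factor. This reduces the transform of the Gaussian to dimension
  one.\<close>

lemma integral_lborel_prod:
  fixes f :: "'a::euclidean_space \<Rightarrow> real \<Rightarrow> 'b::{real_normed_field,banach,second_countable_topology}"
  assumes f: "\<And>b. b \<in> Basis \<Longrightarrow> integrable lborel (f b)"
  shows "integrable lborel (\<lambda>x::'a. \<Prod>b\<in>Basis. f b (x \<bullet> b))"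
    and "(\<integral>x. (\<Prod>b\<in>Basis. f b (x \<bullet> b)) \<partial>lborel) = (\<Prod>b\<in>Basis. (\<integral>x. f b x \<partial>lborel))"
proof -
  interpret product_sigma_finite "\<lambda>_::'a. lborel :: real measure" by standard
  have [measurable]: "\<And>b. b \<in> Basis \<Longrightarrow> f b \<in> borel_measurable borel"
    using borel_measurable_integrable[OF f] by simp
  have eq: "(\<Prod>b\<in>Basis. f b ((\<Sum>c\<in>Basis. x c *\<^sub>R c) \<bullet> b)) = (\<Prod>b\<in>Basis. f b (x b))" for x :: "'a \<Rightarrow> real"
    by (intro prod.cong refl) (simp add: inner_sum_left_Basis)
  have "integrable (Pi\<^sub>M Basis (\<lambda>_. lborel)) (\<lambda>x. \<Prod>b\<in>Basis. f b (x b))"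
    by (intro product_integrable_prod f) auto
  then show "integrable lborel (\<lambda>x::'a. \<Prod>b\<in>Basis. f b (x \<bullet> b))"
    unfolding lborel_eq[where 'a='a] by (subst integrable_distr_eq) (auto simp: eq)
  have "(\<integral>x. (\<Prod>b\<in>Basis. f b (x b)) \<partial>Pi\<^sub>M Basis (\<lambda>_. lborel)) = (\<Prod>b\<in>Basis. (\<integral>x. f b x \<partial>lborel))"
    by (intro product_integral_prod f) auto
  then show "(\<integral>x. (\<Prod>b\<in>Basis. f b (x \<bullet> b)) \<partial>lborel) = (\<Prod>b\<in>Basis. (\<integral>x. f b x \<partial>lborel))"
    unfolding lborel_eq[where 'a='a] by (subst integral_distr) (auto simp: eq)
qed

text \<open>The Borel counterpart of \<open>fourier\<close>: integration over \<open>lborel\<close>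
  keeps parametrised integrals and Fubini arguments measurable, and \<open>cis\<close> exhibits the
  unimodular factor. \<open>fourier_eq_ft\<close> links the two.\<close>

definition ft :: "('a::euclidean_space \<Rightarrow> complex) \<Rightarrow> 'a \<Rightarrow> complex" where
  "ft f \<zeta> = (\<integral>x. f x * cis (- (2 * pi * (x \<bullet> \<zeta>))) \<partial>lborel)"

text \<open>Normalised to have integral 1 and to be its own Fourier transform.\<close>

definition gaussian :: "'a::euclidean_space \<Rightarrow> real" where
  "gaussian x = exp (- (pi * (norm x)\<^sup>2))"

text \<open>Substituting x by sqrt (2 pi) x turns the integral into the characteristic function of
  the standard normal distribution, whose value is known.\<close>

lemma gaussian_fourier_real:
  fixes s :: real
  shows "integrable lborel (\<lambda>x::real. complex_of_real (exp (- (pi * x\<^sup>2))) * cis (- (2 * pi * (x * s))))"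
    and "(\<integral>x. complex_of_real (exp (- (pi * x\<^sup>2))) * cis (- (2 * pi * (x * s))) \<partial>lborel)
           = complex_of_real (exp (- (pi * s\<^sup>2)))"
proof -
  define c where "c = sqrt (2 * pi)"
  have c: "c > 0" "c * c = 2 * pi" "c\<^sup>2 = 2 * pi" by (auto simp: c_def)
  define t where "t = - (2 * pi * s) / c"
  let ?g = "\<lambda>x. std_normal_density x *\<^sub>R iexp (t * x)"
  have int: "integrable lborel ?g"
    by (rule Bochner_Integration.integrable_bound[of _ "std_normal_density"]) (auto simp: integrable_normal_density)
  have "char std_normal_distribution t = (\<integral>x. ?g x \<partial>lborel)"
    unfolding char_def by (subst integral_density) (auto simp: normal_density_nonneg)
  then have *: "(\<integral>x. ?g x \<partial>lborel) = complex_of_real (exp (- (t^2) / 2))"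
    by (simp add: char_std_normal_distribution)
  have t2: "t\<^sup>2 / 2 = pi * s\<^sup>2"
    using c by (simp add: t_def power2_eq_square field_simps)
  have eq: "\<bar>c\<bar> *\<^sub>R ?g (0 + c * x) = complex_of_real (exp (- (pi * x\<^sup>2))) * cis (- (2 * pi * (x * s)))" for x
  proof -
    have "std_normal_density (c * x) = exp (- (pi * x\<^sup>2)) / c"
      using c by (simp add: normal_density_def c_def[symmetric] power_mult_distrib)
    then have "complex_of_real c * complex_of_real (std_normal_density (c * x)) = complex_of_real (exp (- (pi * x\<^sup>2)))"
      using c by simp
    moreover have "iexp (t * (c * x)) = cis (- (2 * pi * (x * s)))"
      using c by (simp add: t_def cis_conv_exp field_simps)
    ultimately show ?thesis using c by (simp add: scaleR_conv_of_real mult.assoc[symmetric])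
  qed
  show "integrable lborel (\<lambda>x::real. complex_of_real (exp (- (pi * x\<^sup>2))) * cis (- (2 * pi * (x * s))))"
    unfolding eq[symmetric]
    by (rule integrable_scaleR_right) (use lborel_integrable_real_affine[OF int, of c 0] c in simp)
  have "(\<integral>x. ?g x \<partial>lborel) = \<bar>c\<bar> *\<^sub>R (\<integral>x. ?g (0 + c * x) \<partial>lborel)"
    using c by (intro lborel_integral_real_affine) auto
  also have "\<dots> = (\<integral>x. complex_of_real (exp (- (pi * x\<^sup>2))) * cis (- (2 * pi * (x * s))) \<partial>lborel)"
    unfolding eq[symmetric] by (simp only: integral_scaleR_right)
  finally show "(\<integral>x. complex_of_real (exp (- (pi * x\<^sup>2))) * cis (- (2 * pi * (x * s))) \<partial>lborel)
           = complex_of_real (exp (- (pi * s\<^sup>2)))" using * t2 by simp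
qed

lemma gaussian_cis_prod:
  fixes x \<zeta> :: "'a::euclidean_space"
  shows "complex_of_real (gaussian x) * cis (- (2 * pi * (x \<bullet> \<zeta>))) =
    (\<Prod>b\<in>Basis. complex_of_real (exp (- (pi * (x \<bullet> b)\<^sup>2))) * cis (- (2 * pi * ((x \<bullet> b) * (\<zeta> \<bullet> b)))))"
proof -
  have "(norm x)\<^sup>2 = (\<Sum>b\<in>Basis. (x \<bullet> b)\<^sup>2)"
    unfolding power2_norm_eq_inner by (subst euclidean_inner) (simp add: power2_eq_square)
  then have 1: "gaussian x = (\<Prod>b\<in>Basis. exp (- (pi * (x \<bullet> b)\<^sup>2)))"
    by (simp add: gaussian_def exp_sum[symmetric] sum_distrib_left sum_negf)
  have 2: "cis (- (2 * pi * (x \<bullet> \<zeta>))) = (\<Prod>b\<in>Basis. cis (- (2 * pi * ((x \<bullet> b) * (\<zeta> \<bullet> b)))))"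
    unfolding cis_conv_exp
    by (subst exp_sum[symmetric], simp, subst euclidean_inner) (simp add: sum_distrib_left sum_negf)
  show ?thesis unfolding 1 2 by (simp add: prod.distrib)
qed

lemma ft_gaussian: "ft (\<lambda>x::'a::euclidean_space. complex_of_real (gaussian x)) \<zeta> = gaussian \<zeta>"
  unfolding ft_def gaussian_cis_prod
  by (subst integral_lborel_prod(2)[OF gaussian_fourier_real(1)], simp add: gaussian_fourier_real(2))
    (use gaussian_cis_prod[of \<zeta> 0] in simp)

lemma integrable_gaussian: "integrable lborel (gaussian :: 'a::euclidean_space \<Rightarrow> real)"
proof -
  have "integrable lborel (\<lambda>x::'a. complex_of_real (gaussian x) * cis (- (2 * pi * (x \<bullet> 0))))"
    unfolding gaussian_cis_prod by (rule integral_lborel_prod(1)[OF gaussian_fourier_real(1)])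
  then show ?thesis by (simp add: complex_of_real_integrable_eq)
qed

lemma integral_gaussian: "(\<integral>x. gaussian (x::'a::euclidean_space) \<partial>lborel) = 1"
proof -
  have "complex_of_real (\<integral>x. gaussian (x::'a) \<partial>lborel) = 1"
    using ft_gaussian[of "0::'a"] by (simp add: ft_def gaussian_def)
  then show ?thesis using of_real_eq_1_iff by blast
qed

lemma gaussian_measurable [measurable]: "(gaussian :: 'a::euclidean_space \<Rightarrow> real) \<in> borel_measurable borel"
  unfolding gaussian_def by measurable

subsection \<open>Fourier transform, convolution and translations\<close>

lemma measurable_cis [measurable]: "cis \<in> borel_measurable borel"
  by (intro borel_measurable_continuous_onI) (auto intro: continuous_intros)

lemma integrable_mult_cis:
  fixes f :: "'a::euclidean_space \<Rightarrow> complex"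
  assumes "integrable lborel f" and [measurable]: "t \<in> borel_measurable borel"
  shows "integrable lborel (\<lambda>x. f x * cis (t x))"
proof -
  have [measurable]: "f \<in> borel_measurable borel" using assms(1) by auto
  show ?thesis
    by (rule Bochner_Integration.integrable_bound[OF assms(1)]) (auto simp: norm_mult)
qed

lemma norm_ft_le:
  fixes f :: "'a::euclidean_space \<Rightarrow> complex"
  shows "norm (ft f \<zeta>) \<le> (\<integral>x. norm (f x) \<partial>lborel)"
  unfolding ft_def by (rule order_trans[OF integral_norm_bound]) (simp add: norm_mult)

lemma ft_measurable [measurable]:
  fixes f :: "'a::euclidean_space \<Rightarrow> complex"
  assumes [measurable]: "f \<in> borel_measurable borel"
  shows "ft f \<in> borel_measurable borel"
  unfolding ft_def by measurable

text \<open>The multiplication formula: both sides are iterated integrals of one kernel. It lets the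
  transform move onto a Gaussian, and so takes the place of Fourier inversion in the proof of
  Plancherel.\<close>

lemma ft_mult_integral:
  fixes f g :: "'a::euclidean_space \<Rightarrow> complex"
  assumes f: "integrable lborel f" and g: "integrable lborel g"
  shows "(\<integral>x. ft f x * g x \<partial>lborel) = (\<integral>x. f x * ft g x \<partial>lborel)"
proof -
  have [measurable]: "f \<in> borel_measurable borel" "g \<in> borel_measurable borel" using f g by auto
  let ?h = "\<lambda>x y. f y * g x * cis (- (2 * pi * (x \<bullet> y)))"
  have int: "integrable (lborel \<Otimes>\<^sub>M lborel) (\<lambda>(x, y). ?h x y)"
  proof (rule lborel_pair.Fubini_integrable)
    show "integrable lborel (\<lambda>x. \<integral>y. norm (case (x, y) of (x, y) \<Rightarrow> ?h x y) \<partial>lborel)"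
      using f g by (simp add: norm_mult)
    show "AE x in lborel. integrable lborel (\<lambda>y. case (x, y) of (x, y) \<Rightarrow> ?h x y)"
      using f by (auto intro!: AE_I2 integrable_mult_cis)
  qed measurable
  have "(\<integral>x. ft f x * g x \<partial>lborel) = (\<integral>x. (\<integral>y. ?h x y \<partial>lborel) \<partial>lborel)"
    unfolding ft_def by (subst integral_mult_left_zero[symmetric]) (simp add: inner_commute mult_ac)
  also have "\<dots> = (\<integral>y. (\<integral>x. ?h x y \<partial>lborel) \<partial>lborel)"
    by (rule lborel_pair.Fubini_integral[OF int, symmetric])
  also have "\<dots> = (\<integral>x. f x * ft g x \<partial>lborel)"
    unfolding ft_def by (subst integral_mult_right_zero[symmetric]) (simp add: inner_commute mult_ac)
  finally show ?thesis .
qed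

definition conv :: "('a::euclidean_space \<Rightarrow> complex) \<Rightarrow> ('a \<Rightarrow> complex) \<Rightarrow> 'a \<Rightarrow> complex" where
  "conv f k x = (\<integral>y. f y * k (x - y) \<partial>lborel)"

lemma integrable_lborel_shift:
  fixes f :: "'a::euclidean_space \<Rightarrow> 'b::{banach, second_countable_topology}"
  assumes "integrable lborel f"
  shows "integrable lborel (\<lambda>x. f (x + a))" "integrable lborel (\<lambda>x. f (x - a))" "integrable lborel (\<lambda>x. f (a - x))"
  using integrable_lborel_affine[OF assms, of 1 a] integrable_lborel_affine[OF assms, of 1 "-a"]
    integrable_lborel_affine[OF assms, of "-1" a] by (simp_all add: add.commute)

lemma integral_lborel_shift:
  fixes f :: "'a::euclidean_space \<Rightarrow> 'b::{banach, second_countable_topology}"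
  shows "(\<integral>x. f (x + a) \<partial>lborel) = (\<integral>x. f x \<partial>lborel)" "(\<integral>x. f (x - a) \<partial>lborel) = (\<integral>x. f x \<partial>lborel)"
    "(\<integral>x. f (a - x) \<partial>lborel) = (\<integral>x. f x \<partial>lborel)"
  using integral_lborel_affine[of 1 f a] integral_lborel_affine[of 1 f "-a"]
    integral_lborel_affine[of "-1" f a] by (simp_all add: add.commute)

lemma conv_measurable [measurable]:
  assumes [measurable]: "f \<in> borel_measurable borel" "k \<in> borel_measurable borel"
  shows "conv f k \<in> borel_measurable (borel :: 'a::euclidean_space measure)"
  unfolding conv_def by measurable

lemma
  fixes f k :: "'a::euclidean_space \<Rightarrow> complex"
  assumes f: "integrable lborel f" and k: "integrable lborel k"
  shows integrable_conv: "integrable lborel (conv f k)"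
    and ft_conv: "ft (conv f k) \<zeta> = ft f \<zeta> * ft k \<zeta>"
proof -
  have [measurable]: "f \<in> borel_measurable borel" "k \<in> borel_measurable borel" using f k by auto
  \<comment> \<open>The phase is carried along for every \<zeta>: the case \<zeta> = 0 gives
    integrability of the convolution, the general case the exchange of integrals in its
    transform.\<close>
  have int: "integrable (lborel \<Otimes>\<^sub>M lborel) (\<lambda>(y, x). f y * k (x - y) * cis (- (2 * pi * (x \<bullet> \<zeta>))))" (is "integrable _ (\<lambda>(y,x). ?h y x)") for \<zeta>
  proof (rule lborel_pair.Fubini_integrable)
    show "integrable lborel (\<lambda>y. \<integral>x. norm (case (y, x) of (y, x) \<Rightarrow> ?h y x) \<partial>lborel)"
      using f integral_lborel_shift(2)[of "\<lambda>x. norm (k x)"] by (simp add: norm_mult)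
    show "AE y in lborel. integrable lborel (\<lambda>x. case (y, x) of (y, x) \<Rightarrow> ?h y x)"
      using integrable_lborel_shift(2)[OF k] by (auto intro!: AE_I2 integrable_mult_cis)
  qed measurable
  show "integrable lborel (conv f k)"
    using lborel_pair.integrable_snd[OF int[of 0]] unfolding conv_def[abs_def] by simp
  have "ft (conv f k) \<zeta> = (\<integral>x. \<integral>y. f y * k (x - y) * cis (- (2 * pi * (x \<bullet> \<zeta>))) \<partial>lborel \<partial>lborel)"
    unfolding ft_def conv_def by simp
  also have "\<dots> = (\<integral>y. \<integral>x. f y * k (x - y) * cis (- (2 * pi * (x \<bullet> \<zeta>))) \<partial>lborel \<partial>lborel)"
    by (rule lborel_pair.Fubini_integral[OF int])
  also have "\<dots> = (\<integral>y. f y * cis (- (2 * pi * (y \<bullet> \<zeta>))) * ft k \<zeta> \<partial>lborel)"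
  proof (intro Bochner_Integration.integral_cong refl)
    fix y
    have "(\<integral>x. f y * k (x - y) * cis (- (2 * pi * (x \<bullet> \<zeta>))) \<partial>lborel)
        = (\<integral>x. f y * k (x + y - y) * cis (- (2 * pi * ((x + y) \<bullet> \<zeta>))) \<partial>lborel)"
      by (rule integral_lborel_shift(1)[symmetric])
    also have "\<dots> = (\<integral>x. f y * cis (- (2 * pi * (y \<bullet> \<zeta>))) * (k x * cis (- (2 * pi * (x \<bullet> \<zeta>)))) \<partial>lborel)"
      by (intro Bochner_Integration.integral_cong refl) (simp add: inner_add_left ring_distribs mult_ac, simp add: cis_mult)
    finally show "(\<integral>x. f y * k (x - y) * cis (- (2 * pi * (x \<bullet> \<zeta>))) \<partial>lborel) =
       f y * cis (- (2 * pi * (y \<bullet> \<zeta>))) * ft k \<zeta>" by (simp add: ft_def)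
  qed
  also have "\<dots> = ft f \<zeta> * ft k \<zeta>" by (simp add: ft_def)
  finally show "ft (conv f k) \<zeta> = ft f \<zeta> * ft k \<zeta>" .
qed

section \<open>Continuity of translations in L^1\<close>

text \<open>An e / 4 argument: translation invariance makes the shifted error as small as the
  unshifted one. It is isolated because the induction on integrable functions uses it twice, for
  indicators of Borel sets and for limits.\<close>

lemma L1_translation_closure:
  fixes f :: "'a::euclidean_space \<Rightarrow> 'b::{banach, second_countable_topology}"
  assumes f: "integrable lborel f"
    and approx: "\<And>e. e > 0 \<Longrightarrow> \<exists>g. integrable lborel g \<and> (\<integral>x. norm (f x - g x) \<partial>lborel) < e \<and>
      (\<lambda>n. \<integral>x. norm (g (x + z n) - g x) \<partial>lborel) \<longlonglongrightarrow> 0"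
  shows "(\<lambda>n. \<integral>x. norm (f (x + z n) - f x) \<partial>lborel) \<longlonglongrightarrow> 0"
proof (rule LIMSEQ_I)
  fix e :: real assume "e > 0"
  obtain g where g: "integrable lborel g" "(\<integral>x. norm (f x - g x) \<partial>lborel) < e / 4"
     "(\<lambda>n. \<integral>x. norm (g (x + z n) - g x) \<partial>lborel) \<longlonglongrightarrow> 0"
    using approx[of "e/4"] \<open>e > 0\<close> by auto
  from LIMSEQ_D[OF g(3), of "e/4"] \<open>e > 0\<close> obtain N where N:
    "\<And>n. n \<ge> N \<Longrightarrow> (\<integral>x. norm (g (x + z n) - g x) \<partial>lborel) < e/4"
    by (auto simp: abs_less_iff)
  have "(\<integral>x. norm (f (x + z n) - f x) \<partial>lborel) < e" if "n \<ge> N" for n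
  proof -
    let ?h = "\<lambda>x. norm (f x - g x)"
    have h: "integrable lborel ?h" using f g by simp
    have fz: "integrable lborel (\<lambda>x. f (x + z n))" "integrable lborel (\<lambda>x. g (x + z n))"
      using f g integrable_lborel_shift(1) by auto
    have hz: "integrable lborel (\<lambda>x. ?h (x + z n))" using fz by simp
    have "(\<integral>x. norm (f (x + z n) - f x) \<partial>lborel) \<le>
       (\<integral>x. ?h (x + z n) + norm (g (x + z n) - g x) + ?h x \<partial>lborel)"
    proof (rule integral_mono)
      fix x
      have "f (x + z n) - f x = (f (x + z n) - g (x + z n)) + (g (x + z n) - g x) - (f x - g x)" by simp
      then show "norm (f (x + z n) - f x) \<le> ?h (x + z n) + norm (g (x + z n) - g x) + ?h x"
        by (metis norm_triangle_ineq norm_triangle_ineq4 add_right_mono order_trans)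
    qed (use f g fz h hz in auto)
    also have "\<dots> = (\<integral>x. ?h (x + z n) \<partial>lborel) + (\<integral>x. norm (g (x + z n) - g x) \<partial>lborel) + (\<integral>x. ?h x \<partial>lborel)"
      using f g fz h hz by simp
    also have "(\<integral>x. ?h (x + z n) \<partial>lborel) = (\<integral>x. ?h x \<partial>lborel)"
      by (rule integral_lborel_shift(1))
    finally show ?thesis using g(2) N[OF that] \<open>e > 0\<close> by linarith
  qed
  then show "\<exists>no. \<forall>n\<ge>no. norm ((\<integral>x. norm (f (x + z n) - f x) \<partial>lborel) - 0) < e"
    by auto
qed

text \<open>The symmetric difference has measure twice that of U minus twice that of the overlap of
  U with its translate. A point of the open set U stays in U under small translations, and a point
  outside contributes nothing to the overlap, so dominated convergence applies with no condition on
  the boundary of U.\<close>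

lemma L1_translation_open:
  fixes U :: "'a::euclidean_space set"
  assumes U: "open U" "emeasure lborel U < \<infinity>" and z: "z \<longlonglongrightarrow> 0"
  shows "(\<lambda>n. \<integral>x. \<bar>indicator U (x + z n) - indicator U x :: real\<bar> \<partial>lborel) \<longlonglongrightarrow> 0"
proof -
  have [measurable]: "U \<in> sets borel" using U by auto
  let ?u = "\<lambda>x. indicator U x :: real"
  have u: "integrable lborel ?u" using U(2) by (intro integrable_real_indicator) auto
  have uz: "integrable lborel (\<lambda>x. ?u (x + z n))" for n by (rule integrable_lborel_shift(1)[OF u])
  have p: "integrable lborel (\<lambda>x. ?u x * ?u (x + z n))" for n
    by (rule Bochner_Integration.integrable_bound[OF u]) (auto simp: indicator_def)
  have "(\<lambda>n. \<integral>x. ?u x * ?u (x + z n) \<partial>lborel) \<longlonglongrightarrow> (\<integral>x. ?u x \<partial>lborel)"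
  proof (rule integral_dominated_convergence[OF _ _ u])
    show "AE x in lborel. (\<lambda>n. ?u x * ?u (x + z n)) \<longlonglongrightarrow> ?u x"
    proof (rule AE_I2)
      fix x
      show "(\<lambda>n. ?u x * ?u (x + z n)) \<longlonglongrightarrow> ?u x"
      proof (cases "x \<in> U")
        case True
        have "(\<lambda>n. x + z n) \<longlonglongrightarrow> x" using tendsto_add[OF tendsto_const[of x] z] by simp
        then have "eventually (\<lambda>n. x + z n \<in> U) sequentially"
          using True U(1) by (metis topological_tendstoD)
        then show ?thesis using True
          by (intro tendsto_eventually) (auto elim!: eventually_mono)
      qed auto
    qed
  qed (auto simp: indicator_def)
  then have "(\<lambda>n. 2 * (\<integral>x. ?u x \<partial>lborel) - 2 * (\<integral>x. ?u x * ?u (x + z n) \<partial>lborel)) \<longlonglongrightarrow>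
     2 * (\<integral>x. ?u x \<partial>lborel) - 2 * (\<integral>x. ?u x \<partial>lborel)"
    by (intro tendsto_intros)
  moreover have "(\<integral>x. \<bar>?u (x + z n) - ?u x\<bar> \<partial>lborel) = 2 * (\<integral>x. ?u x \<partial>lborel) - 2 * (\<integral>x. ?u x * ?u (x + z n) \<partial>lborel)" for n
  proof -
    have "(\<integral>x. \<bar>?u (x + z n) - ?u x\<bar> \<partial>lborel) = (\<integral>x. ?u (x + z n) + ?u x - 2 * (?u x * ?u (x + z n)) \<partial>lborel)"
      by (intro Bochner_Integration.integral_cong) (auto simp: indicator_def)
    also have "\<dots> = (\<integral>x. ?u (x + z n) \<partial>lborel) + (\<integral>x. ?u x \<partial>lborel) - 2 * (\<integral>x. ?u x * ?u (x + z n) \<partial>lborel)"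
      using u uz[of n] p[of n] by (simp del: integral_indicator)
    finally show ?thesis using integral_lborel_shift(1)[of ?u "z n"] by simp
  qed
  ultimately show ?thesis by simp
qed

lemma L1_translation:
  fixes f :: "'a::euclidean_space \<Rightarrow> 'b::{banach, second_countable_topology}"
  assumes f: "integrable lborel f" and z: "z \<longlonglongrightarrow> 0"
  shows "(\<lambda>n. \<integral>x. norm (f (x + z n) - f x) \<partial>lborel) \<longlonglongrightarrow> 0"
  using f
proof (induction f rule: integrable_induct)
  case (base A c)
  then have A: "A \<in> sets borel" "emeasure lborel A < \<infinity>" by auto
  show ?case
  proof (rule L1_translation_closure)
    show "integrable lborel (\<lambda>x. indicat_real A x *\<^sub>R c)" using A by (intro integrable_scaleR_left) auto
    fix e :: real assume "e > 0"
    \<comment> \<open>The summand 1 covers c = 0. Outer regularity then replaces A by an open set at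
      cost \<open>norm c * e'\<close> < e.\<close>
    define e' where "e' = e / (norm c + 1)"
    have "e' > 0" unfolding e'_def by (rule divide_pos_pos) (use \<open>e > 0\<close> norm_ge_zero[of c] in linarith)+
    from outer_regular_lborel[OF A(1) this] obtain U where U: "open U" "A \<subseteq> U" "emeasure lborel (U - A) < ennreal e'"
      by blast
    have [measurable]: "U \<in> sets borel" "A \<in> sets borel" using U A by auto
    have "emeasure lborel U = emeasure lborel A + emeasure lborel (U - A)"
      using U(2) by (subst plus_emeasure) (auto intro: arg_cong[where f="emeasure lborel"])
    also have "\<dots> < \<infinity>" using A(2) order_less_trans[OF U(3) ennreal_less_top] by (simp add: less_top)
    finally have Uf: "emeasure lborel U < \<infinity>" .
    have "(\<integral>x. norm (indicat_real A x *\<^sub>R c - indicat_real U x *\<^sub>R c) \<partial>lborel) = (\<integral>x. norm c * indicat_real (U - A) x \<partial>lborel)"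
      using U(2) by (intro Bochner_Integration.integral_cong) (auto simp: indicator_def)
    also have "\<dots> = norm c * measure lborel (U - A)" by simp
    also have "\<dots> \<le> norm c * e'" 
      using U(3) \<open>e' > 0\<close> by (intro mult_left_mono) (auto simp: measure_def intro!: enn2real_leI)
    also have "\<dots> < e" using \<open>e > 0\<close> norm_ge_zero[of c] unfolding e'_def by (simp add: divide_simps del: norm_ge_zero)
    finally have 1: "(\<integral>x. norm (indicat_real A x *\<^sub>R c - indicat_real U x *\<^sub>R c) \<partial>lborel) < e" .
    have "(\<lambda>n. norm c * (\<integral>x. \<bar>indicator U (x + z n) - indicator U x :: real\<bar> \<partial>lborel)) \<longlonglongrightarrow> norm c * 0"
      by (intro tendsto_intros L1_translation_open U Uf z)
    then have 2: "(\<lambda>n. \<integral>x. norm (indicat_real U (x + z n) *\<^sub>R c - indicat_real U x *\<^sub>R c) \<partial>lborel) \<longlonglongrightarrow> 0"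
      by (simp add: scaleR_diff_left[symmetric] mult.commute)
    have "integrable lborel (\<lambda>x. indicat_real U x *\<^sub>R c)" using Uf by (intro integrable_scaleR_left) auto
    with 1 2 show "\<exists>g. integrable lborel g \<and> (\<integral>x. norm (indicat_real A x *\<^sub>R c - g x) \<partial>lborel) < e \<and>
      (\<lambda>n. \<integral>x. norm (g (x + z n) - g x) \<partial>lborel) \<longlonglongrightarrow> 0" by blast
  qed
next
  case (add f g)
  show ?case
  proof (rule tendsto_sandwich[OF _ _ tendsto_const])
    show "(\<lambda>n. (\<integral>x. norm (f (x + z n) - f x) \<partial>lborel) + (\<integral>x. norm (g (x + z n) - g x) \<partial>lborel)) \<longlonglongrightarrow> 0"
      using tendsto_add[OF add(3,4)] by simp
    have [simp]: "integrable lborel (\<lambda>x. f (x + z n))" "integrable lborel (\<lambda>x. g (x + z n))" for n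
      using add(1,2) integrable_lborel_shift(1) by auto
    show "\<forall>\<^sub>F n in sequentially. (\<integral>x. norm (f (x + z n) + g (x + z n) - (f x + g x)) \<partial>lborel)
      \<le> (\<integral>x. norm (f (x + z n) - f x) \<partial>lborel) + (\<integral>x. norm (g (x + z n) - g x) \<partial>lborel)"
    proof (intro always_eventually allI)
      fix n
      have "(\<integral>x. norm (f (x + z n) + g (x + z n) - (f x + g x)) \<partial>lborel)
        \<le> (\<integral>x. norm (f (x + z n) - f x) + norm (g (x + z n) - g x) \<partial>lborel)"
        using add(1,2) by (intro integral_mono) (auto simp: norm_diff_triangle_ineq)
      then show "(\<integral>x. norm (f (x + z n) + g (x + z n) - (f x + g x)) \<partial>lborel)
        \<le> (\<integral>x. norm (f (x + z n) - f x) \<partial>lborel) + (\<integral>x. norm (g (x + z n) - g x) \<partial>lborel)"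
        using add(1,2) by simp
    qed
  qed auto
next
  case (lim f s)
  show ?case
  proof (rule L1_translation_closure[OF lim(4)])
    fix e :: real assume "e > 0"
    have "(\<lambda>i. \<integral>x. norm (f x - s i x) \<partial>lborel) \<longlonglongrightarrow> (\<integral>x. norm (0::'b) \<partial>(lborel::'a measure))"
    proof (rule integral_dominated_convergence)
      show "integrable lborel (\<lambda>x. 3 * norm (f x))" using lim(4) by simp
      show "AE x in lborel. (\<lambda>i. norm (f x - s i x)) \<longlonglongrightarrow> norm (0::'b)"
      proof (rule AE_I2)
        fix x
        have "(\<lambda>i. f x - s i x) \<longlonglongrightarrow> f x - f x" using lim(2)[of x] by (intro tendsto_intros) auto
        then show "(\<lambda>i. norm (f x - s i x)) \<longlonglongrightarrow> norm (0::'b)" using tendsto_norm by fastforce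
      qed
      show "AE x in lborel. norm (norm (f x - s i x)) \<le> 3 * norm (f x)" for i
      proof (rule AE_I2)
        fix x show "norm (norm (f x - s i x)) \<le> 3 * norm (f x)"
          using norm_triangle_ineq4[of "f x" "s i x"] lim(3)[of x i] by simp
      qed
    qed (use lim in auto)
    then obtain i where "(\<integral>x. norm (f x - s i x) \<partial>lborel) < e"
      using LIMSEQ_D[of _ 0 e] \<open>e > 0\<close> by (fastforce simp: abs_less_iff)
    then show "\<exists>g. integrable lborel g \<and> (\<integral>x. norm (f x - g x) \<partial>lborel) < e \<and>
      (\<lambda>n. \<integral>x. norm (g (x + z n) - g x) \<partial>lborel) \<longlonglongrightarrow> 0"
      using lim(1,5) by blast
  qed
qed

subsection \<open>Plancherel's theorem on \<open>L\<^sup>1 \<inter> L\<^sup>2\<close>\<close>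

lemma measurable_cnj [measurable]: "cnj \<in> borel_measurable borel"
  by (intro borel_measurable_continuous_onI) (auto intro: continuous_intros)

text \<open>The class in which Plancherel is proved. It is closed under sums, translations and
  modulations, and it contains convolutions of integrable functions with bounded integrable kernels,
  so every auxiliary function below stays inside it.\<close>

definition L12 :: "('a::euclidean_space \<Rightarrow> complex) \<Rightarrow> bool" where
  "L12 f \<longleftrightarrow> integrable lborel f \<and> integrable lborel (\<lambda>x. (cmod (f x))\<^sup>2)"

lemma L12D:
  assumes "L12 f"
  shows "integrable lborel f" "integrable lborel (\<lambda>x. (cmod (f x))\<^sup>2)" "f \<in> borel_measurable borel"
  using assms by (auto simp: L12_def)

lemma norm_add_sq_le: "(norm (a + b))\<^sup>2 \<le> 2 * (norm a)\<^sup>2 + 2 * (norm (b::'a::real_normed_vector))\<^sup>2"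
proof -
  have "(norm (a + b))\<^sup>2 \<le> (norm a + norm b)\<^sup>2" by (intro power_mono norm_triangle_ineq) simp
  also have "\<dots> \<le> 2 * (norm a)\<^sup>2 + 2 * (norm b)\<^sup>2"
    using sum_squares_bound[of "norm a" "norm b"] by (simp add: power2_sum)
  finally show ?thesis .
qed

lemma norm_diff_sq_le: "(norm (a - b))\<^sup>2 \<le> 2 * (norm a)\<^sup>2 + 2 * (norm (b::'a::real_normed_vector))\<^sup>2"
  using norm_add_sq_le[of a "-b"] by simp

lemma L12_add: "L12 f \<Longrightarrow> L12 g \<Longrightarrow> L12 (\<lambda>x. f x + g x)"
  unfolding L12_def
proof safe
  assume f: "integrable lborel f" "integrable lborel (\<lambda>x. (cmod (f x))\<^sup>2)"
    and g: "integrable lborel g" "integrable lborel (\<lambda>x. (cmod (g x))\<^sup>2)"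
  have [measurable]: "f \<in> borel_measurable borel" "g \<in> borel_measurable borel" using f g by auto
  show "integrable lborel (\<lambda>x. (cmod (f x + g x))\<^sup>2)"
    by (rule Bochner_Integration.integrable_bound[where f="\<lambda>x. 2 * (cmod (f x))\<^sup>2 + 2 * (cmod (g x))\<^sup>2"])
      (use f g in \<open>auto simp: norm_add_sq_le\<close>)
qed auto

lemma L12_cmult: "L12 f \<Longrightarrow> L12 (\<lambda>x. c * f x)"
  by (auto simp: L12_def norm_mult power_mult_distrib)

lemma L12_sum: "(\<And>i. i \<in> I \<Longrightarrow> L12 (f i)) \<Longrightarrow> L12 (\<lambda>x. \<Sum>i\<in>I. f i x)"
  by (induction I rule: infinite_finite_induct) (auto intro: L12_add simp: L12_def[of "\<lambda>_. 0"])

lemma L12_diff: "L12 f \<Longrightarrow> L12 g \<Longrightarrow> L12 (\<lambda>x. f x - g x)"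
  using L12_add[of f "\<lambda>x. (-1) * g x"] L12_cmult[of g "-1"] by simp

lemma L12_shift: "L12 f \<Longrightarrow> L12 (\<lambda>x. f (x - a))"
  using integrable_lborel_shift(2)[of f a] integrable_lborel_shift(2)[of "\<lambda>x. (cmod (f x))\<^sup>2" a] by (auto simp: L12_def)

lemma L12_mult_cis: "L12 f \<Longrightarrow> t \<in> borel_measurable borel \<Longrightarrow> L12 (\<lambda>x. f x * cis (t x))"
  by (auto simp: L12_def norm_mult intro: integrable_mult_cis)

text \<open>Split f at height m. The part \<open>g m\<close> of small values satisfies |p|^2 \<le> 2
  m |p| for its difference p, so continuity in L^1 suffices; the part \<open>r m\<close> of large
  values is small in L^2 by dominated convergence.\<close>

lemma L2_translation:
  fixes f :: "'a::euclidean_space \<Rightarrow> complex"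
  assumes f: "L12 f" and z: "z \<longlonglongrightarrow> 0"
  shows "(\<lambda>n. \<integral>x. (cmod (f (x + z n) - f x))\<^sup>2 \<partial>lborel) \<longlonglongrightarrow> 0"
proof (rule LIMSEQ_I)
  fix e :: real assume "e > 0"
  have [measurable]: "f \<in> borel_measurable borel" using L12D[OF f] by auto
  define r where "r m x = (if cmod (f x) \<le> real m then 0 else f x)" for m :: nat and x
  define g where "g m x = f x - r m x" for m :: nat and x
  have [measurable]: "r m \<in> borel_measurable borel" for m unfolding r_def by measurable
  have [measurable]: "g m \<in> borel_measurable borel" for m unfolding g_def by measurable
  have r_le: "cmod (r m x) \<le> cmod (f x)" for m x by (simp add: r_def)
  have g_le: "cmod (g m x) \<le> cmod (f x)" "cmod (g m x) \<le> m" for m x by (auto simp: g_def r_def)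
  have gi: "integrable lborel (g m)" for m
    by (rule Bochner_Integration.integrable_bound[OF L12D(1)[OF f]]) (use g_le in auto)
  have ri: "integrable lborel (\<lambda>x. (cmod (r m x))\<^sup>2)" for m
    by (rule Bochner_Integration.integrable_bound[OF L12D(2)[OF f]]) (use r_le in \<open>auto intro!: power_mono\<close>)
  have "(\<lambda>m. \<integral>x. (cmod (r m x))\<^sup>2 \<partial>lborel) \<longlonglongrightarrow> (\<integral>x. 0 \<partial>(lborel :: 'a measure))"
  proof (rule integral_dominated_convergence[OF _ _ L12D(2)[OF f]])
    show "AE x in lborel. (\<lambda>m. (cmod (r m x))\<^sup>2) \<longlonglongrightarrow> 0"
    proof (rule AE_I2)
      fix x
      obtain N :: nat where "cmod (f x) \<le> real N" using real_arch_simple by blast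
      then have "\<forall>m\<ge>N. (cmod (r m x))\<^sup>2 = 0" by (auto simp: r_def)
      then show "(\<lambda>m. (cmod (r m x))\<^sup>2) \<longlonglongrightarrow> 0"
        by (intro tendsto_eventually) (auto simp: eventually_sequentially)
    qed
  qed (use r_le in \<open>auto intro!: power_mono\<close>)
  \<comment> \<open>The tail enters shifted and unshifted, each with factor 4; the bound e / 16 thus
    spends e / 2 on it and leaves e / 2 for the bounded part.\<close>
  then obtain m where m: "(\<integral>x. (cmod (r m x))\<^sup>2 \<partial>lborel) < e / 16"
    using LIMSEQ_D[of _ 0 "e/16"] \<open>e > 0\<close> by (fastforce simp: abs_less_iff)
  have "(\<lambda>n. 4 * real m * (\<integral>x. norm (g m (x + z n) - g m x) \<partial>lborel)) \<longlonglongrightarrow> 4 * real m * 0"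
    by (intro tendsto_intros L1_translation gi z)
  then obtain N where N: "\<And>n. n \<ge> N \<Longrightarrow> 4 * real m * (\<integral>x. norm (g m (x + z n) - g m x) \<partial>lborel) < e / 2"
    using LIMSEQ_D[of _ 0 "e/2"] \<open>e > 0\<close> by (fastforce simp: abs_less_iff)
  have "(\<integral>x. (cmod (f (x + z n) - f x))\<^sup>2 \<partial>lborel) < e" if "n \<ge> N" for n
  proof -
    let ?z = "z n"
    have giz: "integrable lborel (\<lambda>x. g m (x + ?z))" by (rule integrable_lborel_shift(1)[OF gi])
    have riz: "integrable lborel (\<lambda>x. (cmod (r m (x + ?z)))\<^sup>2)" by (rule integrable_lborel_shift(1)[OF ri])
    have "(\<integral>x. (cmod (f (x + ?z) - f x))\<^sup>2 \<partial>lborel) \<le> 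
      (\<integral>x. 4 * real m * norm (g m (x + ?z) - g m x) + (4 * (cmod (r m (x + ?z)))\<^sup>2 + 4 * (cmod (r m x))\<^sup>2) \<partial>lborel)"
    proof (rule integral_mono')
      show "integrable lborel (\<lambda>x. 4 * real m * norm (g m (x + ?z) - g m x) + (4 * (cmod (r m (x + ?z)))\<^sup>2 + 4 * (cmod (r m x))\<^sup>2))"
        using gi[of m] giz ri[of m] riz by auto
      fix x
      let ?p = "g m (x + ?z) - g m x" and ?q = "r m (x + ?z) - r m x"
      have "cmod ?p \<le> 2 * real m" using norm_triangle_ineq4[of "g m (x + ?z)" "g m x"] g_le(2)[of m x] g_le(2)[of m "x + ?z"] by linarith
      then have "(cmod ?p)\<^sup>2 \<le> 2 * real m * cmod ?p" unfolding power2_eq_square by (intro mult_right_mono) auto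
      moreover have "(cmod (f (x + ?z) - f x))\<^sup>2 = (cmod (?p + ?q))\<^sup>2" by (simp add: g_def)
      moreover have "(cmod ?q)\<^sup>2 \<le> 2 * (cmod (r m (x + ?z)))\<^sup>2 + 2 * (cmod (r m x))\<^sup>2" by (rule norm_diff_sq_le)
      ultimately show "(cmod (f (x + ?z) - f x))\<^sup>2 \<le> 4 * real m * norm (g m (x + ?z) - g m x) + (4 * (cmod (r m (x + ?z)))\<^sup>2 + 4 * (cmod (r m x))\<^sup>2)"
        using norm_add_sq_le[of ?p ?q] by linarith
      show "0 \<le> 4 * real m * norm (g m (x + ?z) - g m x) + (4 * (cmod (r m (x + ?z)))\<^sup>2 + 4 * (cmod (r m x))\<^sup>2)" by simp
    qed
    also have "\<dots> = 4 * real m * (\<integral>x. norm (g m (x + ?z) - g m x) \<partial>lborel) + (4 * (\<integral>x. (cmod (r m (x + ?z)))\<^sup>2 \<partial>lborel) + 4 * (\<integral>x. (cmod (r m x))\<^sup>2 \<partial>lborel))"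
      using gi[of m] giz ri[of m] riz by simp
    also have "\<dots> < e" using m N[OF that] integral_lborel_shift(1)[of "\<lambda>x. (cmod (r m x))\<^sup>2" ?z] by simp
    finally show ?thesis .
  qed
  then show "\<exists>no. \<forall>n\<ge>no. norm ((\<integral>x. (cmod (f (x + z n) - f x))\<^sup>2 \<partial>lborel) - 0) < e" by auto
qed

lemma integrable_mult_L2:
  fixes f g :: "'a::euclidean_space \<Rightarrow> complex"
  assumes [measurable]: "f \<in> borel_measurable borel" "g \<in> borel_measurable borel"
    and f: "integrable lborel (\<lambda>x. (cmod (f x))\<^sup>2)" and g: "integrable lborel (\<lambda>x. (cmod (g x))\<^sup>2)"
  shows "integrable lborel (\<lambda>x. f x * g x)"
proof (rule Bochner_Integration.integrable_bound)
  show "integrable lborel (\<lambda>x. (cmod (f x))\<^sup>2 + (cmod (g x))\<^sup>2)" using f g by simp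
  show "AE x in lborel. norm (f x * g x) \<le> norm ((cmod (f x))\<^sup>2 + (cmod (g x))\<^sup>2)"
  proof (rule AE_I2)
    fix x
    have "2 * (cmod (f x) * cmod (g x)) \<le> (cmod (f x))\<^sup>2 + (cmod (g x))\<^sup>2"
      using sum_squares_bound[of "cmod (f x)" "cmod (g x)"] by (simp add: mult.assoc)
    moreover have "0 \<le> cmod (f x) * cmod (g x)" by simp
    ultimately have "cmod (f x) * cmod (g x) \<le> (cmod (f x))\<^sup>2 + (cmod (g x))\<^sup>2" by linarith
    then show "norm (f x * g x) \<le> norm ((cmod (f x))\<^sup>2 + (cmod (g x))\<^sup>2)"
      by (simp add: norm_mult)
  qed
qed measurable

text \<open>The autocorrelation takes the value of the squared L^2 norm at 0 and has the squared
  modulus of \<open>ft f\<close> as its transform. Expanding |f (x + z) - f x|^2 turns its real part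
  at z into the L^2 modulus of continuity of f, which is how continuity at 0 enters
  Plancherel.\<close>

lemma autocorrelation:
  fixes f :: "'a::euclidean_space \<Rightarrow> complex"
  assumes f: "L12 f"
  defines "a \<equiv> conv f (\<lambda>x. cnj (f (- x)))"
  shows "integrable lborel a" "ft a \<zeta> = (cmod (ft f \<zeta>))\<^sup>2"
    "Re (a z) = (\<integral>x. (cmod (f x))\<^sup>2 \<partial>lborel) - (\<integral>x. (cmod (f (x + z) - f x))\<^sup>2 \<partial>lborel) / 2"
proof -
  note fi = L12D[OF f]
  have [measurable]: "f \<in> borel_measurable borel" using fi by auto
  have k: "integrable lborel (\<lambda>x. cnj (f (- x)))"
    using integrable_lborel_shift(3)[OF fi(1), of 0] by simp
  show "integrable lborel a" unfolding a_def by (rule integrable_conv[OF fi(1) k])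
  have "ft (\<lambda>x. cnj (f (- x))) \<zeta> = (\<integral>x. cnj (f (0 - x)) * cis (2 * pi * ((0 - x) \<bullet> \<zeta>)) \<partial>lborel)"
    unfolding ft_def by simp
  also have "\<dots> = (\<integral>x. cnj (f x) * cis (2 * pi * (x \<bullet> \<zeta>)) \<partial>lborel)"
    by (rule integral_lborel_shift(3))
  also have "\<dots> = (\<integral>x. cnj (f x * cis (- (2 * pi * (x \<bullet> \<zeta>)))) \<partial>lborel)"
    by (simp add: cis_cnj)
  also have "\<dots> = cnj (ft f \<zeta>)" unfolding ft_def by (rule Bochner_Integration.integral_cnj)
  finally show "ft a \<zeta> = (cmod (ft f \<zeta>))\<^sup>2"
    unfolding a_def ft_conv[OF fi(1) k] using complex_norm_square[of "ft f \<zeta>"] by simp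
  let ?fz = "\<lambda>x. f (x + z)"
  have s1: "integrable lborel (\<lambda>x. (cmod (?fz x))\<^sup>2)" by (rule integrable_lborel_shift(1)[OF fi(2)])
  have s2: "integrable lborel (\<lambda>x. (cmod (?fz x - f x))\<^sup>2)"
    using L12_diff[OF L12_shift[OF f, of "-z"] f] by (auto simp: L12_def)
  have eq: "Re (?fz x * cnj (f x)) = ((cmod (?fz x))\<^sup>2 + (cmod (f x))\<^sup>2 - (cmod (?fz x - f x))\<^sup>2) / 2" for x
    unfolding cmod_power2 by (simp add: power2_eq_square algebra_simps)
  have int: "integrable lborel (\<lambda>x. ?fz x * cnj (f x))"
    by (rule integrable_mult_L2) (use s1 fi(2) in auto)
  have "a z = (\<integral>y. f y * cnj (f (y - z)) \<partial>lborel)" by (simp add: a_def conv_def)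
  also have "\<dots> = (\<integral>x. ?fz x * cnj (f x) \<partial>lborel)"
    using integral_lborel_shift(1)[of "\<lambda>y. f y * cnj (f (y - z))" z] by simp
  finally have az: "a z = (\<integral>x. ?fz x * cnj (f x) \<partial>lborel)" .
  have "Re (a z) = (\<integral>x. Re (?fz x * cnj (f x)) \<partial>lborel)"
    unfolding az by (rule integral_Re[OF int, symmetric])
  also have "\<dots> = ((\<integral>x. (cmod (?fz x))\<^sup>2 \<partial>lborel) + (\<integral>x. (cmod (f x))\<^sup>2 \<partial>lborel) - (\<integral>x. (cmod (?fz x - f x))\<^sup>2 \<partial>lborel)) / 2"
    unfolding eq using s1 s2 fi(2) by simp
  finally show "Re (a z) = (\<integral>x. (cmod (f x))\<^sup>2 \<partial>lborel) - (\<integral>x. (cmod (f (x + z) - f x))\<^sup>2 \<partial>lborel) / 2"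
    using integral_lborel_shift(1)[of "\<lambda>x. (cmod (f x))\<^sup>2" z] by simp
qed

lemma ft_scale:
  fixes f :: "'a::euclidean_space \<Rightarrow> complex"
  assumes "c > 0"
  shows "ft (\<lambda>x. f (c *\<^sub>R x)) \<zeta> = ft f (\<zeta> /\<^sub>R c) / complex_of_real (c ^ DIM('a))"
proof -
  have "ft f (\<zeta> /\<^sub>R c) = \<bar>c\<bar> ^ DIM('a) *\<^sub>R (\<integral>x. f (0 + c *\<^sub>R x) * cis (- (2 * pi * ((0 + c *\<^sub>R x) \<bullet> (\<zeta> /\<^sub>R c)))) \<partial>lborel)"
    unfolding ft_def by (rule integral_lborel_affine) (use assms in auto)
  moreover have "inverse c * (c * t) = t" for t using assms by simp
  ultimately show ?thesis using assms by (simp add: ft_def scaleR_conv_of_real)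
qed

text \<open>The integral of |ft f|^2 against wide Gaussians is, by the multiplication formula, a
  Gaussian average of the autocorrelation near 0, and converges to its value at 0. As the Gaussians
  increase to 1, monotone convergence yields integrability and the value together.\<close>

theorem plancherel:
  fixes f :: "'a::euclidean_space \<Rightarrow> complex"
  assumes f: "L12 f"
  shows "integrable lborel (\<lambda>\<zeta>. (cmod (ft f \<zeta>))\<^sup>2)"
    and "(\<integral>\<zeta>. (cmod (ft f \<zeta>))\<^sup>2 \<partial>lborel) = (\<integral>x. (cmod (f x))\<^sup>2 \<partial>lborel)"
proof -
  note fi = L12D[OF f]
  have [measurable]: "f \<in> borel_measurable borel" using fi by auto
  define a where "a = conv f (\<lambda>x. cnj (f (- x)))"
  note a = autocorrelation[OF f, folded a_def]
  have [measurable]: "a \<in> borel_measurable borel" using a(1) by auto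
  define s where "s n = inverse (real (Suc n))" for n
  have s: "s n > 0" for n by (simp add: s_def)
  have s0: "s \<longlonglongrightarrow> 0" unfolding s_def by (rule LIMSEQ_inverse_real_of_nat)
  define J where "J n \<zeta> = gaussian (s n *\<^sub>R \<zeta>) * (cmod (ft f \<zeta>))\<^sup>2" for n and \<zeta> :: 'a
  have gi: "integrable lborel (\<lambda>\<zeta>::'a. gaussian (s n *\<^sub>R \<zeta>))" for n
    using integrable_lborel_affine[OF integrable_gaussian, of "s n" 0] s[of n] by simp
  define B where "B = (\<integral>x. norm (f x) \<partial>lborel)"
  have Ji: "integrable lborel (J n)" for n
  proof (rule Bochner_Integration.integrable_bound)
    show "integrable lborel (\<lambda>\<zeta>::'a. B\<^sup>2 * gaussian (s n *\<^sub>R \<zeta>))" using gi by simp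
    show "AE \<zeta> in lborel. norm (J n \<zeta>) \<le> norm (B\<^sup>2 * gaussian (s n *\<^sub>R \<zeta>))"
      using norm_ft_le[of f] by (auto intro!: AE_I2 mult_right_mono power_mono simp: J_def B_def mult.commute abs_mult gaussian_def)
  qed (simp add: J_def[abs_def])
  \<comment> \<open>The transform of the wide Gaussian is a concentrated one; rescaling the variable
    by \<open>s n\<close> moves the concentration into the argument of \<open>a\<close>, so the
    limit can be taken pointwise.\<close>
  have J: "(\<integral>\<zeta>. J n \<zeta> \<partial>lborel) = (\<integral>x. Re (a (s n *\<^sub>R x)) * gaussian x \<partial>lborel)" for n
  proof -
    have "complex_of_real (\<integral>\<zeta>. J n \<zeta> \<partial>lborel) = (\<integral>\<zeta>. ft a \<zeta> * gaussian (s n *\<^sub>R \<zeta>) \<partial>lborel)"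
      unfolding J_def a(2) by (subst integral_complex_of_real[symmetric]) (simp add: mult.commute)
    also have "\<dots> = (\<integral>x. a x * ft (\<lambda>\<zeta>. complex_of_real (gaussian (s n *\<^sub>R \<zeta>))) x \<partial>lborel)"
      using gi by (intro ft_mult_integral a(1)) auto
    also have "\<dots> = (\<integral>x. a x * (gaussian (x /\<^sub>R s n) / complex_of_real (s n ^ DIM('a))) \<partial>lborel)"
      using s[of n] by (simp add: ft_scale[of "s n" "\<lambda>x. complex_of_real (gaussian x)"] ft_gaussian)
    also have "\<dots> = (\<integral>x. a (s n *\<^sub>R x) * gaussian x \<partial>lborel)"
      by (subst integral_lborel_affine[of "s n" _ 0])
        (use s[of n] in \<open>auto simp: scaleR_conv_of_real field_simps simp flip: of_real_power intro!: Bochner_Integration.integral_cong\<close>)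
    finally have *: "complex_of_real (\<integral>\<zeta>. J n \<zeta> \<partial>lborel) = (\<integral>x. a (s n *\<^sub>R x) * gaussian x \<partial>lborel)" .
    have "integrable lborel (\<lambda>x. a (s n *\<^sub>R x) * gaussian x)"
    proof (rule Bochner_Integration.integrable_bound)
      show "integrable lborel (\<lambda>x. a (s n *\<^sub>R x))" using integrable_lborel_affine[OF a(1), of "s n" 0] s[of n] by simp
      show "AE x in lborel. norm (a (s n *\<^sub>R x) * gaussian x) \<le> norm (a (s n *\<^sub>R x))"
        by (auto intro!: AE_I2 mult_left_le simp: norm_mult gaussian_def)
    qed measurable
    then have "Re (\<integral>x. a (s n *\<^sub>R x) * gaussian x \<partial>lborel) = (\<integral>x. Re (a (s n *\<^sub>R x)) * gaussian x \<partial>lborel)"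
      by (subst integral_Re[symmetric]) auto
    with * show ?thesis by (metis Re_complex_of_real)
  qed
  define F where "F = (\<integral>x. (cmod (f x))\<^sup>2 \<partial>lborel)"
  have F0: "F \<ge> 0" by (simp add: F_def)
  define D where "D z = (\<integral>x. (cmod (f (x + z) - f x))\<^sup>2 \<partial>lborel)" for z
  \<comment> \<open>These bounds place F - D z / 2 in [-F, F], which supplies the dominating
    function F times the Gaussian.\<close>
  have D: "0 \<le> D z" "D z \<le> 4 * F" for z
  proof -
    show "0 \<le> D z" by (simp add: D_def)
    have s1: "integrable lborel (\<lambda>x. (cmod (f (x + z)))\<^sup>2)" by (rule integrable_lborel_shift(1)[OF fi(2)])
    have "D z \<le> (\<integral>x. 2 * (cmod (f (x + z)))\<^sup>2 + 2 * (cmod (f x))\<^sup>2 \<partial>lborel)"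
      unfolding D_def by (rule integral_mono') (use s1 fi(2) in \<open>auto intro: norm_diff_sq_le\<close>)
    also have "\<dots> = 4 * F" using s1 fi(2) integral_lborel_shift(1)[of "\<lambda>x. (cmod (f x))\<^sup>2" z] by (simp add: F_def)
    finally show "D z \<le> 4 * F" .
  qed
  have Ra: "Re (a z) = F - D z / 2" for z unfolding a(3) F_def D_def ..
  have "(\<lambda>n. \<integral>x. Re (a (s n *\<^sub>R x)) * gaussian x \<partial>lborel) \<longlonglongrightarrow> (\<integral>x. F * gaussian (x::'a) \<partial>lborel)"
  proof (rule integral_dominated_convergence)
    show "integrable lborel (\<lambda>x::'a. F * gaussian x)" by (intro integrable_mult_right integrable_gaussian)
    show "AE x in lborel. (\<lambda>n. Re (a (s n *\<^sub>R x)) * gaussian x) \<longlonglongrightarrow> F * gaussian (x::'a)"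
    proof (rule AE_I2)
      fix x :: 'a
      have "(\<lambda>n. s n *\<^sub>R x) \<longlonglongrightarrow> 0" using tendsto_scaleR[OF s0 tendsto_const[of x]] by simp
      then have "(\<lambda>n. D (s n *\<^sub>R x)) \<longlonglongrightarrow> 0" unfolding D_def by (rule L2_translation[OF f])
      then have "(\<lambda>n. (F - D (s n *\<^sub>R x) / 2) * gaussian x) \<longlonglongrightarrow> (F - 0 / 2) * gaussian x"
        by (intro tendsto_intros) auto
      then show "(\<lambda>n. Re (a (s n *\<^sub>R x)) * gaussian x) \<longlonglongrightarrow> F * gaussian x" by (simp add: Ra)
    qed
    show "AE x in lborel. norm (Re (a (s n *\<^sub>R x)) * gaussian x) \<le> F * gaussian (x::'a)" for n
    proof (rule AE_I2)
      fix x :: 'a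
      have "\<bar>F - D (s n *\<^sub>R x) / 2\<bar> \<le> F" using D[of "s n *\<^sub>R x"] by (simp add: abs_le_iff)
      then show "norm (Re (a (s n *\<^sub>R x)) * gaussian x) \<le> F * gaussian x"
        by (auto simp: Ra abs_mult gaussian_def intro!: mult_right_mono)
    qed
  qed auto
  then have lim: "(\<lambda>n. \<integral>\<zeta>. J n \<zeta> \<partial>lborel) \<longlonglongrightarrow> F" unfolding J using integral_gaussian[where 'a='a] by simp
  have "mono (\<lambda>n. J n \<zeta>)" for \<zeta>
  proof (rule monoI)
    fix m n :: nat assume "m \<le> n"
    then have "s n \<le> s m" by (auto simp: s_def intro!: le_imp_inverse_le)
    then have "(norm (s n *\<^sub>R \<zeta>))\<^sup>2 \<le> (norm (s m *\<^sub>R \<zeta>))\<^sup>2" using s[of n] s[of m] by (auto intro!: power_mono mult_right_mono)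
    then show "J m \<zeta> \<le> J n \<zeta>" unfolding J_def gaussian_def by (intro mult_right_mono) auto
  qed
  moreover have "(\<lambda>n. J n \<zeta>) \<longlonglongrightarrow> (cmod (ft f \<zeta>))\<^sup>2" for \<zeta>
  proof -
    have "(\<lambda>n. exp (- (pi * (norm (s n *\<^sub>R \<zeta>))\<^sup>2)) * (cmod (ft f \<zeta>))\<^sup>2) \<longlonglongrightarrow> exp (- (pi * (norm (0 *\<^sub>R \<zeta>))\<^sup>2)) * (cmod (ft f \<zeta>))\<^sup>2"
      by (intro tendsto_intros s0)
    then show ?thesis by (simp add: J_def gaussian_def)
  qed
  ultimately have *: "AE \<zeta> in lborel. mono (\<lambda>n. J n \<zeta>)" "AE \<zeta> in lborel. (\<lambda>n. J n \<zeta>) \<longlonglongrightarrow> (cmod (ft f \<zeta>))\<^sup>2"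
    by (auto intro!: AE_I2)
  have m: "(\<lambda>\<zeta>. (cmod (ft f \<zeta>))\<^sup>2) \<in> borel_measurable lborel" by measurable
  show "integrable lborel (\<lambda>\<zeta>. (cmod (ft f \<zeta>))\<^sup>2)"
    by (rule integrable_monotone_convergence[OF Ji * lim m])
  show "(\<integral>\<zeta>. (cmod (ft f \<zeta>))\<^sup>2 \<partial>lborel) = (\<integral>x. (cmod (f x))\<^sup>2 \<partial>lborel)"
    using integral_monotone_convergence[OF Ji * lim m] by (simp only: F_def)
qed

subsection \<open>Functions with spectrum in a slab\<close>

lemma cis_minus_1_le: "cmod (cis t - 1) \<le> \<bar>t\<bar>"
  using iexp_approx1[of t 0] by (simp add: cis_conv_exp)

text \<open>Turns a truncated binomial series in z - 1 into a polynomial in z with exponents below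
  n. For z = cis (t / N) this is a combination of the frequencies i / N with i < n.\<close>

lemma shifted_powers_expand:
  fixes c :: "nat \<Rightarrow> complex"
  shows "(\<Sum>j<n. c j * (z - 1) ^ j) =
    (\<Sum>i<n. (\<Sum>j<n. c j * (of_nat (j choose i) * (-1) ^ (j - i))) * z ^ i)"
proof -
  have "(z - 1) ^ j = (\<Sum>i<n. of_nat (j choose i) * z ^ i * (-1) ^ (j - i))" if "j < n" for j
    using that binomial_ring[of z "-1" j]
    by (auto simp: intro!: sum.mono_neutral_left)
  then have "(\<Sum>j<n. c j * (z - 1) ^ j) = (\<Sum>j<n. \<Sum>i<n. c j * (of_nat (j choose i) * (-1) ^ (j - i)) * z ^ i)"
    by (intro sum.cong) (auto simp: sum_distrib_left mult_ac)
  then show ?thesis by (subst (asm) sum.swap) (simp add: sum_distrib_right)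
qed

text \<open>With \<open>z = cis (t / N)\<close> one has \<open>cis t = (1 + (z - 1)) ^ N\<close>; the binomial series truncated at
  a degree independent of \<open>N\<close> only involves frequencies close to \<open>0\<close> when \<open>N\<close> is large.\<close>
lemma cis_low_frequency_approx:
  fixes b \<eta> s :: real
  assumes "b > 0" "\<eta> > 0" "s > 0"
  obtains N n :: nat and a :: "nat \<Rightarrow> complex"
  where "N > 0" "real n / real N \<le> s"
    "\<And>t. \<bar>t\<bar> \<le> b \<Longrightarrow> cmod (cis t - (\<Sum>i<n. a i * cis (t * (real i / real N)))) \<le> \<eta>"
proof -
  have "summable (\<lambda>j. b ^ j / fact j)" using summable_exp[of b] by (simp add: field_simps)
  from this[unfolded summable_Cauchy, rule_format, OF \<open>\<eta> > 0\<close>]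
  obtain n where n: "\<And>m k. m \<ge> n \<Longrightarrow> norm (\<Sum>j=m..<k. b ^ j / fact j) < \<eta>" by blast
  \<comment> \<open>The bound n / s keeps the frequencies i / N within s; N > n makes the truncated
    sum an initial part of the binomial expansion and N nonzero.\<close>
  obtain N :: nat where N: "real N \<ge> real n / s + real n + 1" using real_arch_simple by blast
  have "real n / s \<ge> 0" using assms by simp
  with N have "real N \<ge> real n + 1" "real N \<ge> real n / s" by linarith+
  then have N': "N > n" "N > 0" by linarith+
  define c where "c j = (of_nat (N choose j) :: complex)" for j
  define a where "a i = (\<Sum>j<n. c j * (of_nat (j choose i) * (-1) ^ (j - i)))" for i
  show thesis
  proof
    show "N > 0" by fact
    show "real n / real N \<le> s" using \<open>real N \<ge> real n / s\<close> N' assms by (simp add: field_simps)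
    fix t :: real assume t: "\<bar>t\<bar> \<le> b"
    define z where "z = cis (t / real N)"
    have "cis (t * (real i / real N)) = z ^ i" for i by (simp add: z_def Complex.DeMoivre mult.commute)
    then have 1: "(\<Sum>i<n. a i * cis (t * (real i / real N))) = (\<Sum>j<n. c j * (z - 1) ^ j)"
      by (simp add: a_def shifted_powers_expand)
    have "cis t = z ^ N" using N' by (simp add: z_def Complex.DeMoivre)
    also have "\<dots> = ((z - 1) + 1) ^ N" by simp
    also have "\<dots> = (\<Sum>j<Suc N. c j * (z - 1) ^ j)"
      by (subst binomial_ring) (simp add: c_def lessThan_Suc_atMost)
    also have "\<dots> = (\<Sum>j<n. c j * (z - 1) ^ j) + (\<Sum>j=n..<Suc N. c j * (z - 1) ^ j)"
      using N' by (simp add: sum.atLeastLessThan_concat lessThan_atLeast0)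
    finally have "cmod (cis t - (\<Sum>i<n. a i * cis (t * (real i / real N)))) = cmod (\<Sum>j=n..<Suc N. c j * (z - 1) ^ j)"
      unfolding 1 by simp
    also have "\<dots> \<le> (\<Sum>j=n..<Suc N. b ^ j / fact j)"
    proof (rule sum_norm_le)
      fix j
      have "cmod (z - 1) \<le> b / real N"
        using cis_minus_1_le[of "t / real N"] t by (simp add: z_def abs_divide divide_right_mono order_trans)
      then have "cmod (z - 1) ^ j \<le> (b / real N) ^ j" by (intro power_mono) auto
      \<comment> \<open>The power N^j cancels against (b / N)^j, so the remainder is dominated by an
        exponential tail that does not see N. This is why n can be fixed before N.\<close>
      moreover have "real (N choose j) * fact j \<le> real N ^ j"
        by (metis binomial_fact_pow of_nat_fact of_nat_le_iff of_nat_mult of_nat_power)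
      then have "real (N choose j) \<le> real N ^ j / fact j"
        by (simp add: pos_le_divide_eq)
      ultimately have "real (N choose j) * cmod (z - 1) ^ j \<le> (real N ^ j / fact j) * (b / real N) ^ j"
        by (intro mult_mono) auto
      also have "\<dots> = b ^ j / fact j" using N' by (simp add: power_divide)
      finally show "cmod (c j * (z - 1) ^ j) \<le> b ^ j / fact j" by (simp add: c_def norm_mult norm_power)
    qed
    also have "\<dots> \<le> \<eta>" using n[of n "Suc N"] by simp
    finally show "cmod (cis t - (\<Sum>i<n. a i * cis (t * (real i / real N)))) \<le> \<eta>" .
  qed
qed

lemma ft_diff: "integrable lborel f \<Longrightarrow> integrable lborel g \<Longrightarrow> ft (\<lambda>x. f x - g x) \<zeta> = ft f \<zeta> - ft g \<zeta>"
  unfolding ft_def left_diff_distrib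
  by (intro Bochner_Integration.integral_diff integrable_mult_cis) auto

lemma ft_sum:
  assumes "\<And>i. i \<in> I \<Longrightarrow> integrable lborel (f i)"
  shows "ft (\<lambda>x. \<Sum>i\<in>I. f i x) \<zeta> = (\<Sum>i\<in>I. ft (f i) \<zeta>)"
  unfolding ft_def sum_distrib_right
  by (intro Bochner_Integration.integral_sum integrable_mult_cis assms) auto

lemma ft_cmult: "ft (\<lambda>x. c * f x) \<zeta> = c * ft f \<zeta>"
  by (simp add: ft_def mult.assoc)

lemma ft_shift:
  fixes f :: "'a::euclidean_space \<Rightarrow> complex"
  shows "ft (\<lambda>x. f (x - a)) \<zeta> = cis (- (2 * pi * (a \<bullet> \<zeta>))) * ft f \<zeta>"
proof -
  have "ft (\<lambda>x. f (x - a)) \<zeta> = (\<integral>x. f (x + a - a) * cis (- (2 * pi * ((x + a) \<bullet> \<zeta>))) \<partial>lborel)"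
    unfolding ft_def by (rule integral_lborel_shift(1)[symmetric])
  also have "\<dots> = (\<integral>x. cis (- (2 * pi * (a \<bullet> \<zeta>))) * (f x * cis (- (2 * pi * (x \<bullet> \<zeta>)))) \<partial>lborel)"
    by (intro Bochner_Integration.integral_cong refl) (simp add: inner_add_left ring_distribs mult_ac, simp add: cis_mult)
  finally show ?thesis by (simp add: ft_def)
qed

lemma ft_modulate: "ft (\<lambda>x. f x * cis (- (2 * pi * (x \<bullet> \<zeta>\<^sub>0)))) \<zeta> = ft f (\<zeta> + \<zeta>\<^sub>0)"
  unfolding ft_def by (intro Bochner_Integration.integral_cong refl)
    (simp add: inner_add_right ring_distribs mult_ac, simp add: cis_mult)

lemma open_nbhd: "open (nbhd d A)"
proof -
  have "nbhd d A = (\<Union>a\<in>A. ball a d)" by (auto simp: nbhd_def dist_commute)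
  then show ?thesis by auto
qed

lemma nbhd_measurable [measurable]: "nbhd d A \<in> sets (borel :: 'a::euclidean_space measure)"
  by (simp add: open_nbhd)

lemma integrable_indicator_mult:
  fixes f :: "'a::euclidean_space \<Rightarrow> real"
  assumes "integrable lborel f" and [measurable]: "A \<in> sets borel"
  shows "integrable lborel (\<lambda>x. indicator A x * f x)"
proof -
  have [measurable]: "f \<in> borel_measurable borel" using assms(1) by auto
  show ?thesis
    by (rule Bochner_Integration.integrable_bound[OF assms(1)]) (auto simp: indicator_def)
qed

text \<open>On the Fourier side, replacing the long translate by short ones multiplies
  \<open>ft g\<close> by a symbol of size at most \<eta> wherever \<open>ft g\<close> is nonzero, so
  by Plancherel the error \<open>h\<close> costs at most \<eta> times the norm of g. The short
  translates move A only within G. Hence the mass of the long translate on A is controlled by the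
  mass of g on G.\<close>

lemma translate_estimate:
  fixes g :: "'a::euclidean_space \<Rightarrow> complex"
  assumes g: "L12 g" and AG: "\<And>x i. x \<in> A \<Longrightarrow> i < n \<Longrightarrow> x - (real i / real N) *\<^sub>R w \<in> G"
    and [measurable]: "A \<in> sets borel" "G \<in> sets borel"
    and m: "\<And>\<zeta>. ft g \<zeta> \<noteq> 0 \<Longrightarrow>
      cmod (cis (- (2 * pi * (w \<bullet> \<zeta>))) - (\<Sum>i<n. a i * cis (- (2 * pi * (w \<bullet> \<zeta>)) * (real i / real N)))) \<le> \<eta>"
  shows "(\<integral>x. indicator A x * (cmod (g (x - w)))\<^sup>2 \<partial>lborel) \<le>
     2 * \<eta>\<^sup>2 * (\<integral>x. (cmod (g x))\<^sup>2 \<partial>lborel) +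
     2 * real n * (\<Sum>i<n. (cmod (a i))\<^sup>2) * (\<integral>x. indicator G x * (cmod (g x))\<^sup>2 \<partial>lborel)"
proof -
  let ?s = "\<lambda>i. (real i / real N) *\<^sub>R w"
  define u where "u x = (\<Sum>i<n. a i * g (x - ?s i))" for x
  define h where "h x = g (x - w) - u x" for x
  have uL: "L12 u" unfolding u_def by (intro L12_sum L12_cmult L12_shift g)
  have hL: "L12 h" unfolding h_def by (intro L12_diff L12_shift g uL)
  have [measurable]: "g \<in> borel_measurable borel" "h \<in> borel_measurable borel" using L12D(3) g hL by auto
  have gs: "integrable lborel (\<lambda>x. g (x - c))" for c using L12D(1)[OF L12_shift[OF g]] .
  have gs2: "integrable lborel (\<lambda>x. (cmod (g (x - c)))\<^sup>2)" for c using L12D(2)[OF L12_shift[OF g]] .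
  have fu: "ft u \<zeta> = (\<Sum>i<n. a i * (cis (- (2 * pi * (w \<bullet> \<zeta>)) * (real i / real N)) * ft g \<zeta>))" for \<zeta>
    unfolding u_def using gs by (subst ft_sum) (auto simp: ft_cmult ft_shift mult_ac)
  have fh: "ft h \<zeta> = (cis (- (2 * pi * (w \<bullet> \<zeta>))) - (\<Sum>i<n. a i * cis (- (2 * pi * (w \<bullet> \<zeta>)) * (real i / real N)))) * ft g \<zeta>" for \<zeta>
    unfolding h_def using gs L12D(1)[OF uL]
    by (subst ft_diff) (auto simp: ft_shift fu left_diff_distrib sum_distrib_right mult.assoc)
  have "(\<integral>x. (cmod (h x))\<^sup>2 \<partial>lborel) = (\<integral>\<zeta>. (cmod (ft h \<zeta>))\<^sup>2 \<partial>lborel)"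
    using plancherel(2)[OF hL] by simp
  also have "\<dots> \<le> (\<integral>\<zeta>. \<eta>\<^sup>2 * (cmod (ft g \<zeta>))\<^sup>2 \<partial>lborel)"
  proof (rule integral_mono)
    fix \<zeta> :: 'a
    show "(cmod (ft h \<zeta>))\<^sup>2 \<le> \<eta>\<^sup>2 * (cmod (ft g \<zeta>))\<^sup>2"
      using m[of \<zeta>] by (cases "ft g \<zeta> = 0") (auto simp: fh norm_mult power_mult_distrib intro!: mult_right_mono power_mono)
  qed (use plancherel(1)[OF hL] plancherel(1)[OF g] in auto)
  finally have h2: "(\<integral>x. (cmod (h x))\<^sup>2 \<partial>lborel) \<le> \<eta>\<^sup>2 * (\<integral>x. (cmod (g x))\<^sup>2 \<partial>lborel)"
    using plancherel[OF g] by simp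
  let ?I = "indicat_real A"
  have ui: "integrable lborel (\<lambda>x. \<Sum>i<n. (cmod (a i))\<^sup>2 * (?I x * (cmod (g (x - ?s i)))\<^sup>2))"
    by (intro Bochner_Integration.integrable_sum integrable_mult_right integrable_indicator_mult gs2) auto
  have "(\<integral>x. ?I x * (cmod (g (x - w)))\<^sup>2 \<partial>lborel) \<le>
     (\<integral>x. 2 * (cmod (h x))\<^sup>2 + 2 * real n * (\<Sum>i<n. (cmod (a i))\<^sup>2 * (?I x * (cmod (g (x - ?s i)))\<^sup>2)) \<partial>lborel)"
  proof (rule integral_mono)
    fix x
    \<comment> \<open>Cauchy-Schwarz over the n terms gives the factor n; the factor 2 comes from
      splitting off \<open>h\<close>.\<close>
    have "(cmod (u x))\<^sup>2 \<le> (\<Sum>i<n. cmod (a i * g (x - ?s i)))\<^sup>2"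
      unfolding u_def by (intro power_mono norm_sum) auto
    also have "\<dots> \<le> real n * (\<Sum>i<n. (cmod (a i))\<^sup>2 * (cmod (g (x - ?s i)))\<^sup>2)"
      using sum_squared_le_sum_of_squares[of "\<lambda>i. cmod (a i * g (x - ?s i))" "{..<n}"]
      by (simp add: norm_mult power_mult_distrib mult.commute)
    finally have "(cmod (g (x - w)))\<^sup>2 \<le> 2 * (cmod (h x))\<^sup>2 + 2 * (real n * (\<Sum>i<n. (cmod (a i))\<^sup>2 * (cmod (g (x - ?s i)))\<^sup>2))"
      using norm_add_sq_le[of "h x" "u x"] by (simp add: h_def)
    then show "?I x * (cmod (g (x - w)))\<^sup>2 \<le> 2 * (cmod (h x))\<^sup>2 + 2 * real n * (\<Sum>i<n. (cmod (a i))\<^sup>2 * (?I x * (cmod (g (x - ?s i)))\<^sup>2))"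
      by (cases "x \<in> A") auto
  qed (use ui L12D(2)[OF hL] gs2[of w] in \<open>auto intro: integrable_indicator_mult\<close>)
  also have "\<dots> = 2 * (\<integral>x. (cmod (h x))\<^sup>2 \<partial>lborel) + 2 * real n * (\<Sum>i<n. (cmod (a i))\<^sup>2 * (\<integral>x. ?I x * (cmod (g (x - ?s i)))\<^sup>2 \<partial>lborel))"
  proof -
    have "(\<integral>x. (\<Sum>i<n. (cmod (a i))\<^sup>2 * (?I x * (cmod (g (x - ?s i)))\<^sup>2)) \<partial>lborel) = (\<Sum>i<n. (cmod (a i))\<^sup>2 * (\<integral>x. ?I x * (cmod (g (x - ?s i)))\<^sup>2 \<partial>lborel))"
      by (subst Bochner_Integration.integral_sum) (auto intro!: integrable_mult_right integrable_indicator_mult gs2)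
    then show ?thesis using L12D(2)[OF hL] ui by simp
  qed
  also have "\<dots> \<le> 2 * (\<eta>\<^sup>2 * (\<integral>x. (cmod (g x))\<^sup>2 \<partial>lborel)) + 2 * real n * (\<Sum>i<n. (cmod (a i))\<^sup>2 * (\<integral>x. indicator G x * (cmod (g x))\<^sup>2 \<partial>lborel))"
  proof (intro add_mono mult_left_mono sum_mono h2)
    fix i assume "i \<in> {..<n}"
    have "(\<integral>x. ?I x * (cmod (g (x - ?s i)))\<^sup>2 \<partial>lborel) \<le> (\<integral>x. indicator G (x - ?s i) * (cmod (g (x - ?s i)))\<^sup>2 \<partial>lborel)"
    proof (rule integral_mono)
      show "integrable lborel (\<lambda>x. indicator G (x - ?s i) * (cmod (g (x - ?s i)))\<^sup>2)"
        using L12D(2)[OF g] by (intro integrable_lborel_shift(2)[of "\<lambda>x. indicator G x * (cmod (g x))\<^sup>2"] integrable_indicator_mult) auto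
      show "integrable lborel (\<lambda>x. ?I x * (cmod (g (x - ?s i)))\<^sup>2)"
        by (intro integrable_indicator_mult gs2) auto
    qed (use AG \<open>i \<in> {..<n}\<close> in \<open>auto simp: indicator_def\<close>)
    also have "\<dots> = (\<integral>x. indicator G x * (cmod (g x))\<^sup>2 \<partial>lborel)"
      by (rule integral_lborel_shift(2))
    finally show "(\<integral>x. ?I x * (cmod (g (x - ?s i)))\<^sup>2 \<partial>lborel) \<le> (\<integral>x. indicator G x * (cmod (g x))\<^sup>2 \<partial>lborel)" .
  qed auto
  finally show ?thesis by (simp add: sum_distrib_right mult.assoc)
qed


text \<open>For an orthonormal \<open>v\<close> the points tested are those of the cube with corner
  x and side l, so this is the form in which the control condition enters the analysis.\<close>

definition relatively_dense_along :: "nat \<Rightarrow> (nat \<Rightarrow> 'a::real_vector) \<Rightarrow> real \<Rightarrow> 'a set \<Rightarrow> bool" where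
  "relatively_dense_along k v l E \<longleftrightarrow>
     (\<forall>x. \<exists>t. (\<forall>i<k. 0 \<le> t i \<and> t i \<le> l) \<and> x + (\<Sum>i<k. t i *\<^sub>R v i) \<in> E)"

text \<open>A finite grid of vectors \<open>w \<alpha>\<close> moves every point into the \<delta> /
  2-neighbourhood of E. Summing \<open>translate_estimate\<close> over the grid bounds the full mass
  P by half of P plus a multiple of the mass on the \<delta>-neighbourhood. Grid size and
  approximating coefficients are chosen before the frame, the set, the centre and the function are
  fixed, hence the uniform constant.\<close>

lemma slab_estimate:
  fixes k :: nat and \<delta> l b :: real
  assumes "\<delta> > 0" "l > 0" "b > 0"
  shows "\<exists>C>0. \<forall>(v :: nat \<Rightarrow> 'a::euclidean_space) E \<zeta>\<^sub>0 g.
     (\<forall>i<k. norm (v i) \<le> 1) \<longrightarrow> relatively_dense_along k v l E \<longrightarrow> L12 g \<longrightarrow>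
     (\<forall>\<zeta>. ft g \<zeta> \<noteq> 0 \<longrightarrow> (\<forall>i<k. \<bar>v i \<bullet> (\<zeta> - \<zeta>\<^sub>0)\<bar> \<le> b)) \<longrightarrow>
     (\<integral>x. (cmod (g x))\<^sup>2 \<partial>lborel) \<le> C * (\<integral>x. indicator (nbhd \<delta> E) x * (cmod (g x))\<^sup>2 \<partial>lborel)"
proof -
  \<comment> \<open>Grid step: rounding all k coordinates down to multiples of \<rho> moves a point
    by at most k \<rho>, which is less than \<delta> / 2.\<close>
  define \<rho> where "\<rho> = \<delta> / (4 * (real k + 1))"
  have \<rho>: "\<rho> > 0" "real k * \<rho> < \<delta> / 2" using assms by (auto simp: \<rho>_def field_simps intro!: add_pos_nonneg)
  define m where "m = nat \<lceil>l / \<rho>\<rceil>"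
  define I where "I = PiE {..<k} (\<lambda>_. {..m})"
  have "finite I" unfolding I_def by (intro finite_PiE) auto
  moreover have "(\<lambda>i\<in>{..<k}. 0) \<in> I" by (auto simp: I_def)
  ultimately have card: "card I > 0" using card_gt_0_iff by blast
  \<comment> \<open>An upper bound for the length of every grid vector.\<close>
  define W where "W = real k * (\<rho> * real m)"
  have W: "W \<ge> 0" using \<rho> by (simp add: W_def)
  \<comment> \<open>Chosen so that the errors 2 \<eta>^2 P, one for each element of I, add up to P /
    2 and can be absorbed.\<close>
  define \<eta> where "\<eta> = sqrt (1 / (4 * real (card I)))"
  have \<eta>: "\<eta> > 0" "\<eta>\<^sup>2 = 1 / (4 * real (card I))" using card by (auto simp: \<eta>_def)
  \<comment> \<open>W b bounds the pairing of a grid vector with a slab frequency; the summand 1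
    keeps the range positive when W = 0.\<close>
  have B: "2 * pi * (W * b) + 1 > 0" using W assms by (intro add_nonneg_pos) auto
  \<comment> \<open>With this fraction a short translate of any grid vector has length at most
    \<delta> / 2, so it does not leave the \<delta>-neighbourhood when started in the \<delta> /
    2-neighbourhood.\<close>
  have s: "\<delta> / (4 * (W + 1)) > 0" using W assms by auto
  obtain N n :: nat and a :: "nat \<Rightarrow> complex" where nN: "N > 0" "real n / real N \<le> \<delta> / (4 * (W + 1))"
    and a: "\<And>t. \<bar>t\<bar> \<le> 2 * pi * (W * b) + 1 \<Longrightarrow> cmod (cis t - (\<Sum>i<n. a i * cis (t * (real i / real N)))) \<le> \<eta>"
    using cis_low_frequency_approx[OF B \<eta>(1) s] by blast
  define S where "S = 2 * real n * (\<Sum>i<n. (cmod (a i))\<^sup>2)"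
  have "S \<ge> 0" unfolding S_def by (intro mult_nonneg_nonneg sum_nonneg) auto
  show ?thesis
  proof (intro exI[of _ "2 * real (card I) * S + 1"] conjI allI impI)
    show "2 * real (card I) * S + 1 > 0" using \<open>S \<ge> 0\<close> by (intro add_nonneg_pos) auto
    fix v :: "nat \<Rightarrow> 'a" and E \<zeta>\<^sub>0 and f :: "'a \<Rightarrow> complex"
    assume v: "\<forall>i<k. norm (v i) \<le> 1" and E: "relatively_dense_along k v l E" and f: "L12 f"
      and spec: "\<forall>\<zeta>. ft f \<zeta> \<noteq> 0 \<longrightarrow> (\<forall>i<k. \<bar>v i \<bullet> (\<zeta> - \<zeta>\<^sub>0)\<bar> \<le> b)"
    \<comment> \<open>Modulation moves the centre of the slab to frequency 0 and leaves the modulus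
      unchanged, so the constant cannot depend on the centre.\<close>
    define g where "g x = f x * cis (- (2 * pi * (x \<bullet> \<zeta>\<^sub>0)))" for x
    have g: "L12 g" unfolding g_def by (intro L12_mult_cis f) auto
    have norm_g: "cmod (g x) = cmod (f x)" for x by (simp add: g_def norm_mult)
    have specg: "\<bar>v i \<bullet> \<zeta>\<bar> \<le> b" if "ft g \<zeta> \<noteq> 0" "i < k" for \<zeta> i
      using that spec[rule_format, of "\<zeta> + \<zeta>\<^sub>0" i] by (simp add: g_def[abs_def] ft_modulate)
    define w where "w \<alpha> = (\<Sum>i<k. (\<rho> * real (\<alpha> i)) *\<^sub>R v i)" for \<alpha> :: "nat \<Rightarrow> nat"
    define A where "A = nbhd (\<delta> / 2) E"
    define G where "G = nbhd \<delta> E"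
    have [measurable]: "A \<in> sets borel" "G \<in> sets borel" by (auto simp: A_def G_def)
    have cover: "\<exists>\<alpha>\<in>I. x + w \<alpha> \<in> A" for x
    proof -
      obtain t where t: "\<And>i. i < k \<Longrightarrow> 0 \<le> t i \<and> t i \<le> l" "x + (\<Sum>i<k. t i *\<^sub>R v i) \<in> E"
        using E unfolding relatively_dense_along_def by blast
      define \<alpha> where "\<alpha> = (\<lambda>i\<in>{..<k}. nat \<lfloor>t i / \<rho>\<rfloor>)"
      have "nat \<lfloor>t i / \<rho>\<rfloor> \<le> m" if "i < k" for i
      proof -
        have "t i / \<rho> \<le> l / \<rho>" using t(1)[OF that] \<rho> by (intro divide_right_mono) auto
        then have "\<lfloor>t i / \<rho>\<rfloor> \<le> \<lceil>l / \<rho>\<rceil>" by (meson floor_le_ceiling floor_mono order_trans)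
        then show ?thesis unfolding m_def by (rule nat_mono)
      qed
      then have "\<alpha> \<in> I" by (auto simp: I_def \<alpha>_def)
      have close: "\<bar>\<rho> * real (\<alpha> i) - t i\<bar> \<le> \<rho>" if "i < k" for i
      proof -
        have "real (\<alpha> i) = real_of_int \<lfloor>t i / \<rho>\<rfloor>" using t(1)[OF that] \<rho> that by (simp add: \<alpha>_def)
        then have "\<rho> * real (\<alpha> i) \<le> \<rho> * (t i / \<rho>)" "\<rho> * (t i / \<rho>) \<le> \<rho> * (real (\<alpha> i) + 1)"
          using \<rho> by (intro mult_left_mono; linarith)+
        moreover have "\<rho> * (t i / \<rho>) = t i" using \<rho> by simp
        ultimately have "\<rho> * real (\<alpha> i) \<le> t i" "t i \<le> \<rho> * real (\<alpha> i) + \<rho>"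
          by (auto simp: distrib_left)
        then show ?thesis by simp
      qed
      have "norm ((x + w \<alpha>) - (x + (\<Sum>i<k. t i *\<^sub>R v i))) = norm (\<Sum>i<k. (\<rho> * real (\<alpha> i) - t i) *\<^sub>R v i)"
        by (simp add: w_def sum_subtractf scaleR_left_diff_distrib)
      also have "\<dots> \<le> (\<Sum>i<k. \<rho> * 1)"
        by (intro sum_norm_le, unfold norm_scaleR, intro mult_mono) (use close v \<rho> in auto)
      also have "\<dots> < \<delta> / 2" using \<rho> by simp
      finally have "x + w \<alpha> \<in> A"
        unfolding A_def nbhd_def mem_Collect_eq dist_norm using t(2) by (rule bexI)
      with \<open>\<alpha> \<in> I\<close> show ?thesis by blast
    qed
    have \<alpha>_le: "\<rho> * real (\<alpha> i) \<le> \<rho> * real m" if "\<alpha> \<in> I" "i < k" for \<alpha> i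
      using that \<rho> by (intro mult_left_mono) (auto simp: I_def PiE_def Pi_def)
    define P where "P = (\<integral>x. (cmod (g x))\<^sup>2 \<partial>lborel)"
    define Q where "Q = (\<integral>x. indicator G x * (cmod (g x))\<^sup>2 \<partial>lborel)"
    have "Q \<ge> 0" unfolding Q_def by (intro integral_nonneg_AE) auto
    have est: "(\<integral>x. indicator A x * (cmod (g (x - w \<alpha>)))\<^sup>2 \<partial>lborel) \<le> 2 * \<eta>\<^sup>2 * P + S * Q" if \<alpha>: "\<alpha> \<in> I" for \<alpha>
      unfolding P_def Q_def S_def
    proof (rule translate_estimate[OF g])
      have "norm (w \<alpha>) \<le> (\<Sum>i<k. (\<rho> * real m) * 1)"
        unfolding w_def
        by (intro sum_norm_le, unfold norm_scaleR, intro mult_mono) (use \<alpha>_le[OF \<alpha>] v \<rho> in auto)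
      then have nw: "norm (w \<alpha>) \<le> W" by (simp add: W_def)
      fix x i assume x: "x \<in> A" "i < n"
      then obtain e where e: "e \<in> E" "dist x e < \<delta> / 2" by (auto simp: A_def nbhd_def)
      have "real i / real N \<le> \<delta> / (4 * (W + 1))" using x(2) nN by (smt (verit) divide_right_mono of_nat_0_le_iff of_nat_less_iff)
      then have "norm ((real i / real N) *\<^sub>R w \<alpha>) \<le> \<delta> / (4 * (W + 1)) * W"
        unfolding norm_scaleR using nw s by (intro mult_mono) auto
      also have "\<dots> \<le> \<delta> / 2"
        using W assms by (simp add: field_simps)
      finally have "norm ((real i / real N) *\<^sub>R w \<alpha>) \<le> \<delta> / 2" .
      then have "norm (x - e - (real i / real N) *\<^sub>R w \<alpha>) < \<delta>"
        using e(2) norm_triangle_ineq4[of "x - e" "(real i / real N) *\<^sub>R w \<alpha>"] unfolding dist_norm by linarith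
      then have "dist (x - (real i / real N) *\<^sub>R w \<alpha>) e < \<delta>"
        unfolding dist_norm by (simp add: algebra_simps)
      then show "x - (real i / real N) *\<^sub>R w \<alpha> \<in> G" using e(1) by (auto simp: G_def nbhd_def)
    next
      fix \<zeta> assume "ft g \<zeta> \<noteq> 0"
      then have "\<bar>v i \<bullet> \<zeta>\<bar> \<le> b" if "i < k" for i using that specg by blast
      then have "\<bar>w \<alpha> \<bullet> \<zeta>\<bar> \<le> (\<Sum>i<k. (\<rho> * real m) * b)"
        unfolding w_def inner_sum_left inner_scaleR_left real_norm_def[symmetric] using \<alpha>_le[OF \<alpha>] \<rho> assms
        by (intro sum_norm_le) (auto intro!: mult_mono simp: abs_mult)
      then have "2 * pi * \<bar>w \<alpha> \<bullet> \<zeta>\<bar> \<le> 2 * pi * (W * b)" by (intro mult_left_mono) (auto simp: W_def)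
      then have "\<bar>- (2 * pi * (w \<alpha> \<bullet> \<zeta>))\<bar> \<le> 2 * pi * (W * b) + 1"
        unfolding abs_minus_cancel abs_mult abs_numeral abs_of_pos[OF pi_gt_zero] by linarith
      then show "cmod (cis (- (2 * pi * (w \<alpha> \<bullet> \<zeta>))) - (\<Sum>i<n. a i * cis (- (2 * pi * (w \<alpha> \<bullet> \<zeta>)) * (real i / real N)))) \<le> \<eta>"
        by (rule a)
    qed auto
    have int: "integrable lborel (\<lambda>x. indicator A (x + w \<alpha>) * (cmod (g x))\<^sup>2)" for \<alpha>
    proof -
      have "integrable lborel (\<lambda>x. indicator A x * (cmod (g (x - w \<alpha>)))\<^sup>2)"
        using L12D(2)[OF L12_shift[OF g]] by (intro integrable_indicator_mult) auto
      from integrable_lborel_shift(1)[OF this, of "w \<alpha>"] show ?thesis by simp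
    qed
    \<comment> \<open>Every x is counted at least once by the translates of A; a change of variable
      then moves the translation from A onto g.\<close>
    have "P \<le> (\<integral>x. (\<Sum>\<alpha>\<in>I. indicator A (x + w \<alpha>) * (cmod (g x))\<^sup>2) \<partial>lborel)"
      unfolding P_def
    proof (rule integral_mono)
      fix x
      obtain \<alpha> where \<alpha>: "\<alpha> \<in> I" "x + w \<alpha> \<in> A" using cover by blast
      have "(cmod (g x))\<^sup>2 = indicator A (x + w \<alpha>) * (cmod (g x))\<^sup>2" using \<alpha>(2) by simp
      also have "\<dots> \<le> (\<Sum>\<alpha>\<in>I. indicator A (x + w \<alpha>) * (cmod (g x))\<^sup>2)"
        by (rule member_le_sum) (use \<alpha>(1) \<open>finite I\<close> in auto)
      finally show "(cmod (g x))\<^sup>2 \<le> (\<Sum>\<alpha>\<in>I. indicator A (x + w \<alpha>) * (cmod (g x))\<^sup>2)" .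
    qed (use int L12D(2)[OF g] in auto)
    also have "\<dots> = (\<Sum>\<alpha>\<in>I. \<integral>x. indicator A (x + w \<alpha>) * (cmod (g x))\<^sup>2 \<partial>lborel)"
      using int by (intro Bochner_Integration.integral_sum) auto
    also have "\<dots> = (\<Sum>\<alpha>\<in>I. \<integral>x. indicator A x * (cmod (g (x - w \<alpha>)))\<^sup>2 \<partial>lborel)"
    proof (rule sum.cong[OF refl])
      fix \<alpha>
      show "(\<integral>x. indicator A (x + w \<alpha>) * (cmod (g x))\<^sup>2 \<partial>lborel) = (\<integral>x. indicator A x * (cmod (g (x - w \<alpha>)))\<^sup>2 \<partial>lborel)"
        using integral_lborel_shift(1)[of "\<lambda>x. indicator A x * (cmod (g (x - w \<alpha>)))\<^sup>2" "w \<alpha>"] by simp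
    qed
    also have "\<dots> \<le> (\<Sum>\<alpha>\<in>I. 2 * \<eta>\<^sup>2 * P + S * Q)" by (intro sum_mono est)
    also have "\<dots> = P / 2 + real (card I) * (S * Q)" using card by (simp add: \<eta> field_simps)
    finally have "P \<le> 2 * real (card I) * S * Q" by simp
    also have "\<dots> \<le> (2 * real (card I) * S + 1) * Q" using \<open>Q \<ge> 0\<close> by (intro mult_right_mono) auto
    finally show "(\<integral>x. (cmod (f x))\<^sup>2 \<partial>lborel) \<le> (2 * real (card I) * S + 1) * (\<integral>x. indicator (nbhd \<delta> E) x * (cmod (f x))\<^sup>2 \<partial>lborel)"
      by (simp add: P_def Q_def G_def norm_g)
  qed
qed

subsection \<open>A localised band-limited kernel\<close>

lemma L12_bounded_mult:
  fixes f g :: "'a::euclidean_space \<Rightarrow> complex"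
  assumes f: "L12 f" and [measurable]: "g \<in> borel_measurable borel" and B: "\<And>x. cmod (g x) \<le> B"
  shows "L12 (\<lambda>x. f x * g x)"
proof -
  have [measurable]: "f \<in> borel_measurable borel" using L12D(3)[OF f] .
  have B0: "B \<ge> 0" using B[of undefined] norm_ge_zero order_trans by blast
  have le: "cmod (f x * g x) \<le> B * cmod (f x)" for x
    unfolding norm_mult using mult_left_mono[OF B norm_ge_zero, of "f x" x] by (simp add: mult.commute)
  show ?thesis unfolding L12_def
  proof
    show "integrable lborel (\<lambda>x. f x * g x)"
    proof (rule Bochner_Integration.integrable_bound)
      show "integrable lborel (\<lambda>x. B * norm (f x))" using L12D(1)[OF f] by simp
      show "AE x in lborel. norm (f x * g x) \<le> norm (B * norm (f x))"
        using le B0 by (auto simp: abs_mult)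
    qed measurable
    show "integrable lborel (\<lambda>x. (cmod (f x * g x))\<^sup>2)"
    proof (rule Bochner_Integration.integrable_bound)
      show "integrable lborel (\<lambda>x. B\<^sup>2 * (cmod (f x))\<^sup>2)" using L12D(2)[OF f] by simp
      show "AE x in lborel. norm ((cmod (f x * g x))\<^sup>2) \<le> norm (B\<^sup>2 * (cmod (f x))\<^sup>2)"
        using power_mono[OF le norm_ge_zero, of _ 2] by (auto simp: power_mult_distrib)
    qed measurable
  qed
qed

lemma L12_integrable_bounded:
  fixes f :: "'a::euclidean_space \<Rightarrow> complex"
  assumes f: "integrable lborel f" and B: "\<And>x. cmod (f x) \<le> B"
  shows "L12 f"
  unfolding L12_def
proof
  have [measurable]: "f \<in> borel_measurable borel" using f by auto
  show "integrable lborel (\<lambda>x. (cmod (f x))\<^sup>2)"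
  proof (rule Bochner_Integration.integrable_bound)
    show "integrable lborel (\<lambda>x. B * norm (f x))" using f by simp
    show "AE x in lborel. norm ((cmod (f x))\<^sup>2) \<le> norm (B * norm (f x))"
      using B norm_ge_zero[of "f undefined"] order_trans[OF norm_ge_zero B] by (auto simp: abs_mult power2_eq_square intro!: AE_I2 mult_right_mono)
  qed measurable
qed (rule f)

lemma L12_compact_support:
  fixes \<psi> :: "'a::euclidean_space \<Rightarrow> complex"
  assumes c: "continuous_on UNIV \<psi>" and K: "compact K" "\<And>x. x \<notin> K \<Longrightarrow> \<psi> x = 0"
  shows "L12 \<psi>"
proof -
  have [measurable]: "\<psi> \<in> borel_measurable borel" using c by (rule borel_measurable_continuous_onI)
  have "compact (\<psi> ` K)" using c K by (meson compact_continuous_image continuous_on_subset subset_UNIV)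
  then obtain B where B: "\<And>x. x \<in> K \<Longrightarrow> cmod (\<psi> x) \<le> B" "B > 0"
    using compact_imp_bounded bounded_pos by (metis image_eqI)
  then have B': "cmod (\<psi> x) \<le> B" for x using K(2)[of x] by (cases "x \<in> K") auto
  have "integrable lborel \<psi>"
  proof (rule Bochner_Integration.integrable_bound)
    show "integrable lborel (\<lambda>x. B * indicator K x)"
      using emeasure_bounded_finite[OF compact_imp_bounded[OF K(1)]] K(1)
      by (intro integrable_mult_right integrable_real_indicator) (auto simp: compact_imp_closed)
    show "AE x in lborel. norm (\<psi> x) \<le> norm (B * indicat_real K x)"
      using B K(2) by (auto simp: indicator_def intro!: AE_I2)
  qed measurable
  then show ?thesis using B' by (rule L12_integrable_bounded)
qed

text \<open>Polarisation: for unimodular c, disjointness gives |f + c g|^2 = |f|^2 + |g|^2, so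
  Plancherel forces the cross term on the Fourier side to vanish. The choices c = 1 and c = \<i>
  give its real and imaginary parts.\<close>

lemma parseval_disjoint:
  fixes f g :: "'a::euclidean_space \<Rightarrow> complex"
  assumes f: "L12 f" and g: "L12 g" and disj: "\<And>x. f x = 0 \<or> g x = 0"
  shows "(\<integral>\<zeta>. ft f \<zeta> * cnj (ft g \<zeta>) \<partial>lborel) = 0"
proof -
  let ?A = "ft f" and ?B = "ft g"
  have [measurable]: "f \<in> borel_measurable borel" "g \<in> borel_measurable borel" using f g L12D(3) by auto
  have int: "integrable lborel (\<lambda>\<zeta>. ?A \<zeta> * cnj (?B \<zeta>))"
    using plancherel(1)[OF f] plancherel(1)[OF g] by (intro integrable_mult_L2) auto
  have key: "(\<integral>\<zeta>. Re (cnj c * (?A \<zeta> * cnj (?B \<zeta>))) \<partial>lborel) = 0" if c: "cmod c = 1" for c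
  proof -
    let ?h = "\<lambda>x. f x + c * g x"
    have h: "L12 ?h" by (intro L12_add L12_cmult f g)
    have fh: "ft ?h \<zeta> = ?A \<zeta> + c * ?B \<zeta>" for \<zeta>
      using L12D(1)[OF f] L12D(1)[OF g] ft_sum[of "{True,False}" "\<lambda>b. if b then f else (\<lambda>x. c * g x)" \<zeta>] by (simp add: ft_cmult)
    have 1: "(cmod (?h x))\<^sup>2 = (cmod (f x))\<^sup>2 + (cmod (g x))\<^sup>2" for x
      using disj[of x] c by (auto simp: norm_mult)
    have 2: "(cmod (ft ?h \<zeta>))\<^sup>2 = (cmod (?A \<zeta>))\<^sup>2 + (cmod (?B \<zeta>))\<^sup>2 + 2 * Re (cnj c * (?A \<zeta> * cnj (?B \<zeta>)))" for \<zeta>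
    proof -
      have "(cmod (?A \<zeta> + c * ?B \<zeta>))\<^sup>2 = (cmod (?A \<zeta>))\<^sup>2 + (cmod (c * ?B \<zeta>))\<^sup>2 + 2 * Re (?A \<zeta> * cnj (c * ?B \<zeta>))"
        unfolding cmod_power2 by (simp add: power2_eq_square algebra_simps)
      then show ?thesis using c by (simp add: fh norm_mult mult_ac)
    qed
    have ci: "integrable lborel (\<lambda>\<zeta>. Re (cnj c * (?A \<zeta> * cnj (?B \<zeta>))))"
      by (intro integrable_Re integrable_mult_right int)
    have "(\<integral>\<zeta>. (cmod (ft ?h \<zeta>))\<^sup>2 \<partial>lborel) = (\<integral>x. (cmod (f x))\<^sup>2 \<partial>lborel) + (\<integral>x. (cmod (g x))\<^sup>2 \<partial>lborel)"
      unfolding plancherel(2)[OF h] 1 using L12D(2)[OF f] L12D(2)[OF g] by simp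
    moreover have "(\<integral>\<zeta>. (cmod (ft ?h \<zeta>))\<^sup>2 \<partial>lborel) = (\<integral>x. (cmod (f x))\<^sup>2 \<partial>lborel) + (\<integral>x. (cmod (g x))\<^sup>2 \<partial>lborel)
        + 2 * (\<integral>\<zeta>. Re (cnj c * (?A \<zeta> * cnj (?B \<zeta>))) \<partial>lborel)"
      unfolding 2 plancherel(2)[OF f, symmetric] plancherel(2)[OF g, symmetric]
      using plancherel(1)[OF f] plancherel(1)[OF g] ci by (simp del: Re_complex_div_eq_0 times_complex.sel)
    ultimately show ?thesis by simp
  qed
  have R: "Re (\<integral>\<zeta>. ?A \<zeta> * cnj (?B \<zeta>) \<partial>lborel) = 0"
    using key[of 1] unfolding integral_Re[OF int, symmetric] by simp
  have I: "Im (\<integral>\<zeta>. ?A \<zeta> * cnj (?B \<zeta>) \<partial>lborel) = 0"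
  proof -
    have "Re (cnj \<i> * w) = Im w" for w by simp
    then show ?thesis using key[of \<i>] unfolding integral_Im[OF int, symmetric] by simp
  qed
  show ?thesis using R I by (simp add: complex_eq_iff)
qed

lemma ft_continuous:
  fixes f :: "'a::euclidean_space \<Rightarrow> complex"
  assumes f: "integrable lborel f" and z: "z \<longlonglongrightarrow> \<zeta>"
  shows "(\<lambda>n. ft f (z n)) \<longlonglongrightarrow> ft f \<zeta>"
  unfolding ft_def
proof (rule integral_dominated_convergence[where w="\<lambda>x. norm (f x)"])
  have [measurable]: "f \<in> borel_measurable borel" using f by auto
  show "AE x in lborel. (\<lambda>n. f x * cis (- (2 * pi * (x \<bullet> z n)))) \<longlonglongrightarrow> f x * cis (- (2 * pi * (x \<bullet> \<zeta>)))"
    by (intro AE_I2 tendsto_intros z)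
  show "(\<lambda>x. f x * cis (- (2 * pi * (x \<bullet> \<zeta>)))) \<in> borel_measurable lborel"
    "(\<lambda>x. f x * cis (- (2 * pi * (x \<bullet> z n)))) \<in> borel_measurable lborel" for n by measurable
qed (use f in \<open>auto simp: norm_mult\<close>)

text \<open>A bump used twice: its transform produces the band-limited window, and its dilates serve
  as test functions for \<open>spec\<close>, which are only required to be continuous.\<close>

definition tent :: "'a::euclidean_space \<Rightarrow> complex" where
  "tent x = complex_of_real (max 0 (1 - norm x))"

lemma tent_continuous: "continuous_on UNIV tent"
  unfolding tent_def by (intro continuous_intros)

lemma tent_zero: "norm x \<ge> 1 \<Longrightarrow> tent x = 0"
  by (simp add: tent_def max_def)

lemma norm_tent: "cmod (tent x) = max 0 (1 - norm x)"
  unfolding tent_def norm_of_real by simp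

lemma L12_tent: "L12 (tent :: 'a::euclidean_space \<Rightarrow> complex)"
  by (rule L12_compact_support[OF tent_continuous compact_cball[of 0 1]]) (auto intro: tent_zero)

lemma tent_integral_pos: "0 < (\<integral>x. (cmod (tent (x::'a::euclidean_space)))\<^sup>2 \<partial>lborel)"
proof -
  have "(\<integral>x. (1/4) * indicator (ball 0 (1/2)) (x::'a) \<partial>lborel) \<le> (\<integral>x. (cmod (tent (x::'a)))\<^sup>2 \<partial>lborel)"
  proof (rule integral_mono')
    show "integrable lborel (\<lambda>x. (cmod (tent (x::'a)))\<^sup>2)" by (rule L12D(2)[OF L12_tent])
    fix x :: 'a
    have "(1/2)\<^sup>2 \<le> (cmod (tent x))\<^sup>2" if "norm x < 1/2"
      using that by (intro power_mono) (auto simp: norm_tent)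
    then show "(1/4) * indicator (ball 0 (1/2)) x \<le> (cmod (tent x))\<^sup>2"
      by (auto simp: indicator_def power2_eq_square)
  qed auto
  moreover have "(\<integral>x. (1/4) * indicator (ball 0 (1/2)) (x::'a) \<partial>lborel) = measure lborel (ball (0::'a) (1/2)) / 4"
    by simp
  moreover have "0 < measure lborel (ball (0::'a) (1/2))"
    by (rule content_ball_pos) simp
  ultimately show ?thesis by linarith
qed

text \<open>As 0 \<le> \<open>tent\<close> \<le> 1, its integral dominates that of its square. The
  value at 0 later normalises the multipliers that tend to 1.\<close>

lemma ft_tent_0: "ft (tent :: 'a::euclidean_space \<Rightarrow> complex) 0 \<noteq> 0"
proof -
  have i: "integrable lborel (\<lambda>x::'a. cmod (tent x))" by (intro integrable_norm L12D(1)[OF L12_tent])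
  have "(\<integral>x. (cmod (tent (x::'a)))\<^sup>2 \<partial>lborel) \<le> (\<integral>x. cmod (tent (x::'a)) \<partial>lborel)"
  proof (rule integral_mono[OF L12D(2)[OF L12_tent] i])
    fix x :: 'a
    have "cmod (tent x) \<le> 1" by (simp add: norm_tent)
    then show "(cmod (tent x))\<^sup>2 \<le> cmod (tent x)" by (simp add: power2_eq_square mult_left_le)
  qed
  moreover have "ft (tent :: 'a \<Rightarrow> complex) 0 = complex_of_real (\<integral>x. cmod (tent (x::'a)) \<partial>lborel)"
    unfolding ft_def by (subst integral_complex_of_real[symmetric]) (simp add: tent_def)
  ultimately show ?thesis using tent_integral_pos[where 'a='a] by simp
qed

text \<open>Squaring the modulus makes the kernel integrable by Plancherel, while it stays
  band-limited, with twice the radius of the support of the bump.\<close>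

definition fejer :: "'a::euclidean_space \<Rightarrow> complex" where
  "fejer z = complex_of_real ((cmod (ft tent z))\<^sup>2)"

lemma tent_measurable [measurable]: "(tent :: 'a::euclidean_space \<Rightarrow> complex) \<in> borel_measurable borel"
  using L12D(3)[OF L12_tent] .

lemma fejer_bound:
  fixes z :: "'a::euclidean_space"
  shows "cmod (fejer z) \<le> (\<integral>x. norm (tent (x::'a)) \<partial>lborel)\<^sup>2"
  unfolding fejer_def using norm_ft_le[of tent z] by (auto simp: norm_power intro!: power_mono)

lemma L12_fejer: "L12 (fejer :: 'a::euclidean_space \<Rightarrow> complex)"
proof (rule L12_integrable_bounded[OF _ fejer_bound])
  show "integrable lborel (fejer :: 'a \<Rightarrow> complex)"
    unfolding fejer_def[abs_def] complex_of_real_integrable_eq by (rule plancherel(1)[OF L12_tent])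
qed

lemma fejer_L2_pos: "0 < (\<integral>x. (cmod (fejer (x::'a::euclidean_space)))\<^sup>2 \<partial>lborel)"
proof (rule ccontr)
  assume "\<not> 0 < (\<integral>x. (cmod (fejer (x::'a)))\<^sup>2 \<partial>lborel)"
  moreover have "0 \<le> (\<integral>x. (cmod (fejer (x::'a)))\<^sup>2 \<partial>lborel)" by simp
  ultimately have "(\<integral>x. (cmod (fejer (x::'a)))\<^sup>2 \<partial>lborel) = 0" by linarith
  then have "AE x in lborel. (cmod (fejer (x::'a)))\<^sup>2 = 0"
    by (subst (asm) integral_nonneg_eq_0_iff_AE) (auto intro: L12D(2)[OF L12_fejer])
  then have "AE x in lborel. (cmod (ft tent (x::'a)))\<^sup>2 = 0"
    by (rule AE_mp) (auto simp: fejer_def)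
  then have "(\<integral>x. (cmod (ft tent (x::'a)))\<^sup>2 \<partial>lborel) = 0"
    by (rule integral_eq_zero_AE)
  then show False using plancherel(2)[OF L12_tent[where 'a='a]] tent_integral_pos[where 'a='a] by simp
qed

text \<open>The phase at \<zeta> shifts one of the two factors \<open>tent\<close> by \<zeta>. Two
  unit bumps whose centres are at distance at least 2 are disjoint, so
  \<open>parseval_disjoint\<close> replaces an appeal to Fourier inversion.\<close>

lemma ft_fejer_eq_0:
  fixes \<zeta> :: "'a::euclidean_space"
  assumes "norm \<zeta> \<ge> 2"
  shows "ft fejer \<zeta> = 0"
proof -
  have "ft fejer \<zeta> = (\<integral>z. ft (\<lambda>x. tent (x - \<zeta>)) z * cnj (ft tent z) \<partial>lborel)"
    unfolding ft_def[of fejer] ft_shift fejer_def complex_norm_square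
    by (simp add: mult_ac inner_commute)
  also have "\<dots> = 0"
  proof (rule parseval_disjoint[OF L12_shift[OF L12_tent] L12_tent])
    fix x
    have "norm \<zeta> \<le> norm x + norm (x - \<zeta>)"
      using norm_triangle_ineq4[of x "x - \<zeta>"] by simp
    then have "norm (x - \<zeta>) \<ge> 1 \<or> norm x \<ge> 1" using assms by linarith
    then show "tent (x - \<zeta>) = 0 \<or> tent x = 0" using tent_zero by blast
  qed
  finally show ?thesis .
qed

text \<open>Compressing \<open>fejer\<close> by a large factor pushes its mass into a small ball at
  the price of a larger bandwidth. The relative tail is the quantity that scaling preserves, so it
  can be read off from the tail of \<open>fejer\<close> beyond n \<rho>.\<close>

lemma localized_kernel:
  fixes \<rho> \<kappa> :: real
  assumes "\<rho> > 0" "\<kappa> > 0"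
  shows "\<exists>(k :: 'a::euclidean_space \<Rightarrow> complex) M B. M > 0 \<and> integrable lborel k \<and> (\<forall>x. cmod (k x) \<le> B) \<and>
     0 < (\<integral>x. (cmod (k x))\<^sup>2 \<partial>lborel) \<and> (\<forall>\<zeta>. ft k \<zeta> \<noteq> 0 \<longrightarrow> norm \<zeta> < M) \<and>
     (\<integral>x. indicator {z. \<rho> \<le> norm z} x * (cmod (k x))\<^sup>2 \<partial>lborel) \<le> \<kappa> * (\<integral>x. (cmod (k x))\<^sup>2 \<partial>lborel)"
proof -
  let ?K = "fejer :: 'a \<Rightarrow> complex"
  note K = L12D[OF L12_fejer[where 'a='a]]
  note [measurable] = K(3)
  have "(\<lambda>n. \<integral>x. indicator {z. real n * \<rho> \<le> norm z} x * (cmod (?K x))\<^sup>2 \<partial>lborel) \<longlonglongrightarrow> (\<integral>x. 0 \<partial>(lborel :: 'a measure))"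
  proof (rule integral_dominated_convergence[OF _ _ K(2)])
    show "AE x in lborel. (\<lambda>n. indicator {z. real n * \<rho> \<le> norm z} x * (cmod (?K x))\<^sup>2) \<longlonglongrightarrow> 0"
    proof (rule AE_I2)
      fix x :: 'a
      obtain n0 :: nat where n0: "norm x / \<rho> < real n0" using reals_Archimedean2 by blast
      have "norm x < real n * \<rho>" if "n \<ge> n0" for n
      proof -
        have "norm x / \<rho> < real n" using n0 that by (meson less_le_trans of_nat_le_iff)
        then show ?thesis using assms(1) by (simp add: divide_less_eq)
      qed
      then have "\<forall>n\<ge>n0. indicator {z. real n * \<rho> \<le> norm z} x * (cmod (?K x))\<^sup>2 = 0"
        by (auto simp: indicator_def not_le)
      then show "(\<lambda>n. indicator {z. real n * \<rho> \<le> norm z} x * (cmod (?K x))\<^sup>2) \<longlonglongrightarrow> 0"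
        by (intro tendsto_eventually) (auto simp: eventually_sequentially)
    qed
  qed (auto simp: indicator_def)
  moreover have "\<kappa> * (\<integral>x. (cmod (?K x))\<^sup>2 \<partial>lborel) > 0" using fejer_L2_pos[where 'a='a] assms by auto
  ultimately have "\<forall>\<^sub>F n in sequentially. (\<integral>x. indicator {z. real n * \<rho> \<le> norm z} x * (cmod (?K x))\<^sup>2 \<partial>lborel) < \<kappa> * (\<integral>x. (cmod (?K x))\<^sup>2 \<partial>lborel)"
    by (intro order_tendstoD(2)[of _ "\<integral>x. 0 \<partial>(lborel :: 'a measure)"]) auto
  then have "\<forall>\<^sub>F n in sequentially. n > 0 \<and> (\<integral>x. indicator {z. real n * \<rho> \<le> norm z} x * (cmod (?K x))\<^sup>2 \<partial>lborel) < \<kappa> * (\<integral>x. (cmod (?K x))\<^sup>2 \<partial>lborel)"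
    using eventually_gt_at_top[of 0] by eventually_elim auto
  then obtain n where n: "n > 0" "(\<integral>x. indicator {z. real n * \<rho> \<le> norm z} x * (cmod (?K x))\<^sup>2 \<partial>lborel) < \<kappa> * (\<integral>x. (cmod (?K x))\<^sup>2 \<partial>lborel)"
    by (auto simp: eventually_sequentially)
  define M where "M = real n"
  have M: "M > 0" using n by (simp add: M_def)
  define k where "k x = ?K (M *\<^sub>R x)" for x
  have scale: "(\<integral>x. F x \<partial>lborel) = M ^ DIM('a) * (\<integral>x. F (M *\<^sub>R x) \<partial>lborel)" for F :: "'a \<Rightarrow> real"
    using integral_lborel_affine[of M F 0] M by simp
  show ?thesis
  proof (rule exI[of _ k], rule exI[of _ "2 * M"], rule exI[of _ "(\<integral>x. norm (tent (x::'a)) \<partial>lborel)\<^sup>2"],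
      intro conjI allI impI)
    \<comment> \<open>The bandwidth witness is 2 M, because the transform of \<open>fejer\<close>
      vanishes from radius 2 on and the compression factor is M.\<close>
    show "2 * M > 0" using M by simp
    show "integrable lborel k" unfolding k_def using integrable_lborel_affine[OF K(1), of M 0] M by simp
    show "cmod (k x) \<le> (\<integral>x. norm (tent (x::'a)) \<partial>lborel)\<^sup>2" for x unfolding k_def by (rule fejer_bound)
    have eq: "(\<integral>x. (cmod (?K x))\<^sup>2 \<partial>lborel) = M ^ DIM('a) * (\<integral>x. (cmod (k x))\<^sup>2 \<partial>lborel)"
      unfolding k_def by (rule scale)
    then show "0 < (\<integral>x. (cmod (k x))\<^sup>2 \<partial>lborel)"
      using fejer_L2_pos[where 'a='a] M by (simp add: zero_less_mult_iff)
    show "norm \<zeta> < 2 * M" if "ft k \<zeta> \<noteq> 0" for \<zeta>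
    proof (rule ccontr)
      assume "\<not> norm \<zeta> < 2 * M"
      then have "norm (\<zeta> /\<^sub>R M) \<ge> 2" using M by (simp add: field_simps)
      then have "ft fejer (\<zeta> /\<^sub>R M) = 0" by (rule ft_fejer_eq_0)
      then show False using that M by (simp add: k_def[abs_def] ft_scale)
    qed
    have "(\<integral>x. indicator {z. real n * \<rho> \<le> norm z} x * (cmod (?K x))\<^sup>2 \<partial>lborel) =
       M ^ DIM('a) * (\<integral>x. indicator {z. \<rho> \<le> norm z} x * (cmod (k x))\<^sup>2 \<partial>lborel)"
      by (subst scale) (use M in \<open>auto simp: k_def M_def indicator_def intro!: Bochner_Integration.integral_cong\<close>)
    then have "M ^ DIM('a) * (\<integral>x. indicator {z. \<rho> \<le> norm z} x * (cmod (k x))\<^sup>2 \<partial>lborel) \<le> M ^ DIM('a) * (\<kappa> * (\<integral>x. (cmod (k x))\<^sup>2 \<partial>lborel))"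
      using n(2) eq by (simp add: mult_ac)
    then show "(\<integral>x. indicator {z. \<rho> \<le> norm z} x * (cmod (k x))\<^sup>2 \<partial>lborel) \<le> \<kappa> * (\<integral>x. (cmod (k x))\<^sup>2 \<partial>lborel)"
      using M by simp
  qed
qed

subsection \<open>The short-time Fourier transform\<close>

lemma L12_conv:
  fixes f k :: "'a::euclidean_space \<Rightarrow> complex"
  assumes f: "integrable lborel f" and k: "integrable lborel k" and B: "\<And>x. cmod (k x) \<le> B"
  shows "L12 (conv f k)"
proof (rule L12_integrable_bounded[OF integrable_conv[OF f k]])
  have [measurable]: "f \<in> borel_measurable borel" "k \<in> borel_measurable borel" using f k by auto
  fix x
  have "cmod (conv f k x) \<le> (\<integral>y. cmod (f y * k (x - y)) \<partial>lborel)" unfolding conv_def by (rule integral_norm_bound)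
  also have "\<dots> \<le> (\<integral>y. B * cmod (f y) \<partial>lborel)"
  proof (rule integral_mono')
    fix y
    show "cmod (f y * k (x - y)) \<le> B * cmod (f y)"
      unfolding norm_mult using mult_left_mono[OF B norm_ge_zero, of "f y" "x - y"] by (simp add: mult.commute)
  next
    fix y show "0 \<le> B * cmod (f y)" using order_trans[OF norm_ge_zero B] by simp
  qed (use f in auto)
  finally show "cmod (conv f k x) \<le> (\<integral>y. B * cmod (f y) \<partial>lborel)" .
qed

lemma nn_integral_L12:
  assumes "L12 f"
  shows "(\<integral>\<^sup>+x. ennreal ((cmod (f x))\<^sup>2) \<partial>lborel) = ennreal (\<integral>x. (cmod (f x))\<^sup>2 \<partial>lborel)"
  by (rule nn_integral_eq_integral) (use L12D(2)[OF assms] in auto)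

lemma nn_integral_indicator_L12:
  fixes f :: "'a::euclidean_space \<Rightarrow> complex"
  assumes "L12 f" "A \<in> sets borel"
  shows "(\<integral>\<^sup>+x. indicator A x * ennreal ((cmod (f x))\<^sup>2) \<partial>lborel) = ennreal (\<integral>x. indicator A x * (cmod (f x))\<^sup>2 \<partial>lborel)"
proof -
  have "(\<integral>\<^sup>+x. indicator A x * ennreal ((cmod (f x))\<^sup>2) \<partial>lborel) = (\<integral>\<^sup>+x. ennreal (indicator A x * (cmod (f x))\<^sup>2) \<partial>lborel)"
    by (intro nn_integral_cong) (auto simp: indicator_def)
  also have "\<dots> = ennreal (\<integral>x. indicator A x * (cmod (f x))\<^sup>2 \<partial>lborel)"
    by (rule nn_integral_eq_integral) (use integrable_indicator_mult[OF L12D(2)[OF assms(1)] assms(2)] in auto)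
  finally show ?thesis .
qed

text \<open>For fixed \<open>x\<close>, the map \<open>\<xi> \<mapsto> conv (f e\<^sub>\<xi>) k x\<close> is the Fourier transform of \<open>y \<mapsto> f y * k (x - y)\<close>,
  so Plancherel in \<open>\<xi>\<close> recombines the frequency-localised pieces without almost-orthogonality.\<close>
lemma stft_estimate:
  fixes f k :: "'a::euclidean_space \<Rightarrow> complex"
  assumes f: "L12 f" and k: "integrable lborel k" and B: "\<And>x. cmod (k x) \<le> B"
    and [measurable]: "G \<in> sets borel" "G' \<in> sets borel" and C: "C \<ge> 0" and \<kappa>: "\<kappa> \<ge> 0"
    and sep: "\<And>x y. x \<in> G \<Longrightarrow> y \<notin> G' \<Longrightarrow> \<rho> \<le> norm (x - y)"
    and tail: "(\<integral>x. indicator {z. \<rho> \<le> norm z} x * (cmod (k x))\<^sup>2 \<partial>lborel) \<le> \<kappa> * (\<integral>x. (cmod (k x))\<^sup>2 \<partial>lborel)"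
    and piece: "\<And>\<xi>. let g = conv (\<lambda>y. f y * cis (- (2 * pi * (y \<bullet> \<xi>)))) k in
      (\<integral>x. (cmod (g x))\<^sup>2 \<partial>lborel) \<le> C * (\<integral>x. indicator G x * (cmod (g x))\<^sup>2 \<partial>lborel)"
  shows "(\<integral>x. (cmod (f x))\<^sup>2 \<partial>lborel) * (\<integral>x. (cmod (k x))\<^sup>2 \<partial>lborel) \<le>
     C * ((\<integral>x. indicator G' x * (cmod (f x))\<^sup>2 \<partial>lborel) + \<kappa> * (\<integral>x. (cmod (f x))\<^sup>2 \<partial>lborel)) * (\<integral>x. (cmod (k x))\<^sup>2 \<partial>lborel)"
proof -
  have [measurable]: "f \<in> borel_measurable borel" "k \<in> borel_measurable borel" using L12D(3)[OF f] k by auto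
  have kL: "L12 k" by (rule L12_integrable_bounded[OF k B])
  define g where "g \<xi> x = (\<integral>y. f y * k (x - y) * cis (- (2 * pi * (y \<bullet> \<xi>))) \<partial>lborel)" for \<xi> x :: 'a
  have g_conv: "g \<xi> = conv (\<lambda>y. f y * cis (- (2 * pi * (y \<bullet> \<xi>)))) k" for \<xi>
    unfolding g_def conv_def by (intro ext Bochner_Integration.integral_cong) (auto simp: mult_ac)
  have g_ft: "g \<xi> x = ft (\<lambda>y. f y * k (x - y)) \<xi>" for \<xi> x unfolding g_def ft_def ..
  have gL: "L12 (g \<xi>)" for \<xi>
    unfolding g_conv by (rule L12_conv[OF integrable_mult_cis[OF L12D(1)[OF f]] k B]) auto
  have [measurable]: "(\<lambda>(\<xi>, x). g \<xi> x) \<in> borel_measurable (borel \<Otimes>\<^sub>M borel)"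
    unfolding g_def by measurable
  have fk: "L12 (\<lambda>y. f y * k (x - y))" for x
    by (rule L12_bounded_mult[OF f _ B]) measurable
  let ?n = "\<lambda>z. ennreal ((cmod z)\<^sup>2)"
  define Nk where "Nk = (\<integral>x. (cmod (k x))\<^sup>2 \<partial>lborel)"
  define Nf where "Nf = (\<integral>x. (cmod (f x))\<^sup>2 \<partial>lborel)"
  define Nf' where "Nf' = (\<integral>x. indicator G' x * (cmod (f x))\<^sup>2 \<partial>lborel)"
  have nn: "Nk \<ge> 0" "Nf \<ge> 0" "Nf' \<ge> 0" unfolding Nk_def Nf_def Nf'_def by (auto intro!: integral_nonneg_AE)
  have slice: "(\<integral>\<^sup>+\<xi>. ?n (g \<xi> x) \<partial>lborel) = (\<integral>\<^sup>+y. ?n (f y) * ?n (k (x - y)) \<partial>lborel)" for x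
  proof -
    have "(\<integral>\<^sup>+\<xi>. ?n (g \<xi> x) \<partial>lborel) = ennreal (\<integral>\<xi>. (cmod (g \<xi> x))\<^sup>2 \<partial>lborel)"
      unfolding g_ft using plancherel(1)[OF fk] by (intro nn_integral_eq_integral) auto
    also have "\<dots> = (\<integral>\<^sup>+y. ?n (f y * k (x - y)) \<partial>lborel)"
      unfolding g_ft plancherel(2)[OF fk] nn_integral_L12[OF fk] ..
    also have "\<dots> = (\<integral>\<^sup>+y. ?n (f y) * ?n (k (x - y)) \<partial>lborel)"
      by (intro nn_integral_cong) (simp add: norm_mult power_mult_distrib ennreal_mult')
    finally show ?thesis .
  qed
  have kshift: "(\<integral>\<^sup>+x. ?n (k (x - y)) \<partial>lborel) = ennreal Nk" for y
    using nn_integral_L12[OF L12_shift[OF kL, of y]] integral_lborel_shift(2)[of "\<lambda>x. (cmod (k x))\<^sup>2" y] by (simp add: Nk_def)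
  \<comment> \<open>\<open>swap\<close> and \<open>flip\<close> evaluate one double integral over S
    and all frequencies: once through f and the window, once through the pieces
    \<open>g \<xi>\<close>. Working with nonnegative integrals allows both exchanges from
    measurability alone.\<close>
  have swap: "(\<integral>\<^sup>+x. indicator S x * (\<integral>\<^sup>+\<xi>. ?n (g \<xi> x) \<partial>lborel) \<partial>lborel) = (\<integral>\<^sup>+y. ?n (f y) * (\<integral>\<^sup>+x. indicator S x * ?n (k (x - y)) \<partial>lborel) \<partial>lborel)"
    if [measurable]: "S \<in> sets borel" for S
  proof -
    have "(\<integral>\<^sup>+x. indicator S x * (\<integral>\<^sup>+\<xi>. ?n (g \<xi> x) \<partial>lborel) \<partial>lborel) = (\<integral>\<^sup>+x. \<integral>\<^sup>+y. indicator S x * (?n (f y) * ?n (k (x - y))) \<partial>lborel \<partial>lborel)"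
      unfolding slice by (subst nn_integral_cmult) auto
    also have "\<dots> = (\<integral>\<^sup>+y. \<integral>\<^sup>+x. indicator S x * (?n (f y) * ?n (k (x - y))) \<partial>lborel \<partial>lborel)"
      by (rule lborel_pair.Fubini') measurable
    also have "\<dots> = (\<integral>\<^sup>+y. ?n (f y) * (\<integral>\<^sup>+x. indicator S x * ?n (k (x - y)) \<partial>lborel) \<partial>lborel)"
      by (subst nn_integral_cmult[symmetric]) (auto simp: mult_ac)
    finally show ?thesis .
  qed
  have flip: "(\<integral>\<^sup>+x. indicator S x * (\<integral>\<^sup>+\<xi>. ?n (g \<xi> x) \<partial>lborel) \<partial>lborel) = (\<integral>\<^sup>+\<xi>. ennreal (\<integral>x. indicator S x * (cmod (g \<xi> x))\<^sup>2 \<partial>lborel) \<partial>lborel)"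
    if [measurable]: "S \<in> sets borel" for S
  proof -
    have "(\<integral>\<^sup>+x. indicator S x * (\<integral>\<^sup>+\<xi>. ?n (g \<xi> x) \<partial>lborel) \<partial>lborel) = (\<integral>\<^sup>+x. \<integral>\<^sup>+\<xi>. indicator S x * ?n (g \<xi> x) \<partial>lborel \<partial>lborel)"
      by (subst nn_integral_cmult) auto
    also have "\<dots> = (\<integral>\<^sup>+\<xi>. \<integral>\<^sup>+x. indicator S x * ?n (g \<xi> x) \<partial>lborel \<partial>lborel)"
      by (rule lborel_pair.Fubini') measurable
    finally show ?thesis by (simp add: nn_integral_indicator_L12[OF gL])
  qed
  have "ennreal (Nf * Nk) = (\<integral>\<^sup>+y. ?n (f y) * ennreal Nk \<partial>lborel)"
    using nn by (subst nn_integral_multc) (auto simp: nn_integral_L12[OF f] Nf_def ennreal_mult')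
  also have "\<dots> = (\<integral>\<^sup>+y. ?n (f y) * (\<integral>\<^sup>+x. indicator UNIV x * ?n (k (x - y)) \<partial>lborel) \<partial>lborel)"
    by (simp add: kshift)
  also have "\<dots> = (\<integral>\<^sup>+\<xi>. ennreal (\<integral>x. indicator UNIV x * (cmod (g \<xi> x))\<^sup>2 \<partial>lborel) \<partial>lborel)"
    by (subst swap[symmetric], simp, rule flip, simp)
  also have "\<dots> \<le> (\<integral>\<^sup>+\<xi>. ennreal C * ennreal (\<integral>x. indicator G x * (cmod (g \<xi> x))\<^sup>2 \<partial>lborel) \<partial>lborel)"
    using piece by (intro nn_integral_mono) (auto simp: Let_def g_conv ennreal_mult'[OF C, symmetric] intro!: ennreal_leI)
  also have "\<dots> = ennreal C * (\<integral>\<^sup>+\<xi>. ennreal (\<integral>x. indicator G x * (cmod (g \<xi> x))\<^sup>2 \<partial>lborel) \<partial>lborel)"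
    by (rule nn_integral_cmult) measurable
  also have "\<dots> = ennreal C * (\<integral>\<^sup>+y. ?n (f y) * (\<integral>\<^sup>+x. indicator G x * ?n (k (x - y)) \<partial>lborel) \<partial>lborel)"
    by (subst flip[symmetric], simp, subst swap, simp_all)
  \<comment> \<open>For y in G' the whole window mass is a sufficient bound; for y outside G' every
    x in G is at distance at least \<rho>, so only the tail of the window contributes.\<close>
  also have "\<dots> \<le> ennreal C * (\<integral>\<^sup>+y. ?n (f y) * (indicator G' y * ennreal Nk + ennreal (\<kappa> * Nk)) \<partial>lborel)"
  proof (intro mult_left_mono nn_integral_mono)
    fix y
    show "(\<integral>\<^sup>+x. indicator G x * ?n (k (x - y)) \<partial>lborel) \<le> indicator G' y * ennreal Nk + ennreal (\<kappa> * Nk)"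
    proof (cases "y \<in> G'")
      case True
      have "(\<integral>\<^sup>+x. indicator G x * ?n (k (x - y)) \<partial>lborel) \<le> (\<integral>\<^sup>+x. ?n (k (x - y)) \<partial>lborel)"
        by (intro nn_integral_mono) (auto simp: indicator_def)
      then show ?thesis using True by (simp add: kshift add_increasing2)
    next
      case False
      have "(\<integral>\<^sup>+x. indicator G x * ?n (k (x - y)) \<partial>lborel) \<le> (\<integral>\<^sup>+x. indicator {z. \<rho> \<le> norm (z - y)} x * ?n (k (x - y)) \<partial>lborel)"
        using sep[OF _ False] by (intro nn_integral_mono) (auto simp: indicator_def)
      also have "\<dots> = ennreal (\<integral>x. indicator {z. \<rho> \<le> norm (z - y)} x * (cmod (k (x - y)))\<^sup>2 \<partial>lborel)"
        by (rule nn_integral_indicator_L12[OF L12_shift[OF kL]]) measurable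
      also have "(\<integral>x. indicator {z. \<rho> \<le> norm (z - y)} x * (cmod (k (x - y)))\<^sup>2 \<partial>lborel) = (\<integral>x. indicator {z. \<rho> \<le> norm z} x * (cmod (k x))\<^sup>2 \<partial>lborel)"
        using integral_lborel_shift(2)[of "\<lambda>x. indicator {z. \<rho> \<le> norm z} x * (cmod (k x))\<^sup>2" y] by (simp add: indicator_def)
      also have "ennreal (\<integral>x. indicator {z. \<rho> \<le> norm z} x * (cmod (k x))\<^sup>2 \<partial>lborel) \<le> ennreal (\<kappa> * Nk)"
        using tail unfolding Nk_def by (rule ennreal_leI)
      finally show ?thesis using False by simp
    qed
  qed auto
  also have "\<dots> = ennreal C * (\<integral>\<^sup>+y. indicator G' y * ?n (f y) * ennreal Nk + ?n (f y) * ennreal (\<kappa> * Nk) \<partial>lborel)"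
    by (simp add: distrib_left mult_ac)
  also have "\<dots> = ennreal C * (ennreal Nf' * ennreal Nk + ennreal Nf * ennreal (\<kappa> * Nk))"
    by (simp add: nn_integral_add nn_integral_multc nn_integral_L12[OF f] nn_integral_indicator_L12[OF f] Nf_def Nf'_def)
  also have "\<dots> = ennreal (C * (Nf' + \<kappa> * Nf) * Nk)"
    using nn C \<kappa> by (simp add: ennreal_mult'[symmetric] ennreal_plus[symmetric] algebra_simps del: ennreal_plus)
  finally have "ennreal (Nf * Nk) \<le> ennreal (C * (Nf' + \<kappa> * Nf) * Nk)" .
  then have "Nf * Nk \<le> C * (Nf' + \<kappa> * Nf) * Nk"
    using nn C \<kappa> by (subst (asm) ennreal_le_iff) auto
  then show ?thesis by (simp add: Nf_def Nf'_def Nk_def)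
qed

subsection \<open>Flatness of compact \<open>C\<^sup>1\<close> submanifolds\<close>

text \<open>The coefficients \<open>a\<close> are recorded together with the frame because estimates
  for the gradients have to be carried over to the frame vectors.\<close>

lemma orthonormal_frame_of_independent:
  fixes g :: "nat \<Rightarrow> real^'d"
  assumes ind: "\<And>c :: nat \<Rightarrow> real. (\<Sum>i<k. c i *\<^sub>R g i) = 0 \<Longrightarrow> (\<forall>i<k. c i = 0)"
  obtains v a where "orthonormal_family k v" "\<And>i. i < k \<Longrightarrow> v i = (\<Sum>j<k. a i j *\<^sub>R g j)"
proof -
  have inj: "inj_on g {..<k}"
  proof (rule inj_onI, rule ccontr)
    fix i j assume ij: "i \<in> {..<k}" "j \<in> {..<k}" "g i = g j" "i \<noteq> j"
    \<comment> \<open>A repeated vector would give this nontrivial relation; injectivity allows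
      passing from the indexed family to the set of its values.\<close>
    define c where "c = (\<lambda>m. if m = i then 1 else if m = j then -1 else (0::real))"
    have "(\<Sum>m<k. c m *\<^sub>R g m) = (\<Sum>m<k. (if m = i then g i else 0) + (if m = j then - g j else 0))"
      using ij(4) by (intro sum.cong) (auto simp: c_def)
    also have "\<dots> = 0" using ij by (simp add: sum.distrib sum.delta)
    finally have "c i = 0" using ind ij by blast
    then show False by (simp add: c_def)
  qed
  have indep: "independent (g ` {..<k})"
  proof (subst independent_explicit_finite_subsets, safe)
    fix S u x assume S: "S \<subseteq> g ` {..<k}" "finite S" "(\<Sum>v\<in>S. u v *\<^sub>R v) = 0" "x \<in> S"
    define c where "c i = (if g i \<in> S then u (g i) else 0)" for i
    have "(\<Sum>i<k. c i *\<^sub>R g i) = (\<Sum>v\<in>g ` {..<k}. (if v \<in> S then u v else 0) *\<^sub>R v)"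
      unfolding sum.reindex[OF inj] by (simp add: c_def)
    also have "\<dots> = (\<Sum>v\<in>S. u v *\<^sub>R v)"
      using S by (intro sum.mono_neutral_cong_right) auto
    finally have "\<forall>i<k. c i = 0" using ind S(3) by simp
    moreover obtain i where "i < k" "x = g i" using S by auto
    ultimately have "c i = 0" "c i = u x" using S(4) by (auto simp: c_def)
    then show "u x = 0" by simp
  qed
  obtain Bs where Bs: "Bs \<subseteq> span (g ` {..<k})" "pairwise orthogonal Bs" "\<And>x. x \<in> Bs \<Longrightarrow> norm x = 1"
     "independent Bs" "card Bs = dim (span (g ` {..<k}))" "span Bs = span (g ` {..<k})"
    using orthonormal_basis_subspace[of "span (g ` {..<k})"] by (auto simp: subspace_span)
  have "card Bs = k"
    using Bs(5) indep inj by (simp add: dim_span dim_eq_card_independent card_image)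
  moreover have "finite Bs" using Bs(4) by (rule independent_imp_finite)
  ultimately obtain v where v: "bij_betw v {..<k} Bs"
    using ex_bij_betw_nat_finite[of Bs] by (auto simp: lessThan_atLeast0)
  have vB: "v i \<in> Bs" if "i < k" for i using v that by (auto simp: bij_betw_def)
  have "orthonormal_family k v"
    unfolding orthonormal_family_def
  proof (intro allI impI)
    fix i j assume ij: "i < k" "j < k"
    show "v i \<bullet> v j = (if i = j then 1 else 0)"
    proof (cases "i = j")
      case True
      then show ?thesis using Bs(3)[OF vB[OF ij(1)]] by (simp add: norm_eq_1)
    next
      case False
      then have "v i \<noteq> v j" using v ij by (auto simp: bij_betw_def inj_on_def)
      then show ?thesis using False Bs(2) vB ij by (simp add: pairwise_def orthogonal_def)
    qed
  qed
  moreover have "\<exists>a. v i = (\<Sum>j<k. a j *\<^sub>R g j)" if "i < k" for i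
  proof -
    have "v i \<in> span (g ` {..<k})" using Bs(1) vB[OF that] by blast
    then obtain u where "v i = (\<Sum>w\<in>g ` {..<k}. u w *\<^sub>R w)"
      by (auto simp: span_finite)
    then have "v i = (\<Sum>j<k. u (g j) *\<^sub>R g j)" by (simp add: sum.reindex[OF inj])
    then show ?thesis by (rule exI[of _ "\<lambda>j. u (g j)"])
  qed
  then obtain a where "\<And>i. i < k \<Longrightarrow> v i = (\<Sum>j<k. a i j *\<^sub>R g j)" by metis
  ultimately show thesis by (rule that)
qed

text \<open>The frame of normal directions is frozen at the centre \<open>p\<close>: a function whose gradient is within
  \<open>\<epsilon>\<close> of the one at \<open>p\<close> and which vanishes at both \<open>x\<close> and \<open>y\<close> forces \<open>y - x\<close> to be almost
  orthogonal to that gradient.\<close>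
lemma local_flatness:
  fixes S :: "(real^'d) set"
  assumes S: "compact_C1_submanifold_codim k S" and p: "p \<in> S" and \<eta>: "\<eta> > 0"
  shows "\<exists>r>0. \<exists>v. orthonormal_family k v \<and>
     (\<forall>x\<in>S \<inter> ball p r. \<forall>y\<in>S \<inter> ball p r. \<forall>i<k. \<bar>v i \<bullet> (y - x)\<bar> \<le> \<eta> * norm (y - x))"
proof -
  from bspec[OF conjunct2[OF S[unfolded compact_C1_submanifold_codim_def]] p]
  obtain U F G where U: "open U" "p \<in> U"
    and FG: "\<forall>i<k. continuous_on U (G i) \<and> (\<forall>x\<in>U. (F i has_derivative (\<lambda>h. G i x \<bullet> h)) (at x))"
    and indep: "\<forall>x\<in>U. \<forall>c::nat \<Rightarrow> real. (\<Sum>i<k. c i *\<^sub>R G i x) = 0 \<longrightarrow> (\<forall>i<k. c i = 0)"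
    and SU: "S \<inter> U = {x\<in>U. \<forall>i<k. F i x = (0::real)}"
    by (elim exE conjE) (rule that)
  have G: "continuous_on U (G i)" if "i < k" for i using FG that by blast
  have F: "(F i has_derivative (\<lambda>h. G i x \<bullet> h)) (at x)" if "i < k" "x \<in> U" for i x using FG that by blast
  have ind: "\<forall>i<k. c i = 0" if "(\<Sum>i<k. c i *\<^sub>R G i p) = 0" for c :: "nat \<Rightarrow> real"
    using indep U(2) that by blast
  obtain v a where v: "orthonormal_family k v" "\<And>i. i < k \<Longrightarrow> v i = (\<Sum>j<k. a i j *\<^sub>R G j p)"
    using orthonormal_frame_of_independent[where k = k and g = "\<lambda>i. G i p", OF ind] by blast
  \<comment> \<open>A exceeds every row sum of the coefficients, so tolerance \<eta> / A for the
    gradients becomes \<eta> for the frame; the summand 1 makes it a legitimate divisor.\<close>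
  define A where "A = (\<Sum>i<k. \<Sum>j<k. \<bar>a i j\<bar>) + 1"
  have A: "A > 0" unfolding A_def by (intro add_nonneg_pos sum_nonneg) auto
  have Ai: "(\<Sum>j<k. \<bar>a i j\<bar>) \<le> A" if "i < k" for i
    using member_le_sum[of i "{..<k}" "\<lambda>i. \<Sum>j<k. \<bar>a i j\<bar>"] that unfolding A_def by (simp add: sum_nonneg)
  have "\<exists>r>0. ball p r \<subseteq> U \<and> (\<forall>x\<in>ball p r. norm (G j x - G j p) \<le> \<eta> / A)" if "j < k" for j
  proof -
    have "isCont (G j) p" using G[OF that] U by (simp add: continuous_on_eq_continuous_at)
    then obtain d where d: "d > 0" "\<And>x. dist x p < d \<Longrightarrow> dist (G j x) (G j p) < \<eta> / A"
      using A \<eta> unfolding continuous_at_eps_delta by (metis divide_pos_pos)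
    obtain e where e: "e > 0" "ball p e \<subseteq> U" using U by (meson open_contains_ball)
    show ?thesis
      using d e by (intro exI[of _ "min d e"]) (auto simp: dist_norm norm_minus_commute subset_iff less_imp_le)
  qed
  then obtain r where r: "\<And>j. j < k \<Longrightarrow> r j > 0 \<and> ball p (r j) \<subseteq> U \<and> (\<forall>x\<in>ball p (r j). norm (G j x - G j p) \<le> \<eta> / A)"
    by metis
  obtain e where e: "e > 0" "ball p e \<subseteq> U" using U by (meson open_contains_ball)
  define R where "R = Min (insert e (r ` {..<k}))"
  have R: "R > 0" "R \<le> e" "\<And>j. j < k \<Longrightarrow> R \<le> r j" unfolding R_def using r e by (auto simp: Min_gr_iff)
  have "\<bar>v i \<bullet> (y - x)\<bar> \<le> \<eta> * norm (y - x)" if x: "x \<in> S \<inter> ball p R" and y: "y \<in> S \<inter> ball p R" and i: "i < k" for x y i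
  proof -
    have G_est: "\<bar>G j p \<bullet> (y - x)\<bar> \<le> \<eta> / A * norm (y - x)" if j: "j < k" for j
    proof -
      let ?h = "\<lambda>x. F j x - G j p \<bullet> x"
      \<comment> \<open>Mean value inequality on the convex ball, for \<open>F j\<close> minus its
        linear part frozen at p. Both values of \<open>F j\<close> vanish on the submanifold, so
        only the linear part remains.\<close>
      have "norm (?h y - ?h x) \<le> \<eta> / A * norm (y - x)"
      proof (rule differentiable_bound[OF convex_ball])
        fix z assume z: "z \<in> ball p R"
        then have zU: "z \<in> U" using R e by auto
        show "(?h has_derivative (\<lambda>h. G j z \<bullet> h - G j p \<bullet> h)) (at z within ball p R)"
          by (rule has_derivative_at_withinI) (auto intro!: derivative_eq_intros F[OF j zU])
        have "norm (G j z - G j p) \<le> \<eta> / A" using r[OF j] R(3)[OF j] z by auto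
        moreover have "onorm (\<lambda>h. G j z \<bullet> h - G j p \<bullet> h) \<le> norm (G j z - G j p)"
          by (rule onorm_le) (simp add: inner_diff_left[symmetric] Cauchy_Schwarz_ineq2)
        ultimately show "onorm (\<lambda>h. G j z \<bullet> h - G j p \<bullet> h) \<le> \<eta> / A" by linarith
      qed (use x y in auto)
      moreover have "F j x = 0" "F j y = 0" using x y SU R e j by (auto simp: set_eq_iff subset_iff)
      ultimately show ?thesis by (simp add: inner_diff_right abs_minus_commute)
    qed
    have "\<bar>v i \<bullet> (y - x)\<bar> \<le> (\<Sum>j<k. \<bar>a i j\<bar> * (\<eta> / A * norm (y - x)))"
      unfolding v(2)[OF i] inner_sum_left inner_scaleR_left real_norm_def[symmetric]
      by (rule sum_norm_le, unfold real_norm_def abs_mult, rule mult_left_mono) (use G_est in auto)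
    also have "\<dots> = (\<Sum>j<k. \<bar>a i j\<bar>) * (\<eta> / A * norm (y - x))" by (rule sum_distrib_right[symmetric])
    also have "\<dots> \<le> A * (\<eta> / A * norm (y - x))" using Ai[OF i] A \<eta> by (intro mult_right_mono) auto
    also have "\<dots> = \<eta> * norm (y - x)" using A by simp
    finally show ?thesis .
  qed
  with R(1) v(1) show ?thesis by blast
qed

text \<open>The radius is a Lebesgue number of the cover by the balls of
  \<open>local_flatness\<close>; the frame of a suitable ball then serves for x.\<close>

lemma uniform_flatness:
  fixes S :: "(real^'d) set"
  assumes S: "compact_C1_submanifold_codim k S" and \<eta>: "\<eta> > 0"
  shows "\<exists>r>0. \<forall>x\<in>S. \<exists>v. orthonormal_family k v \<and>
     (\<forall>y\<in>S. dist x y < r \<longrightarrow> (\<forall>i<k. \<bar>v i \<bullet> (y - x)\<bar> \<le> \<eta> * norm (y - x)))"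
proof -
  obtain r where r: "\<And>p. p \<in> S \<Longrightarrow> r p > 0 \<and> (\<exists>v. orthonormal_family k v \<and>
     (\<forall>x\<in>S \<inter> ball p (r p). \<forall>y\<in>S \<inter> ball p (r p). \<forall>i<k. \<bar>v i \<bullet> (y - x)\<bar> \<le> \<eta> * norm (y - x)))"
    using local_flatness[OF S _ \<eta>] by metis
  have "compact S" using S by (simp add: compact_C1_submanifold_codim_def)
  moreover have "S \<subseteq> \<Union>((\<lambda>p. ball p (r p)) ` S)" using r by force
  ultimately obtain e where e: "e > 0" "\<And>x. x \<in> S \<Longrightarrow> \<exists>B\<in>(\<lambda>p. ball p (r p)) ` S. ball x e \<subseteq> B"
    using Heine_Borel_lemma[of S "(\<lambda>p. ball p (r p)) ` S"] by (metis (no_types, lifting) image_iff open_ball)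
  show ?thesis
  proof (intro exI[of _ e] conjI ballI e(1))
    fix x assume x: "x \<in> S"
    obtain p where p: "p \<in> S" "ball x e \<subseteq> ball p (r p)" using e(2)[OF x] by blast
    obtain v where v: "orthonormal_family k v"
      "\<forall>x\<in>S \<inter> ball p (r p). \<forall>y\<in>S \<inter> ball p (r p). \<forall>i<k. \<bar>v i \<bullet> (y - x)\<bar> \<le> \<eta> * norm (y - x)"
      using r[OF p(1)] by blast
    have "x \<in> ball p (r p)" using p(2) e(1) by (metis centre_in_ball subsetD)
    then show "\<exists>v. orthonormal_family k v \<and> (\<forall>y\<in>S. dist x y < e \<longrightarrow> (\<forall>i<k. \<bar>v i \<bullet> (y - x)\<bar> \<le> \<eta> * norm (y - x)))"
      using v x p(2) by (intro exI[of _ v]) (auto simp: subset_iff)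
  qed
qed

subsection \<open>The estimate on \<open>L\<^sup>1 \<inter> L\<^sup>2\<close>\<close>

text \<open>Supplies directions where the geometry prescribes none: for a vanishing frequency piece
  and for bounded R.\<close>

lemma exists_orthonormal_family:
  assumes "k \<le> CARD('d::finite)"
  shows "\<exists>v :: nat \<Rightarrow> real^'d. orthonormal_family k v"
proof -
  have "k \<le> card (Basis :: (real^'d) set)" using assms by simp
  then obtain T :: "(real^'d) set" where T: "T \<subseteq> Basis" "card T = k" "finite T"
    using obtain_subset_with_card_n by blast
  then obtain v where v: "bij_betw v {..<k} T"
    using ex_bij_betw_nat_finite[of T] by (auto simp: lessThan_atLeast0)
  have "v i \<in> Basis" if "i < k" for i using v T that by (auto simp: bij_betw_def)
  moreover have "v i = v j \<longleftrightarrow> i = j" if "i < k" "j < k" for i j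
    using v that by (auto simp: bij_betw_def inj_on_def)
  ultimately have "orthonormal_family k v" by (auto simp: orthonormal_family_def inner_Basis)
  then show ?thesis by blast
qed

lemma orthonormal_family_norm: "orthonormal_family k v \<Longrightarrow> i < k \<Longrightarrow> norm (v i) = 1"
  by (simp add: orthonormal_family_def norm_eq_1)

section \<open>From the control condition to the estimate for \<Sigma>\<close>

text \<open>Cover by empty sets: each term contains 0 ^ k, which is 0 because k \<ge> 1.\<close>

lemma hausdorff_measure_empty:
  assumes "k \<ge> 1"
  shows "hausdorff_measure k ({} :: 'a::metric_space set) = 0"
proof -
  have "(INF C\<in>{C :: nat \<Rightarrow> 'a set. {} \<subseteq> (\<Union>j. C j) \<and> (\<forall>j. bounded (C j) \<and> diameter (C j) \<le> \<delta>)}.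
        (\<Sum>j. ennreal (unit_ball_vol (real k) * (diameter (C j) / 2) ^ k))) = 0" if "\<delta> > 0" for \<delta>
  proof -
    have "(INF C\<in>{C :: nat \<Rightarrow> 'a set. {} \<subseteq> (\<Union>j. C j) \<and> (\<forall>j. bounded (C j) \<and> diameter (C j) \<le> \<delta>)}.
        (\<Sum>j. ennreal (unit_ball_vol (real k) * (diameter (C j) / 2) ^ k)))
        \<le> (\<Sum>j. ennreal (unit_ball_vol (real k) * (diameter ({} :: 'a set) / 2) ^ k))"
      using that by (intro INF_lower2[of "\<lambda>_. {}"]) auto
    also have "\<dots> = 0" using assms by (simp add: zero_power)
    finally show ?thesis by simp
  qed
  then show ?thesis unfolding hausdorff_measure_def by simp
qed

lemma GCC_relatively_dense:
  assumes gcc: "GCC_params k l \<gamma> E" and "l > 0" "\<gamma> > 0" "k \<ge> 1" and v: "orthonormal_family k v"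
  shows "relatively_dense_along k v l E"
  unfolding relatively_dense_along_def
proof
  fix x
  have "hausdorff_measure k (kcube k x v l \<inter> E) \<ge> ennreal (\<gamma> * l ^ k)"
    using gcc v unfolding GCC_params_def by blast
  moreover have "ennreal (\<gamma> * l ^ k) > 0" using assms by simp
  ultimately have "kcube k x v l \<inter> E \<noteq> {}"
    using hausdorff_measure_empty[OF \<open>k \<ge> 1\<close>, where 'a="real^'a"] by force
  then show "\<exists>t. (\<forall>i<k. 0 \<le> t i \<and> t i \<le> l) \<and> x + (\<Sum>i<k. t i *\<^sub>R v i) \<in> E"
    unfolding kcube_def by blast
qed

lemma L12_estimate:
  fixes \<Sigma> E :: "(real^'d) set"
  assumes S: "compact_C1_submanifold_codim k \<Sigma>" and k: "k \<le> CARD('d)"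
    and dense: "\<And>v. orthonormal_family k v \<Longrightarrow> relatively_dense_along k v l E"
    and pos: "l > 0" "\<delta> > 0" "\<beta> > 0"
  shows "\<exists>C>0. \<forall>R>0. \<forall>f. L12 f \<longrightarrow> (\<forall>\<zeta>. ft f \<zeta> \<noteq> 0 \<longrightarrow> \<zeta> \<in> nbhd \<beta> ((\<lambda>x. R *\<^sub>R x) ` \<Sigma>)) \<longrightarrow>
     (\<integral>x. (cmod (f x))\<^sup>2 \<partial>lborel) \<le> C * (\<integral>x. indicator (nbhd \<delta> E) x * (cmod (f x))\<^sup>2 \<partial>lborel)"
proof -
  have pos2: "\<delta> / 2 > 0" "2 * \<beta> > 0" using pos by auto
  from slab_estimate[OF pos2(1) pos(1) pos2(2), of k, where 'a="real^'d"]
  obtain C1 where C1: "C1 > 0" and slab1: "\<And>(v :: nat \<Rightarrow> real^'d) E \<zeta>\<^sub>0 g. (\<And>i. i < k \<Longrightarrow> norm (v i) \<le> 1) \<Longrightarrow>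
     relatively_dense_along k v l E \<Longrightarrow> L12 g \<Longrightarrow>
     (\<And>\<zeta> i. ft g \<zeta> \<noteq> 0 \<Longrightarrow> i < k \<Longrightarrow> \<bar>v i \<bullet> (\<zeta> - \<zeta>\<^sub>0)\<bar> \<le> 2 * \<beta>) \<Longrightarrow>
     (\<integral>x. (cmod (g x))\<^sup>2 \<partial>lborel) \<le> C1 * (\<integral>x. indicator (nbhd (\<delta> / 2) E) x * (cmod (g x))\<^sup>2 \<partial>lborel)"
    by blast
  \<comment> \<open>The leakage then returns as C1 \<kappa> N = N / 2 and is absorbed.\<close>
  define \<kappa> where "\<kappa> = 1 / (2 * C1)"
  have \<kappa>: "\<kappa> > 0" "C1 * \<kappa> = 1 / 2" using C1 by (auto simp: \<kappa>_def)
  from localized_kernel[OF pos2(1) \<kappa>(1), where 'a="real^'d"]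
  obtain \<phi> :: "real^'d \<Rightarrow> complex" and M B where M: "M > 0" and \<phi>: "integrable lborel \<phi>" "\<And>x. cmod (\<phi> x) \<le> B"
     "0 < (\<integral>x. (cmod (\<phi> x))\<^sup>2 \<partial>lborel)" "\<And>\<zeta>. ft \<phi> \<zeta> \<noteq> 0 \<Longrightarrow> norm \<zeta> < M"
     "(\<integral>x. indicator {z. \<delta> / 2 \<le> norm z} x * (cmod (\<phi> x))\<^sup>2 \<partial>lborel) \<le> \<kappa> * (\<integral>x. (cmod (\<phi> x))\<^sup>2 \<partial>lborel)"
    by blast
  \<comment> \<open>Two frequencies of one piece differ by less than 2 M and each lies within
    \<beta> of R \<Sigma>; the nearby points R x and R y are therefore less than D apart.\<close>
  define D where "D = 2 * \<beta> + 2 * M"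
  have D: "D > 0" using pos M by (simp add: D_def)
  \<comment> \<open>A displacement below D on R \<Sigma> deviates by at most \<beta> in the normal
    directions. Adding the \<beta> of the neighbourhood gives half-width 2 \<beta>, which does not
    depend on M.\<close>
  from uniform_flatness[OF S, of "\<beta> / D"] pos D
  obtain r where r: "r > 0" and flat: "\<And>x. x \<in> \<Sigma> \<Longrightarrow> \<exists>v. orthonormal_family k v \<and>
     (\<forall>y\<in>\<Sigma>. dist x y < r \<longrightarrow> (\<forall>i<k. \<bar>v i \<bullet> (y - x)\<bar> \<le> \<beta> / D * norm (y - x)))"
    by auto
  have "bounded \<Sigma>" using S by (simp add: compact_C1_submanifold_codim_def compact_imp_bounded)
  then obtain s where s: "s > 0" "\<And>x. x \<in> \<Sigma> \<Longrightarrow> norm x \<le> s" by (auto simp: bounded_pos)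
  \<comment> \<open>Radius of a ball containing the whole spectrum when R < D / r.\<close>
  define b where "b = D / r * s + \<beta>"
  have b: "b > 0" using D r s pos by (auto simp: b_def intro!: add_pos_pos)
  from slab_estimate[OF pos(2) pos(1) b, of k, where 'a="real^'d"]
  obtain C2 where C2: "C2 > 0" and slab2: "\<And>(v :: nat \<Rightarrow> real^'d) E \<zeta>\<^sub>0 g. (\<And>i. i < k \<Longrightarrow> norm (v i) \<le> 1) \<Longrightarrow>
     relatively_dense_along k v l E \<Longrightarrow> L12 g \<Longrightarrow>
     (\<And>\<zeta> i. ft g \<zeta> \<noteq> 0 \<Longrightarrow> i < k \<Longrightarrow> \<bar>v i \<bullet> (\<zeta> - \<zeta>\<^sub>0)\<bar> \<le> b) \<Longrightarrow>
     (\<integral>x. (cmod (g x))\<^sup>2 \<partial>lborel) \<le> C2 * (\<integral>x. indicator (nbhd \<delta> E) x * (cmod (g x))\<^sup>2 \<partial>lborel)"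
    by blast
  obtain v0 :: "nat \<Rightarrow> real^'d" where v0: "orthonormal_family k v0" using exists_orthonormal_family[OF k] by blast
  show ?thesis
  proof (intro exI[of _ "max (2 * C1) C2"] conjI allI impI)
    show "max (2 * C1) C2 > 0" using C2 by simp
    fix R :: real and f :: "real^'d \<Rightarrow> complex"
    assume R: "R > 0" and f: "L12 f" and supp: "\<forall>\<zeta>. ft f \<zeta> \<noteq> 0 \<longrightarrow> \<zeta> \<in> nbhd \<beta> ((\<lambda>x. R *\<^sub>R x) ` \<Sigma>)"
    define N where "N = (\<integral>x. (cmod (f x))\<^sup>2 \<partial>lborel)"
    define Q where "Q = (\<integral>x. indicator (nbhd \<delta> E) x * (cmod (f x))\<^sup>2 \<partial>lborel)"
    have Q: "Q \<ge> 0" unfolding Q_def by (intro integral_nonneg_AE) auto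
    \<comment> \<open>The threshold D / r is where points of R \<Sigma> at distance less than D come
      from points of \<Sigma> closer than the flatness radius r.\<close>
    have "N \<le> 2 * C1 * Q \<or> N \<le> C2 * Q"
    proof (cases "D / r \<le> R")
      case True
      define P where "P = (\<integral>x. (cmod (\<phi> x))\<^sup>2 \<partial>lborel)"
      have "N * P \<le> C1 * (Q + \<kappa> * N) * P"
        unfolding N_def P_def Q_def
      proof (rule stft_estimate[OF f \<phi>(1,2) _ _ _ _ _ \<phi>(5)])
        fix x y assume x: "x \<in> nbhd (\<delta> / 2) E" and y: "y \<notin> nbhd \<delta> E"
        obtain e where e: "e \<in> E" "dist x e < \<delta> / 2" using x by (auto simp: nbhd_def)
        have "\<not> dist y e < \<delta>" using y e by (auto simp: nbhd_def)
        then show "\<delta> / 2 \<le> norm (x - y)" using e dist_triangle[of y e x] by (simp add: dist_norm norm_minus_commute)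
      next
        fix \<xi>
        define g where "g = conv (\<lambda>y. f y * cis (- (2 * pi * (y \<bullet> \<xi>)))) \<phi>"
        have fm: "integrable lborel (\<lambda>y. f y * cis (- (2 * pi * (y \<bullet> \<xi>))))"
          by (rule integrable_mult_cis[OF L12D(1)[OF f]]) measurable
        have g: "L12 g" unfolding g_def by (rule L12_conv[OF fm \<phi>(1,2)])
        have ftg: "ft g \<zeta> = ft f (\<zeta> + \<xi>) * ft \<phi> \<zeta>" for \<zeta>
          unfolding g_def ft_conv[OF fm \<phi>(1)] ft_modulate ..
        have near: "norm \<zeta> < M \<and> (\<exists>y\<in>\<Sigma>. norm (\<zeta> + \<xi> - R *\<^sub>R y) < \<beta>)" if "ft g \<zeta> \<noteq> 0" for \<zeta>
          using that \<phi>(4)[of \<zeta>] supp[rule_format, of "\<zeta> + \<xi>"] by (auto simp: ftg nbhd_def dist_norm)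
        have "\<exists>v \<zeta>\<^sub>0. orthonormal_family k v \<and> (\<forall>\<zeta> i. ft g \<zeta> \<noteq> 0 \<longrightarrow> i < k \<longrightarrow> \<bar>v i \<bullet> (\<zeta> - \<zeta>\<^sub>0)\<bar> \<le> 2 * \<beta>)"
        proof (cases "\<exists>\<zeta>. ft g \<zeta> \<noteq> 0")
          case False
          then show ?thesis using v0 by blast
        next
          case True
          then obtain \<zeta>1 where "ft g \<zeta>1 \<noteq> 0" by blast
          from near[OF this] obtain x where x: "norm \<zeta>1 < M" "x \<in> \<Sigma>" "norm (\<zeta>1 + \<xi> - R *\<^sub>R x) < \<beta>" by blast
          from flat[OF x(2)] obtain v where v: "orthonormal_family k v"
            and fl: "\<And>y i. y \<in> \<Sigma> \<Longrightarrow> dist x y < r \<Longrightarrow> i < k \<Longrightarrow> \<bar>v i \<bullet> (y - x)\<bar> \<le> \<beta> / D * norm (y - x)" by blast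
          have "\<bar>v i \<bullet> (\<zeta> - (R *\<^sub>R x - \<xi>))\<bar> \<le> 2 * \<beta>" if \<zeta>: "ft g \<zeta> \<noteq> 0" and i: "i < k" for \<zeta> i
          proof -
            from near[OF \<zeta>] obtain y where y: "norm \<zeta> < M" "y \<in> \<Sigma>" "norm (\<zeta> + \<xi> - R *\<^sub>R y) < \<beta>" by blast
            have eq: "R *\<^sub>R (y - x) = (\<zeta>1 + \<xi> - R *\<^sub>R x) - (\<zeta> + \<xi> - R *\<^sub>R y) + (\<zeta> - \<zeta>1)" by (simp add: algebra_simps)
            have "norm (R *\<^sub>R (y - x)) \<le> norm (\<zeta>1 + \<xi> - R *\<^sub>R x) + norm (\<zeta> + \<xi> - R *\<^sub>R y) + (norm \<zeta> + norm \<zeta>1)"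
              unfolding eq
              using norm_triangle_ineq[of "(\<zeta>1 + \<xi> - R *\<^sub>R x) - (\<zeta> + \<xi> - R *\<^sub>R y)" "\<zeta> - \<zeta>1"]
                norm_triangle_ineq4[of "\<zeta>1 + \<xi> - R *\<^sub>R x" "\<zeta> + \<xi> - R *\<^sub>R y"] norm_triangle_ineq4[of \<zeta> \<zeta>1]
              by linarith
            then have yx: "R * norm (y - x) < D" using x y R by (simp add: D_def)
            then have "norm (y - x) < D / R" using R by (simp add: field_simps)
            also have "D / R \<le> r" using True \<open>D / r \<le> R\<close> R r by (simp add: field_simps)
            finally have "dist x y < r" by (simp add: dist_norm norm_minus_commute)
            then have "\<bar>v i \<bullet> (y - x)\<bar> \<le> \<beta> / D * norm (y - x)" using fl y(2) i by blast
            then have "R * \<bar>v i \<bullet> (y - x)\<bar> \<le> R * (\<beta> / D * norm (y - x))" using R by (intro mult_left_mono) auto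
            also have "\<dots> = \<beta> / D * (R * norm (y - x))" by simp
            also have "\<dots> \<le> \<beta> / D * D" using yx pos D by (intro mult_left_mono) auto
            finally have 1: "\<bar>v i \<bullet> (R *\<^sub>R (y - x))\<bar> \<le> \<beta>" using R D by (simp add: abs_mult)
            have "\<bar>v i \<bullet> (\<zeta> + \<xi> - R *\<^sub>R y)\<bar> \<le> norm (v i) * norm (\<zeta> + \<xi> - R *\<^sub>R y)" by (rule Cauchy_Schwarz_ineq2)
            then have 2: "\<bar>v i \<bullet> (\<zeta> + \<xi> - R *\<^sub>R y)\<bar> \<le> \<beta>" using orthonormal_family_norm[OF v i] y(3) by simp
            \<comment> \<open>The slab is centred at R x - \<xi>, since localising at \<xi> shifts
              the spectrum of f by -\<xi>.\<close>
            have "v i \<bullet> (\<zeta> - (R *\<^sub>R x - \<xi>)) = v i \<bullet> (\<zeta> + \<xi> - R *\<^sub>R y) + v i \<bullet> (R *\<^sub>R (y - x))"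
              by (simp add: inner_diff_right inner_add_right algebra_simps)
            then show ?thesis using 1 2 by linarith
          qed
          then show ?thesis using v by blast
        qed
        then obtain v \<zeta>\<^sub>0 where v: "orthonormal_family k v"
          and sl: "\<And>\<zeta> i. ft g \<zeta> \<noteq> 0 \<Longrightarrow> i < k \<Longrightarrow> \<bar>v i \<bullet> (\<zeta> - \<zeta>\<^sub>0)\<bar> \<le> 2 * \<beta>" by blast
        have "(\<integral>x. (cmod (g x))\<^sup>2 \<partial>lborel) \<le> C1 * (\<integral>x. indicator (nbhd (\<delta> / 2) E) x * (cmod (g x))\<^sup>2 \<partial>lborel)"
          by (rule slab1[OF _ dense[OF v] g sl]) (simp add: orthonormal_family_norm[OF v])
        then show "let g = conv (\<lambda>y. f y * cis (- (2 * pi * (y \<bullet> \<xi>)))) \<phi> in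
          (\<integral>x. (cmod (g x))\<^sup>2 \<partial>lborel) \<le> C1 * (\<integral>x. indicator (nbhd (\<delta> / 2) E) x * (cmod (g x))\<^sup>2 \<partial>lborel)"
          by (simp add: g_def)
      qed (use C1 \<kappa> in auto)
      then have "N \<le> C1 * (Q + \<kappa> * N)" using \<phi>(3) by (simp add: P_def)
      also have "\<dots> = C1 * Q + (C1 * \<kappa>) * N" by (simp add: algebra_simps)
      finally show ?thesis unfolding \<kappa>(2) by simp
    next
      case False
      have "N \<le> C2 * Q" unfolding N_def Q_def
      proof (rule slab2[OF _ dense[OF v0] f])
        fix \<zeta> i assume \<zeta>: "ft f \<zeta> \<noteq> 0" and i: "i < k"
        then obtain x where x: "x \<in> \<Sigma>" "norm (\<zeta> - R *\<^sub>R x) < \<beta>" using supp by (auto simp: nbhd_def dist_norm)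
        have "norm \<zeta> \<le> norm (R *\<^sub>R x) + norm (\<zeta> - R *\<^sub>R x)"
          using norm_triangle_ineq[of "R *\<^sub>R x" "\<zeta> - R *\<^sub>R x"] by simp
        also have "norm (R *\<^sub>R x) \<le> D / r * s"
          unfolding norm_scaleR by (intro mult_mono) (use s(2)[OF x(1)] R False D r in auto)
        finally have "norm \<zeta> \<le> b" using x(2) by (simp add: b_def)
        then show "\<bar>v0 i \<bullet> (\<zeta> - 0)\<bar> \<le> b"
          using Cauchy_Schwarz_ineq2[of "v0 i" \<zeta>] orthonormal_family_norm[OF v0 i] by simp
      qed (simp add: orthonormal_family_norm[OF v0])
      then show ?thesis ..
    qed
    moreover have "2 * C1 * Q \<le> max (2 * C1) C2 * Q" "C2 * Q \<le> max (2 * C1) C2 * Q" using Q by (auto intro: mult_right_mono)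
    ultimately show "N \<le> max (2 * C1) C2 * Q" by linarith
  qed
qed

subsection \<open>From the distributional spectrum to \<open>L\<^sup>1 \<inter> L\<^sup>2\<close>\<close>

lemma lebesgue_borel_version:
  fixes f :: "'a::euclidean_space \<Rightarrow> complex"
  assumes f: "f \<in> borel_measurable lebesgue"
  obtains g where "g \<in> borel_measurable borel" "AE x in lborel. f x = g x"
proof -
  have "(\<lambda>x. Re (f x)) \<in> borel_measurable lebesgue" "(\<lambda>x. Im (f x)) \<in> borel_measurable lebesgue"
    using f by auto
  then obtain u v where u: "u \<in> borel_measurable lborel" "AE x in lborel. Re (f x) = u x"
    and v: "v \<in> borel_measurable lborel" "AE x in lborel. Im (f x) = v x"
    using completion_ex_borel_measurable_real by metis
  have "AE x in lborel. f x = Complex (u x) (v x)"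
    using u(2) v(2) by eventually_elim (simp add: complex_eq_iff)
  moreover have "(\<lambda>x. Complex (u x) (v x)) \<in> borel_measurable borel"
    using u(1) v(1) unfolding Complex_eq by simp
  ultimately show thesis using that[of "\<lambda>x. Complex (u x) (v x)"] by blast
qed

lemma fourier_eq_ft:
  fixes \<psi> :: "real^'d \<Rightarrow> complex"
  assumes "\<psi> \<in> borel_measurable borel"
  shows "fourier \<psi> = ft \<psi>"
proof
  fix x
  note [measurable] = assms
  have "fourier \<psi> x = (\<integral>\<xi>. \<psi> \<xi> * cis (- (2 * pi * (\<xi> \<bullet> x))) \<partial>lebesgue)"
    unfolding fourier_def by (simp add: cis_conv_exp inner_commute mult_ac)
  also have "\<dots> = ft \<psi> x"
    unfolding ft_def by (rule integral_completion) measurable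
  finally show "fourier \<psi> x = ft \<psi> x" .
qed

text \<open>\<open>spec\<close> is defined locally; a finite partition of unity on K, made of
  cone-shaped bumps, passes to arbitrary continuous test functions supported in K. Each summand is
  supported in one closed ball inside a good open set.\<close>

lemma pairing_vanishes:
  fixes f :: "'a::euclidean_space \<Rightarrow> complex"
  assumes [measurable]: "f \<in> borel_measurable borel" and f2: "integrable lborel (\<lambda>x. (cmod (f x))\<^sup>2)"
    and K: "compact K" and \<psi>: "continuous_on UNIV \<psi>" "\<And>x. x \<notin> K \<Longrightarrow> \<psi> x = 0"
    and local: "\<And>\<xi>. \<xi> \<in> K \<Longrightarrow> \<exists>V. open V \<and> \<xi> \<in> V \<and>
       (\<forall>\<phi> L. continuous_on UNIV \<phi> \<longrightarrow> compact L \<longrightarrow> L \<subseteq> V \<longrightarrow> (\<forall>x. x \<notin> L \<longrightarrow> \<phi> x = 0) \<longrightarrow> (\<integral>x. f x * ft \<phi> x \<partial>lborel) = 0)"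
  shows "(\<integral>x. f x * ft \<psi> x \<partial>lborel) = 0"
proof -
  define vanishing where "vanishing A \<longleftrightarrow> (\<forall>\<phi> L. continuous_on UNIV \<phi> \<longrightarrow> compact L \<longrightarrow> L \<subseteq> A \<longrightarrow>
    (\<forall>x. x \<notin> L \<longrightarrow> \<phi> x = 0) \<longrightarrow> (\<integral>x. f x * ft \<phi> x \<partial>lborel) = 0)" for A
  have "\<exists>r. r > 0 \<and> vanishing (cball \<xi> r)" if \<xi>: "\<xi> \<in> K" for \<xi>
  proof -
    obtain V where V: "open V" "\<xi> \<in> V"
       "\<forall>\<phi> L. continuous_on UNIV \<phi> \<longrightarrow> compact L \<longrightarrow> L \<subseteq> V \<longrightarrow> (\<forall>x. x \<notin> L \<longrightarrow> \<phi> x = 0) \<longrightarrow> (\<integral>x. f x * ft \<phi> x \<partial>lborel) = 0"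
      using local[OF \<xi>] by blast
    obtain r where r: "r > 0" "cball \<xi> r \<subseteq> V" using V(1,2) by (meson open_contains_cball)
    have "vanishing (cball \<xi> r)"
      unfolding vanishing_def
    proof (intro allI impI)
      fix \<phi> :: "'a \<Rightarrow> complex" and L
      assume "continuous_on UNIV \<phi>" "compact L" "L \<subseteq> cball \<xi> r" "\<forall>x. x \<notin> L \<longrightarrow> \<phi> x = 0"
      moreover have "L \<subseteq> V" using \<open>L \<subseteq> cball \<xi> r\<close> r(2) by (rule order_trans)
      ultimately show "(\<integral>x. f x * ft \<phi> x \<partial>lborel) = 0" using V(3) by blast
    qed
    then show ?thesis using r(1) by blast
  qed
  then obtain r where r: "\<And>\<xi>. \<xi> \<in> K \<Longrightarrow> r \<xi> > 0" and van: "\<And>\<xi>. \<xi> \<in> K \<Longrightarrow> vanishing (cball \<xi> (r \<xi>))"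
    by metis
  have "K \<subseteq> (\<Union>\<xi>\<in>K. ball \<xi> (r \<xi>))" using r by force
  then obtain F where F: "F \<subseteq> K" "finite F" "K \<subseteq> (\<Union>\<xi>\<in>F. ball \<xi> (r \<xi>))"
    using compactE_image[OF K, of K "\<lambda>\<xi>. ball \<xi> (r \<xi>)"] by auto
  define h where "h \<xi> x = max 0 (r \<xi> - dist \<xi> x)" for \<xi> x
  define s where "s x = (\<Sum>\<xi>\<in>F. h \<xi> x)" for x
  have h_cont: "continuous_on A (h \<xi>)" for A \<xi> unfolding h_def by (intro continuous_intros)
  have s_cont: "continuous_on A s" for A unfolding s_def by (intro continuous_intros h_cont)
  have s_pos: "s x > 0" if "x \<in> K" for x
  proof -
    obtain \<xi> where "\<xi> \<in> F" "dist \<xi> x < r \<xi>" using F(3) \<open>x \<in> K\<close> by auto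
    then show ?thesis unfolding s_def using F(2) by (intro sum_pos2[of F \<xi>]) (auto simp: h_def)
  qed
  obtain m where m: "m > 0" "\<And>x. x \<in> K \<Longrightarrow> s x \<ge> m"
  proof (cases "K = {}")
    case True
    then show ?thesis using that[of 1] by auto
  next
    case False
    from continuous_attains_inf[OF K False s_cont] obtain x0 where "x0 \<in> K" "\<And>x. x \<in> K \<Longrightarrow> s x0 \<le> s x" by blast
    then show ?thesis using that s_pos by blast
  qed
  \<comment> \<open>The maximum with the lower bound m of s on K keeps the quotient continuous on
    the whole space and leaves it unchanged on K, where \<psi> lives.\<close>
  define \<phi> where "\<phi> \<xi> x = \<psi> x * complex_of_real (h \<xi> x / max m (s x))" for \<xi> x
  have \<phi>_cont: "continuous_on UNIV (\<phi> \<xi>)" for \<xi>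
    unfolding \<phi>_def using m by (intro continuous_intros \<psi> h_cont s_cont) (auto simp: max_def)
  have \<phi>_supp: "\<phi> \<xi> x = 0" if "x \<notin> K \<inter> cball \<xi> (r \<xi>)" for \<xi> x
    using that \<psi>(2) by (auto simp: \<phi>_def h_def max_def)
  have \<phi>L: "L12 (\<phi> \<xi>)" for \<xi>
    by (rule L12_compact_support[OF \<phi>_cont _ \<phi>_supp]) (auto intro: compact_Int_closed K)
  have [measurable]: "\<phi> \<xi> \<in> borel_measurable borel" for \<xi> using L12D(3)[OF \<phi>L] .
  have sum: "\<psi> x = (\<Sum>\<xi>\<in>F. \<phi> \<xi> x)" for x
  proof (cases "x \<in> K")
    case True
    then have "max m (s x) = s x" "s x > 0" using m s_pos by (auto simp: max_def)
    then have "(\<Sum>\<xi>\<in>F. h \<xi> x / max m (s x)) = 1" by (simp add: sum_divide_distrib[symmetric] s_def)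
    then have "(\<Sum>\<xi>\<in>F. complex_of_real (h \<xi> x / max m (s x))) = 1" by (metis of_real_1 of_real_sum)
    then show ?thesis unfolding \<phi>_def sum_distrib_left[symmetric] by simp
  qed (simp add: \<phi>_def \<psi>(2))
  have "ft \<psi> x = (\<Sum>\<xi>\<in>F. ft (\<phi> \<xi>) x)" for x
    unfolding sum[abs_def] using L12D(1)[OF \<phi>L] by (rule ft_sum)
  then have "(\<integral>x. f x * ft \<psi> x \<partial>lborel) = (\<integral>x. (\<Sum>\<xi>\<in>F. f x * ft (\<phi> \<xi>) x) \<partial>lborel)" by (simp add: sum_distrib_left)
  also have "\<dots> = (\<Sum>\<xi>\<in>F. \<integral>x. f x * ft (\<phi> \<xi>) x \<partial>lborel)"
    by (intro Bochner_Integration.integral_sum integrable_mult_L2 f2 plancherel(1)[OF \<phi>L]) auto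
  also have "\<dots> = 0"
  proof (rule sum.neutral, rule ballI)
    fix \<xi> assume "\<xi> \<in> F"
    then have "vanishing (cball \<xi> (r \<xi>))" using F(1) van by blast
    moreover have "compact (K \<inter> cball \<xi> (r \<xi>))" using K by (auto intro: compact_Int_closed)
    ultimately show "(\<integral>x. f x * ft (\<phi> \<xi>) x \<partial>lborel) = 0"
      using \<phi>_cont \<phi>_supp unfolding vanishing_def by (metis inf_le2)
  qed
  finally show ?thesis .
qed

text \<open>Damping f by a dilated \<open>ft tent\<close> averages its spectrum over radius e. The
  average at \<zeta> is a pairing of f with the transform of a bump around \<zeta>, which is what
  \<open>spec\<close> controls.\<close>

lemma mollified_spectrum:
  fixes f :: "'a::euclidean_space \<Rightarrow> complex"
  assumes "e > 0"
  shows "(\<integral>x. f x * ft (\<lambda>\<eta>. tent ((\<eta> - \<zeta>) /\<^sub>R e)) x \<partial>lborel) = complex_of_real (e ^ DIM('a)) * ft (\<lambda>x. f x * ft tent (e *\<^sub>R x)) \<zeta>"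
proof -
  have "ft (\<lambda>\<eta>. tent ((\<eta> - \<zeta>) /\<^sub>R e)) x = cis (- (2 * pi * (x \<bullet> \<zeta>))) * (complex_of_real (e ^ DIM('a)) * ft tent (e *\<^sub>R x))" for x :: 'a
  proof -
    have "ft (\<lambda>\<eta>. tent ((\<eta> - \<zeta>) /\<^sub>R e)) x = cis (- (2 * pi * (\<zeta> \<bullet> x))) * ft (\<lambda>\<eta>. tent (inverse e *\<^sub>R \<eta>)) x"
      using ft_shift[of "\<lambda>\<eta>. tent (inverse e *\<^sub>R \<eta>)" \<zeta> x] by simp
    also have "ft (\<lambda>\<eta>. tent (inverse e *\<^sub>R \<eta>)) x = complex_of_real (e ^ DIM('a)) * ft tent (e *\<^sub>R x)"
      using assms by (subst ft_scale) (auto simp: power_inverse divide_simps)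
    finally show ?thesis by (simp add: inner_commute)
  qed
  then have "(\<integral>x. f x * ft (\<lambda>\<eta>. tent ((\<eta> - \<zeta>) /\<^sub>R e)) x \<partial>lborel) =
    (\<integral>x. complex_of_real (e ^ DIM('a)) * (f x * ft tent (e *\<^sub>R x) * cis (- (2 * pi * (x \<bullet> \<zeta>)))) \<partial>lborel)"
    by (intro Bochner_Integration.integral_cong) (auto simp: mult_ac)
  then show ?thesis by (simp add: ft_def[of "\<lambda>x. f x * ft tent (e *\<^sub>R x)"])
qed

lemma ft_tent_le:
  fixes x :: "'a::euclidean_space"
  shows "cmod (ft tent x) \<le> cmod (ft (tent :: 'a \<Rightarrow> complex) 0)"
proof -
  have "ft (tent :: 'a \<Rightarrow> complex) 0 = complex_of_real (\<integral>x. cmod (tent (x::'a)) \<partial>lborel)"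
    unfolding ft_def by (subst integral_complex_of_real[symmetric]) (simp add: norm_tent, simp add: tent_def)
  then show ?thesis using norm_ft_le[of tent x] by simp
qed

text \<open>The multipliers \<open>w n\<close> are square integrable, bounded by 1 and tend to 1, so
  the damped functions \<open>g n\<close> lie in L^1 \<inter> L^2, never exceed f in modulus, and
  converge to f in norm.\<close>

lemma L2_estimate_of_L12_estimate:
  fixes f :: "'a::euclidean_space \<Rightarrow> complex"
  assumes [measurable]: "f \<in> borel_measurable borel" and f2: "integrable lborel (\<lambda>x. (cmod (f x))\<^sup>2)"
    and G[measurable]: "G \<in> sets borel" and C: "C \<ge> 0" and \<beta>: "\<beta> > 0"
    and est: "\<And>g. L12 g \<Longrightarrow> (\<And>\<zeta>. ft g \<zeta> \<noteq> 0 \<Longrightarrow> \<zeta> \<in> nbhd (2 * \<beta>) S) \<Longrightarrow>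
      (\<integral>x. (cmod (g x))\<^sup>2 \<partial>lborel) \<le> C * (\<integral>x. indicator G x * (cmod (g x))\<^sup>2 \<partial>lborel)"
    and spec: "\<And>\<psi> K. continuous_on UNIV \<psi> \<Longrightarrow> compact K \<Longrightarrow> (\<And>x. x \<notin> K \<Longrightarrow> \<psi> x = 0) \<Longrightarrow> K \<inter> nbhd \<beta> S = {} \<Longrightarrow>
      (\<integral>x. f x * ft \<psi> x \<partial>lborel) = 0"
  shows "(\<integral>x. (cmod (f x))\<^sup>2 \<partial>lborel) \<le> C * (\<integral>x. indicator G x * (cmod (f x))\<^sup>2 \<partial>lborel)"
proof -
  define c where "c = ft (tent :: 'a \<Rightarrow> complex) 0"
  have c: "c \<noteq> 0" unfolding c_def by (rule ft_tent_0)
  \<comment> \<open>Damping widens the spectrum by at most \<open>e n\<close> \<le> \<beta>, hence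
    the hypothesis with 2 \<beta>.\<close>
  define e where "e n = \<beta> * inverse (real (Suc n))" for n
  have e: "e n > 0" "e n \<le> \<beta>" for n using \<beta> by (auto simp: e_def field_simps)
  have e0: "e \<longlonglongrightarrow> 0" unfolding e_def using tendsto_mult[OF tendsto_const LIMSEQ_inverse_real_of_nat, of \<beta>] by simp
  define w where "w n x = ft (tent :: 'a \<Rightarrow> complex) (e n *\<^sub>R x) / c" for n x
  have w_le: "cmod (w n x) \<le> 1" for n x
    using ft_tent_le[of "e n *\<^sub>R x"] c by (simp add: w_def c_def norm_divide)
  have [measurable]: "w n \<in> borel_measurable borel" for n unfolding w_def by measurable
  have w2: "integrable lborel (\<lambda>x. (cmod (w n x))\<^sup>2)" for n
    using integrable_lborel_affine[OF plancherel(1)[OF L12_tent[where 'a='a]], of "e n" 0] e(1)[of n]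
    by (simp add: w_def norm_divide power_divide)
  define g where "g n x = f x * w n x" for n x
  have g_le: "(cmod (g n x))\<^sup>2 \<le> (cmod (f x))\<^sup>2" for n x
    unfolding g_def norm_mult using w_le[of n x] by (intro power_mono mult_left_le) auto
  have [measurable]: "g n \<in> borel_measurable borel" for n unfolding g_def by measurable
  have gL: "L12 (g n)" for n
    unfolding L12_def
  proof
    show "integrable lborel (g n)" unfolding g_def by (intro integrable_mult_L2 f2 w2) auto
    show "integrable lborel (\<lambda>x. (cmod (g n x))\<^sup>2)"
      by (rule Bochner_Integration.integrable_bound[OF f2]) (use g_le in auto)
  qed
  have g_spec: "\<zeta> \<in> nbhd (2 * \<beta>) S" if "ft (g n) \<zeta> \<noteq> 0" for n \<zeta>
  proof (rule ccontr)
    assume \<zeta>: "\<zeta> \<notin> nbhd (2 * \<beta>) S"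
    let ?\<psi> = "\<lambda>\<eta>. tent ((\<eta> - \<zeta>) /\<^sub>R e n)"
    have "(\<integral>x. f x * ft ?\<psi> x \<partial>lborel) = 0"
    proof (rule spec)
      show "continuous_on UNIV ?\<psi>"
        unfolding tent_def by (intro continuous_intros)
      show "compact (cball \<zeta> (e n))" by simp
      show "?\<psi> \<eta> = 0" if "\<eta> \<notin> cball \<zeta> (e n)" for \<eta>
      proof (rule tent_zero)
        have "1 \<le> inverse (e n) * norm (\<eta> - \<zeta>)"
          using that e(1)[of n] by (simp add: dist_norm norm_minus_commute field_simps)
        then show "1 \<le> norm ((\<eta> - \<zeta>) /\<^sub>R e n)" using e(1)[of n] by simp
      qed
      show "cball \<zeta> (e n) \<inter> nbhd \<beta> S = {}"
      proof (rule ccontr)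
        assume "cball \<zeta> (e n) \<inter> nbhd \<beta> S \<noteq> {}"
        then obtain \<eta> a where "dist \<zeta> \<eta> \<le> e n" "a \<in> S" "dist \<eta> a < \<beta>" by (auto simp: nbhd_def)
        then have "dist \<zeta> a < 2 * \<beta>" using dist_triangle[of \<zeta> a \<eta>] e(2)[of n] by linarith
        then show False using \<zeta> \<open>a \<in> S\<close> by (auto simp: nbhd_def)
      qed
    qed
    then have "ft (\<lambda>x. f x * ft tent (e n *\<^sub>R x)) \<zeta> = 0"
      using mollified_spectrum[OF e(1)[of n], of f \<zeta>] e(1)[of n] by simp
    moreover have "ft (g n) \<zeta> = (1 / c) * ft (\<lambda>x. f x * ft tent (e n *\<^sub>R x)) \<zeta>"
      using ft_cmult[of "1 / c" "\<lambda>x. f x * ft tent (e n *\<^sub>R x)" \<zeta>] by (simp add: g_def[abs_def] w_def)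
    ultimately show False using that by simp
  qed
  have lim: "(\<lambda>n. \<integral>x. (cmod (g n x))\<^sup>2 \<partial>lborel) \<longlonglongrightarrow> (\<integral>x. (cmod (f x))\<^sup>2 \<partial>lborel)"
  proof (rule integral_dominated_convergence[OF _ _ f2])
    show "AE x in lborel. (\<lambda>n. (cmod (g n x))\<^sup>2) \<longlonglongrightarrow> (cmod (f x))\<^sup>2"
    proof (rule AE_I2)
      fix x :: 'a
      have "(\<lambda>n. e n *\<^sub>R x) \<longlonglongrightarrow> 0" using tendsto_scaleR[OF e0 tendsto_const[of x]] by simp
      then have "(\<lambda>n. ft (tent :: 'a \<Rightarrow> complex) (e n *\<^sub>R x)) \<longlonglongrightarrow> c"
        unfolding c_def by (rule ft_continuous[OF L12D(1)[OF L12_tent]])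
      then have "(\<lambda>n. (cmod (f x * (ft (tent :: 'a \<Rightarrow> complex) (e n *\<^sub>R x) / c)))\<^sup>2) \<longlonglongrightarrow> (cmod (f x * (c / c)))\<^sup>2"
        using c by (intro tendsto_intros)
      then show "(\<lambda>n. (cmod (g n x))\<^sup>2) \<longlonglongrightarrow> (cmod (f x))\<^sup>2" using c by (simp add: g_def w_def)
    qed
    show "AE x in lborel. norm ((cmod (g n x))\<^sup>2) \<le> (cmod (f x))\<^sup>2" for n using g_le by simp
  qed auto
  have "(\<integral>x. (cmod (g n x))\<^sup>2 \<partial>lborel) \<le> C * (\<integral>x. indicator G x * (cmod (f x))\<^sup>2 \<partial>lborel)" for n
  proof -
    have "(\<integral>x. (cmod (g n x))\<^sup>2 \<partial>lborel) \<le> C * (\<integral>x. indicator G x * (cmod (g n x))\<^sup>2 \<partial>lborel)"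
      using gL g_spec by (rule est)
    also have "\<dots> \<le> C * (\<integral>x. indicator G x * (cmod (f x))\<^sup>2 \<partial>lborel)"
      using C g_le by (intro mult_left_mono integral_mono integrable_indicator_mult f2 L12D(2)[OF gL]) auto
    finally show ?thesis .
  qed
  then show ?thesis by (intro LIMSEQ_le_const2[OF lim]) blast
qed

lemma L2_norm_on_borel_version:
  fixes f g :: "real^'d \<Rightarrow> complex"
  assumes f: "f \<in> borel_measurable lebesgue" and g: "g \<in> borel_measurable borel"
    and ae: "AE x in lborel. f x = g x" and A: "A \<in> sets borel"
  shows "L2_norm_on A f = sqrt (\<integral>x. indicator A x * (cmod (g x))\<^sup>2 \<partial>lborel)"
proof -
  have m: "(\<lambda>x. indicator A x * (cmod (g x))\<^sup>2) \<in> borel_measurable lborel"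
    using g A by measurable
  have [measurable]: "g \<in> borel_measurable lebesgue" "A \<in> sets lebesgue" using g A by (auto intro: measurable_completion)
  note [measurable] = f
  have "(\<integral>x\<in>A. (cmod (f x))\<^sup>2 \<partial>lebesgue) = (\<integral>x. indicator A x * (cmod (g x))\<^sup>2 \<partial>lebesgue)"
    unfolding set_lebesgue_integral_def using AE_completion[OF ae]
    by (intro integral_cong_AE) auto
  also have "\<dots> = (\<integral>x. indicator A x * (cmod (g x))\<^sup>2 \<partial>lborel)"
    by (rule integral_completion[OF m])
  finally show ?thesis by (simp add: L2_norm_on_def)
qed

theorem theorem1p2:
  fixes k :: nat and \<Sigma> E :: "(real^'d) set"
  assumes "1 \<le> k" and "k < CARD('d)"
    and "compact_C1_submanifold_codim k \<Sigma>"
    and "E \<in> sets lebesgue"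
    and "GCC k E"
  shows "\<forall>\<delta>>0. \<forall>\<beta>>0. \<exists>C>0. \<forall>R>0. \<forall>f\<in>L2.
           spec f \<subseteq> nbhd \<beta> ((\<lambda>x. R *\<^sub>R x) ` \<Sigma>) \<longrightarrow>
           L2_norm_on UNIV f \<le> C * L2_norm_on (nbhd \<delta> E) f"
proof (intro allI impI)
  fix \<delta> \<beta> :: real assume \<delta>: "\<delta> > 0" and \<beta>: "\<beta> > 0"
  obtain l \<gamma> where l: "l > 0" "\<gamma> > 0" "GCC_params k l \<gamma> E" using assms(5) unfolding GCC_def by blast
  have "2 * \<beta> > 0" using \<beta> by simp
  from L12_estimate[OF assms(3) less_imp_le[OF assms(2)] GCC_relatively_dense[OF l(3,1,2) assms(1)] l(1) \<delta> this]
  obtain C where C: "C > 0" and est: "\<And>R f. R > 0 \<Longrightarrow> L12 f \<Longrightarrow>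
     (\<And>\<zeta>. ft f \<zeta> \<noteq> 0 \<Longrightarrow> \<zeta> \<in> nbhd (2 * \<beta>) ((\<lambda>x. R *\<^sub>R x) ` \<Sigma>)) \<Longrightarrow>
     (\<integral>x. (cmod (f x))\<^sup>2 \<partial>lborel) \<le> C * (\<integral>x. indicator (nbhd \<delta> E) x * (cmod (f x))\<^sup>2 \<partial>lborel)" by blast
  show "\<exists>C>0. \<forall>R>0. \<forall>f\<in>L2. spec f \<subseteq> nbhd \<beta> ((\<lambda>x. R *\<^sub>R x) ` \<Sigma>) \<longrightarrow>
           L2_norm_on UNIV f \<le> C * L2_norm_on (nbhd \<delta> E) f"
  \<comment> \<open>The square root appears because the estimate behind it compares squared
    norms.\<close>
  proof (intro exI[of _ "sqrt C"] conjI allI impI ballI)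
    show "sqrt C > 0" using C by simp
    fix R :: real and f :: "real^'d \<Rightarrow> complex"
    let ?S = "(\<lambda>x. R *\<^sub>R x) ` \<Sigma>"
    assume R: "R > 0" and f: "f \<in> L2" and spec: "spec f \<subseteq> nbhd \<beta> ?S"
    have fm: "f \<in> borel_measurable lebesgue" and f2: "integrable lebesgue (\<lambda>x. (cmod (f x))\<^sup>2)"
      using f by (auto simp: L2_def)
    obtain g where gm: "g \<in> borel_measurable borel" and ae: "AE x in lborel. f x = g x"
      using lebesgue_borel_version[OF fm] .
    note [measurable] = gm
    have gl: "g \<in> borel_measurable lebesgue" using gm by (auto intro: measurable_completion)
    have "integrable lebesgue (\<lambda>x. (cmod (g x))\<^sup>2)"
      by (rule Bochner_Integration.integrable_cong_AE_imp[OF f2])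
        (use gl AE_completion[OF ae] in auto)
    then have g2: "integrable lborel (\<lambda>x. (cmod (g x))\<^sup>2)"
      by (subst (asm) integrable_completion) auto
    \<comment> \<open>Transfers the condition defining \<open>spec\<close> from f to its Borel
      version g, to which the L^2 estimate applies.\<close>
    have pairing: "(\<integral>x. f x * fourier \<psi> x \<partial>lebesgue) = (\<integral>x. g x * ft \<psi> x \<partial>lborel)"
      if \<psi>: "continuous_on UNIV \<psi>" for \<psi> :: "real^'d \<Rightarrow> complex"
    proof -
      have [measurable]: "\<psi> \<in> borel_measurable borel" using \<psi> by (rule borel_measurable_continuous_onI)
      have ftl: "ft \<psi> \<in> borel_measurable lebesgue" by (rule measurable_completion) simp
      have "(\<integral>x. f x * fourier \<psi> x \<partial>lebesgue) = (\<integral>x. g x * ft \<psi> x \<partial>lebesgue)"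
        using AE_completion[OF ae] fm gl ftl
        by (subst fourier_eq_ft) (auto intro!: integral_cong_AE)
      also have "\<dots> = (\<integral>x. g x * ft \<psi> x \<partial>lborel)" by (rule integral_completion) measurable
      finally show ?thesis .
    qed
    have "(\<integral>x. (cmod (g x))\<^sup>2 \<partial>lborel) \<le> C * (\<integral>x. indicator (nbhd \<delta> E) x * (cmod (g x))\<^sup>2 \<partial>lborel)"
    proof (rule L2_estimate_of_L12_estimate[OF gm g2 _ _ \<beta> est[OF R]])
      fix \<psi> :: "real^'d \<Rightarrow> complex" and K :: "(real^'d) set"
      assume \<psi>: "continuous_on UNIV \<psi>" "compact K" "\<And>x. x \<notin> K \<Longrightarrow> \<psi> x = 0" and disj: "K \<inter> nbhd \<beta> ?S = {}"
      show "(\<integral>x. g x * ft \<psi> x \<partial>lborel) = 0"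
      proof (rule pairing_vanishes[OF gm g2 \<psi>(2,1,3)])
        fix \<xi> assume "\<xi> \<in> K"
        then have "\<xi> \<notin> spec f" using disj spec by blast
        from this[unfolded spec_def Compl_iff mem_Collect_eq not_not]
        obtain V where V: "open V" "\<xi> \<in> V" and z: "\<forall>\<psi>. continuous_on UNIV \<psi> \<and>
            (\<exists>K. compact K \<and> K \<subseteq> V \<and> (\<forall>\<eta>. \<eta> \<notin> K \<longrightarrow> \<psi> \<eta> = 0)) \<longrightarrow> (\<integral>x. f x * fourier \<psi> x \<partial>lebesgue) = 0"
          by (elim exE conjE) (rule that)
        show "\<exists>V. open V \<and> \<xi> \<in> V \<and> (\<forall>\<phi> L. continuous_on UNIV \<phi> \<longrightarrow> compact L \<longrightarrow> L \<subseteq> V \<longrightarrow>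
            (\<forall>x. x \<notin> L \<longrightarrow> \<phi> x = 0) \<longrightarrow> (\<integral>x. g x * ft \<phi> x \<partial>lborel) = 0)"
        proof (intro exI[of _ V] conjI allI impI V)
          fix \<phi> :: "real^'d \<Rightarrow> complex" and L
          assume \<phi>: "continuous_on UNIV \<phi>" and L: "compact L" "L \<subseteq> V" "\<forall>x. x \<notin> L \<longrightarrow> \<phi> x = 0"
          have "(\<integral>x. f x * fourier \<phi> x \<partial>lebesgue) = 0"
            by (rule z[rule_format]) (use \<phi> L in blast)
          then show "(\<integral>x. g x * ft \<phi> x \<partial>lborel) = 0" by (simp add: pairing[OF \<phi>])
        qed
      qed
    qed (use C in auto)
    then have "sqrt (\<integral>x. indicator UNIV x * (cmod (g x))\<^sup>2 \<partial>lborel) \<le> sqrt (C * (\<integral>x. indicator (nbhd \<delta> E) x * (cmod (g x))\<^sup>2 \<partial>lborel))"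
      by simp
    then show "L2_norm_on UNIV f \<le> sqrt C * L2_norm_on (nbhd \<delta> E) f"
      by (simp add: L2_norm_on_borel_version[OF fm gm ae] real_sqrt_mult)
  qed
qed

end
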